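(* Let $A=U_\zeta^0(\mathfrak{sl}(2))$. Then, up to a scalar multiple, $A$ has a unique (nonzero) primitive element, namely $$\binom{K}{\ell}+\sum_{i=0}^{\ell-1}a_iK^i,\qquad\text{where } a_i=\frac1{\ell^2}\sum_{j=0}^{\ell-1}j\,\zeta^{-ij},\quad i=0,1,\dots,\ell-1.$$
   Context: Let $k$ be a field of characteristic $0$ containing a primitive $\ell$-th root of unity $\zeta$, $\ell>1$ odd. Let $U_q(\mathfrak{sl}(2))$ be the quantized enveloping algebra over $\mathbb Q(q)$, with generators $E,F,K^{\pm1}$ ($KEK^{-1}=q^2E$, $KFK^{-1}=q^{-2}F$, $EF-FE=(K-K^{-1})/(q-q^{-1})$, $\Delta K=K\otimes K$, $\Delta E=E\otimes K+1\otimes E$, $\Delta F=F\otimes1+K^{-1}\otimes F$). Lusztig's form is the $\mathbb Z[q,q^{-1}]$-subalgebra generated by $K^{\pm1}$ and the divided powers $E^t/[t]_q!$, $F^t/[t]_q!$, where $[t]_q!=\prod_{s=1}^t(q^s-q^{-s})/(q-q^{-1})$. $U_\zeta(\mathfrak{sl}(2))$ is the Hopf $k$-algebra obtained from it by specializing $q\mapsto\zeta$ and imposing $K^\ell=1$. The element $\binom K\ell$ is the image in it of $\prod_{s=1}^{\ell}\frac{Kq^{1-s}-K^{-1}q^{s-1}}{q^s-q^{-s}}$, and $U_\zeta^0(\mathfrak{sl}(2))$ is the Hopf subalgebra generated by $K$ and $\binom K\ell$. An element $x$ is primitive if $\Delta(x)=x\otimes1+1\otimes x$. *)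

theory Defs
  imports
    "HOL-Computational_Algebra.Polynomial"
    "HOL-Computational_Algebra.Fraction_Field"
    "HOL-Library.Poly_Mapping"
    "HOL-Algebra.QuotRing"
    "HOL-Algebra.Module"
begin

section \<open>Algebras, tensor products and extension of scalars\<close>

text \<open>
  Throughout, a (not necessarily commutative) algebra over a commutative ring given by a type
  \<open>'r\<close> is a record of type \<^typ>\<open>('r, 'm) module\<close>; its ring of scalars is all of \<open>'r\<close>.
\<close>

abbreviation sg :: "'g \<Rightarrow> 'r \<Rightarrow> ('g \<Rightarrow>\<^sub>0 'r::zero)" where
  "sg \<equiv> Poly_Mapping.single"

definition monoid_algebra ::
  "('g, 'z) monoid_scheme \<Rightarrow> ('r::comm_ring_1, 'g \<Rightarrow>\<^sub>0 'r) module" where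
  "monoid_algebra G =
    \<lparr>carrier = {f. Poly_Mapping.keys f \<subseteq> carrier G},
     monoid.mult = (\<lambda>f g. \<Sum>x\<in>Poly_Mapping.keys f. \<Sum>y\<in>Poly_Mapping.keys g.
       sg (x \<otimes>\<^bsub>G\<^esub> y) (Poly_Mapping.lookup f x * Poly_Mapping.lookup g y)),
     one = sg \<one>\<^bsub>G\<^esub> 1,
     zero = 0,
     add = (+),
     module.smult = (\<lambda>r. Poly_Mapping.map ((*) r))\<rparr>"

definition quot_alg :: "('r, 'm) module \<Rightarrow> 'm set \<Rightarrow> ('r, 'm set) module" where
  "quot_alg M S = (let I = Idl\<^bsub>M\<^esub> S in
    \<lparr>carrier = carrier (M Quot I),
     monoid.mult = mult (M Quot I),
     one = one (M Quot I),
     zero = zero (M Quot I),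
     add = add (M Quot I),
     module.smult = (\<lambda>r X. \<Union>x\<in>X. I +>\<^bsub>M\<^esub> (r \<odot>\<^bsub>M\<^esub> x))\<rparr>)"

definition quot_map :: "('r, 'm) module \<Rightarrow> 'm set \<Rightarrow> 'm \<Rightarrow> 'm set" where
  "quot_map M S x = (Idl\<^bsub>M\<^esub> S) +>\<^bsub>M\<^esub> x"

definition opposite_alg :: "('r, 'm) module \<Rightarrow> ('r, 'm) module" where
  "opposite_alg M = M\<lparr>monoid.mult := (\<lambda>x y. y \<otimes>\<^bsub>M\<^esub> x)\<rparr>"

definition restrict_scalars :: "('s \<Rightarrow> 'r) \<Rightarrow> ('r, 'm) module \<Rightarrow> ('s, 'm) module" where
  "restrict_scalars \<phi> M =
    \<lparr>carrier = carrier M, monoid.mult = mult M, one = one M, zero = zero M, add = add M,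
     module.smult = (\<lambda>a x. \<phi> a \<odot>\<^bsub>M\<^esub> x)\<rparr>"

inductive_set subalg_gen :: "('r, 'm) module \<Rightarrow> 'm set \<Rightarrow> 'm set"
  for M :: "('r, 'm) module" and S :: "'m set" where
  gen: "x \<in> S \<Longrightarrow> x \<in> subalg_gen M S"
| one: "\<one>\<^bsub>M\<^esub> \<in> subalg_gen M S"
| add: "x \<in> subalg_gen M S \<Longrightarrow> y \<in> subalg_gen M S \<Longrightarrow> x \<oplus>\<^bsub>M\<^esub> y \<in> subalg_gen M S"
| mult: "x \<in> subalg_gen M S \<Longrightarrow> y \<in> subalg_gen M S \<Longrightarrow> x \<otimes>\<^bsub>M\<^esub> y \<in> subalg_gen M S"
| smult: "x \<in> subalg_gen M S \<Longrightarrow> r \<odot>\<^bsub>M\<^esub> x \<in> subalg_gen M S"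

text \<open>
  The tensor product of two algebras is the free module on pairs (with the multiplication of
  the direct product, hence a monoid algebra) modulo the bilinearity relations.
\<close>

definition bilinear_rels ::
  "('r::comm_ring_1, 'm) module \<Rightarrow> ('r, 'n) module \<Rightarrow> ('m \<times> 'n \<Rightarrow>\<^sub>0 'r) set" where
  "bilinear_rels M N =
    {sg (x \<oplus>\<^bsub>M\<^esub> x', y) 1 - sg (x, y) 1 - sg (x', y) 1 | x x' y.
      x \<in> carrier M \<and> x' \<in> carrier M \<and> y \<in> carrier N} \<union>
    {sg (x, y \<oplus>\<^bsub>N\<^esub> y') 1 - sg (x, y) 1 - sg (x, y') 1 | x y y'.
      x \<in> carrier M \<and> y \<in> carrier N \<and> y' \<in> carrier N} \<union>
    {sg (r \<odot>\<^bsub>M\<^esub> x, y) 1 - sg (x, y) r | r x y. x \<in> carrier M \<and> y \<in> carrier N} \<union>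
    {sg (x, r \<odot>\<^bsub>N\<^esub> y) 1 - sg (x, y) r | r x y. x \<in> carrier M \<and> y \<in> carrier N}"

definition tensor ::
  "('r::comm_ring_1, 'm) module \<Rightarrow> ('r, 'n) module \<Rightarrow> ('r, ('m \<times> 'n \<Rightarrow>\<^sub>0 'r) set) module" where
  "tensor M N = quot_alg (monoid_algebra (M \<times>\<times> N)) (bilinear_rels M N)"

definition tens ::
  "('r::comm_ring_1, 'm) module \<Rightarrow> ('r, 'n) module \<Rightarrow> 'm \<Rightarrow> 'n \<Rightarrow> ('m \<times> 'n \<Rightarrow>\<^sub>0 'r) set" where
  "tens M N x y = quot_map (monoid_algebra (M \<times>\<times> N)) (bilinear_rels M N) (sg (x, y) 1)"

definition tens_sum ::
  "('r::comm_ring_1, 'm) module \<Rightarrow> ('r, 'n) module \<Rightarrow> ('m \<times> 'n) list \<Rightarrow> ('m \<times> 'n \<Rightarrow>\<^sub>0 'r) set" where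
  "tens_sum M N ps = foldr (\<lambda>(x, y) t. tens M N x y \<oplus>\<^bsub>tensor M N\<^esub> t) ps \<zero>\<^bsub>tensor M N\<^esub>"

text \<open>
  Extension of scalars of \<open>M\<close> along a ring homomorphism \<open>\<phi>\<close>, i.e. the tensor product of \<open>M\<close>
  with the target of \<open>\<phi>\<close>, presented as the target's free module on the elements of \<open>M\<close> modulo
  the relations \<open>[x + y] = [x] + [y]\<close> and \<open>[a x] = \<phi>(a) [x]\<close>.
\<close>

definition extend_scalars_rels ::
  "('s \<Rightarrow> 'r::comm_ring_1) \<Rightarrow> ('s, 'm) module \<Rightarrow> ('m \<Rightarrow>\<^sub>0 'r) set" where
  "extend_scalars_rels \<phi> M =
    {sg (x \<oplus>\<^bsub>M\<^esub> y) 1 - sg x 1 - sg y 1 | x y. x \<in> carrier M \<and> y \<in> carrier M} \<union>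
    {sg (a \<odot>\<^bsub>M\<^esub> x) 1 - sg x (\<phi> a) | a x. x \<in> carrier M}"

definition extend_scalars ::
  "('s \<Rightarrow> 'r::comm_ring_1) \<Rightarrow> ('s, 'm) module \<Rightarrow> ('r, ('m \<Rightarrow>\<^sub>0 'r) set) module" where
  "extend_scalars \<phi> M = quot_alg (monoid_algebra M) (extend_scalars_rels \<phi> M)"

definition extend_scalars_map ::
  "('s \<Rightarrow> 'r::comm_ring_1) \<Rightarrow> ('s, 'm) module \<Rightarrow> 'm \<Rightarrow> ('m \<Rightarrow>\<^sub>0 'r) set" where
  "extend_scalars_map \<phi> M x = quot_map (monoid_algebra M) (extend_scalars_rels \<phi> M) (sg x 1)"


section \<open>The quantized enveloping algebra over the rational function field\<close>

type_synonym ratfun = "rat poly fract"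

definition qq :: ratfun where
  "qq = Fract [:0, 1:] 1"

datatype gen = GE | GF | GK | GKi

type_synonym uq = "(gen list \<Rightarrow>\<^sub>0 ratfun) set"

definition free_monoid :: "gen list monoid" where
  "free_monoid = \<lparr>carrier = UNIV, monoid.mult = (@), one = []\<rparr>"

definition free_alg :: "(ratfun, gen list \<Rightarrow>\<^sub>0 ratfun) module" where
  "free_alg = monoid_algebra free_monoid"

definition uq_rels :: "(gen list \<Rightarrow>\<^sub>0 ratfun) set" where
  "uq_rels =
    {sg [GK, GKi] 1 - sg [] 1,
     sg [GKi, GK] 1 - sg [] 1,
     sg [GK, GE, GKi] 1 - sg [GE] (qq powi 2),
     sg [GK, GF, GKi] 1 - sg [GF] (qq powi (-2)),
     sg [GE, GF] 1 - sg [GF, GE] 1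
       - (sg [GK] (1 / (qq - inverse qq)) - sg [GKi] (1 / (qq - inverse qq)))}"

definition Uq :: "(ratfun, uq) module" where
  "Uq = quot_alg free_alg uq_rels"

definition ug :: "gen \<Rightarrow> uq" where
  "ug g = quot_map free_alg uq_rels (sg [g] 1)"

definition free_eval :: "(ratfun, 'm) module \<Rightarrow> (gen \<Rightarrow> 'm) \<Rightarrow> (gen list \<Rightarrow>\<^sub>0 ratfun) \<Rightarrow> 'm" where
  "free_eval N h f = (\<Oplus>\<^bsub>N\<^esub>w\<in>Poly_Mapping.keys f.
     Poly_Mapping.lookup f w \<odot>\<^bsub>N\<^esub> foldr (\<lambda>g x. h g \<otimes>\<^bsub>N\<^esub> x) w \<one>\<^bsub>N\<^esub>)"

text \<open>
  The algebra homomorphism \<open>Uq \<rightarrow> N\<close> with given values on the generators: if these values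
  satisfy the defining relations, \<^const>\<open>free_eval\<close> is constant on every class \<open>X\<close>.
\<close>

definition uq_hom :: "(ratfun, 'm) module \<Rightarrow> (gen \<Rightarrow> 'm) \<Rightarrow> uq \<Rightarrow> 'm" where
  "uq_hom N h X = the_elem (free_eval N h ` X)"

definition uq_comult :: "uq \<Rightarrow> (uq \<times> uq \<Rightarrow>\<^sub>0 ratfun) set" where
  "uq_comult = uq_hom (tensor Uq Uq) (\<lambda>g. case g of
       GE \<Rightarrow> tens Uq Uq (ug GE) (ug GK) \<oplus>\<^bsub>tensor Uq Uq\<^esub> tens Uq Uq \<one>\<^bsub>Uq\<^esub> (ug GE)
     | GF \<Rightarrow> tens Uq Uq (ug GF) \<one>\<^bsub>Uq\<^esub> \<oplus>\<^bsub>tensor Uq Uq\<^esub> tens Uq Uq (ug GKi) (ug GF)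
     | GK \<Rightarrow> tens Uq Uq (ug GK) (ug GK)
     | GKi \<Rightarrow> tens Uq Uq (ug GKi) (ug GKi))"

text \<open>
  The antipode is an anti-homomorphism; its values on the generators are forced by the
  comultiplication above (\<open>S E = - E K\<^sup>-\<^sup>1\<close>, \<open>S F = - K F\<close>).
\<close>

definition uq_antipode :: "uq \<Rightarrow> uq" where
  "uq_antipode = uq_hom (opposite_alg Uq) (\<lambda>g. case g of
       GE \<Rightarrow> \<ominus>\<^bsub>Uq\<^esub> (ug GE \<otimes>\<^bsub>Uq\<^esub> ug GKi)
     | GF \<Rightarrow> \<ominus>\<^bsub>Uq\<^esub> (ug GK \<otimes>\<^bsub>Uq\<^esub> ug GF)
     | GK \<Rightarrow> ug GKi
     | GKi \<Rightarrow> ug GK)"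


section \<open>Lusztig's form\<close>

text \<open>Integral Laurent polynomials, indexed by their exponents, and their evaluation.\<close>

type_synonym laurent = "int \<Rightarrow>\<^sub>0 int"

definition laurent_eval :: "'a::field \<Rightarrow> laurent \<Rightarrow> 'a" where
  "laurent_eval x a =
    (\<Sum>n\<in>Poly_Mapping.keys a. of_int (Poly_Mapping.lookup a n) * x powi n)"

definition qfact :: "nat \<Rightarrow> ratfun" where
  "qfact t = (\<Prod>s=1..t. (qq powi int s - qq powi (- int s)) / (qq - inverse qq))"

definition divided_power :: "gen \<Rightarrow> nat \<Rightarrow> uq" where
  "divided_power g t = inverse (qfact t) \<odot>\<^bsub>Uq\<^esub> (ug g [^]\<^bsub>Uq\<^esub> t)"

definition lusztig_form :: "(laurent, uq) module" where
  "lusztig_form = (let U = restrict_scalars (laurent_eval qq) Uq in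
    U\<lparr>carrier := subalg_gen U
      ({ug GK, ug GKi} \<union> range (divided_power GE) \<union> range (divided_power GF))\<rparr>)"

definition uq_Kbinom :: "nat \<Rightarrow> uq" where
  "uq_Kbinom l = foldr
     (\<lambda>s x. ((1 / (qq powi int s - qq powi (- int s))) \<odot>\<^bsub>Uq\<^esub>
              ((qq powi (1 - int s) \<odot>\<^bsub>Uq\<^esub> ug GK) \<ominus>\<^bsub>Uq\<^esub> (qq powi (int s - 1) \<odot>\<^bsub>Uq\<^esub> ug GKi)))
            \<otimes>\<^bsub>Uq\<^esub> x)
     [1..<Suc l] \<one>\<^bsub>Uq\<^esub>"


section \<open>The specialization at a root of unity\<close>

type_synonym 'k uz = "(uq \<Rightarrow>\<^sub>0 'k) set set"

definition uz_rels :: "'k::field \<Rightarrow> nat \<Rightarrow> (uq \<Rightarrow>\<^sub>0 'k) set set" where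
  "uz_rels \<zeta> l = (let B = extend_scalars (laurent_eval \<zeta>) lusztig_form in
    {extend_scalars_map (laurent_eval \<zeta>) lusztig_form (ug GK) [^]\<^bsub>B\<^esub> l \<ominus>\<^bsub>B\<^esub> \<one>\<^bsub>B\<^esub>})"

definition Uz :: "'k::field \<Rightarrow> nat \<Rightarrow> ('k, 'k uz) module" where
  "Uz \<zeta> l = quot_alg (extend_scalars (laurent_eval \<zeta>) lusztig_form) (uz_rels \<zeta> l)"

text \<open>The canonical map from Lusztig's form to its specialization.\<close>

definition spec :: "'k::field \<Rightarrow> nat \<Rightarrow> uq \<Rightarrow> 'k uz" where
  "spec \<zeta> l u = quot_map (extend_scalars (laurent_eval \<zeta>) lusztig_form) (uz_rels \<zeta> l)
     (extend_scalars_map (laurent_eval \<zeta>) lusztig_form u)"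

text \<open>
  The graphs of the comultiplication and of the antipode of the specialization, i.e. of the
  linear maps induced by those of \<^const>\<open>Uq\<close>. For \<open>u\<close> in Lusztig's form, the comultiplication
  of \<open>u\<close> is a sum of tensors \<open>y \<otimes> z\<close> with \<open>y, z\<close> in Lusztig's form, and the image of \<open>u\<close> in the
  specialization is sent to the sum of the tensors of the images of \<open>y\<close> and \<open>z\<close>. (The first
  relation is single-valued because Lusztig's form is free over the Laurent polynomials.)
\<close>

inductive_set uz_comult :: "'k::field \<Rightarrow> nat \<Rightarrow> ('k uz \<times> ('k uz \<times> 'k uz \<Rightarrow>\<^sub>0 'k) set) set"
  for \<zeta> :: "'k::field" and l :: nat where
  base: "\<lbrakk>u \<in> carrier lusztig_form;
          set ps \<subseteq> carrier lusztig_form \<times> carrier lusztig_form;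
          uq_comult u = tens_sum Uq Uq ps\<rbrakk> \<Longrightarrow>
    (spec \<zeta> l u, tens_sum (Uz \<zeta> l) (Uz \<zeta> l) (map (map_prod (spec \<zeta> l) (spec \<zeta> l)) ps))
      \<in> uz_comult \<zeta> l"
| add: "\<lbrakk>(x, t) \<in> uz_comult \<zeta> l; (x', t') \<in> uz_comult \<zeta> l\<rbrakk> \<Longrightarrow>
    (x \<oplus>\<^bsub>Uz \<zeta> l\<^esub> x', t \<oplus>\<^bsub>tensor (Uz \<zeta> l) (Uz \<zeta> l)\<^esub> t') \<in> uz_comult \<zeta> l"
| smult: "(x, t) \<in> uz_comult \<zeta> l \<Longrightarrow>
    (c \<odot>\<^bsub>Uz \<zeta> l\<^esub> x, c \<odot>\<^bsub>tensor (Uz \<zeta> l) (Uz \<zeta> l)\<^esub> t) \<in> uz_comult \<zeta> l"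

inductive_set uz_antipode :: "'k::field \<Rightarrow> nat \<Rightarrow> ('k uz \<times> 'k uz) set"
  for \<zeta> :: "'k::field" and l :: nat where
  base: "\<lbrakk>u \<in> carrier lusztig_form; uq_antipode u \<in> carrier lusztig_form\<rbrakk> \<Longrightarrow>
    (spec \<zeta> l u, spec \<zeta> l (uq_antipode u)) \<in> uz_antipode \<zeta> l"
| add: "\<lbrakk>(x, y) \<in> uz_antipode \<zeta> l; (x', y') \<in> uz_antipode \<zeta> l\<rbrakk> \<Longrightarrow>
    (x \<oplus>\<^bsub>Uz \<zeta> l\<^esub> x', y \<oplus>\<^bsub>Uz \<zeta> l\<^esub> y') \<in> uz_antipode \<zeta> l"
| smult: "(x, y) \<in> uz_antipode \<zeta> l \<Longrightarrow>
    (c \<odot>\<^bsub>Uz \<zeta> l\<^esub> x, c \<odot>\<^bsub>Uz \<zeta> l\<^esub> y) \<in> uz_antipode \<zeta> l"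

text \<open>For a subspace \<open>B\<close>, the subspace \<open>B \<otimes> B\<close> of the tensor square.\<close>

definition uz_tensor_square ::
  "'k::field \<Rightarrow> nat \<Rightarrow> 'k uz set \<Rightarrow> ('k uz \<times> 'k uz \<Rightarrow>\<^sub>0 'k) set set" where
  "uz_tensor_square \<zeta> l B = {tens_sum (Uz \<zeta> l) (Uz \<zeta> l) ps | ps. set ps \<subseteq> B \<times> B}"

definition hopf_subalgebra :: "'k::field \<Rightarrow> nat \<Rightarrow> 'k uz set \<Rightarrow> bool" where
  "hopf_subalgebra \<zeta> l B \<longleftrightarrow>
     B \<subseteq> carrier (Uz \<zeta> l) \<and>
     \<one>\<^bsub>Uz \<zeta> l\<^esub> \<in> B \<and>
     (\<forall>x\<in>B. \<forall>y\<in>B. x \<oplus>\<^bsub>Uz \<zeta> l\<^esub> y \<in> B) \<and>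
     (\<forall>x\<in>B. \<forall>y\<in>B. x \<otimes>\<^bsub>Uz \<zeta> l\<^esub> y \<in> B) \<and>
     (\<forall>c. \<forall>x\<in>B. c \<odot>\<^bsub>Uz \<zeta> l\<^esub> x \<in> B) \<and>
     (\<forall>x\<in>B. \<exists>t\<in>uz_tensor_square \<zeta> l B. (x, t) \<in> uz_comult \<zeta> l) \<and>
     (\<forall>x\<in>B. \<exists>y\<in>B. (x, y) \<in> uz_antipode \<zeta> l)"

definition uz_K :: "'k::field \<Rightarrow> nat \<Rightarrow> 'k uz" where
  "uz_K \<zeta> l = spec \<zeta> l (ug GK)"

definition uz_Kbinom :: "'k::field \<Rightarrow> nat \<Rightarrow> 'k uz" where
  "uz_Kbinom \<zeta> l = spec \<zeta> l (uq_Kbinom l)"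

definition Uz0 :: "'k::field \<Rightarrow> nat \<Rightarrow> ('k, 'k uz) module" where
  "Uz0 \<zeta> l = (Uz \<zeta> l)\<lparr>carrier :=
     \<Inter>{B. hopf_subalgebra \<zeta> l B \<and> uz_K \<zeta> l \<in> B \<and> uz_Kbinom \<zeta> l \<in> B}\<rparr>"

text \<open>
  The comultiplication of \<^const>\<open>Uz0\<close>, the restriction of that of \<^const>\<open>Uz\<close>. Its values lie
  in the tensor square of \<^const>\<open>Uz0\<close>, viewed inside the tensor square of \<^const>\<open>Uz\<close>.
\<close>

definition uz0_comult :: "'k::field \<Rightarrow> nat \<Rightarrow> 'k uz \<Rightarrow> ('k uz \<times> 'k uz \<Rightarrow>\<^sub>0 'k) set" where
  "uz0_comult \<zeta> l x =
     (THE t. t \<in> uz_tensor_square \<zeta> l (carrier (Uz0 \<zeta> l)) \<and> (x, t) \<in> uz_comult \<zeta> l)"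

definition uz0_primitive :: "'k::field \<Rightarrow> nat \<Rightarrow> 'k uz \<Rightarrow> bool" where
  "uz0_primitive \<zeta> l x \<longleftrightarrow> x \<in> carrier (Uz0 \<zeta> l) \<and>
     uz0_comult \<zeta> l x =
       tens (Uz \<zeta> l) (Uz \<zeta> l) x \<one>\<^bsub>Uz \<zeta> l\<^esub>
         \<oplus>\<^bsub>tensor (Uz \<zeta> l) (Uz \<zeta> l)\<^esub> tens (Uz \<zeta> l) (Uz \<zeta> l) \<one>\<^bsub>Uz \<zeta> l\<^esub> x"

end

theory Submission
  imports Defs
begin

text \<open>
  For an integer \<open>N\<close> let \<open>f\<^sub>N u\<close> be the coefficient of the highest weight vector \<open>v\<close> in \<open>u v\<close>, in the
  Verma module of highest weight \<open>N\<close>. Divided powers act by Gaussian binomials, so \<open>f\<^sub>N\<close> is integral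
  on Lusztig's form and descends to the specialization. Since \<open>v \<otimes> v'\<close> is a highest weight vector
  of weight \<open>n + m\<close>, one has \<open>(f\<^sub>n \<otimes> f\<^sub>m) \<circ> \<Delta> = f\<^sub>n\<^sub>+\<^sub>m\<close>.

  On the subalgebra generated by \<open>K\<close> and \<open>b = [K; 0 choose l]\<close>, every \<open>f\<^sub>N\<close> is multiplicative with
  \<open>f\<^sub>N K = \<zeta>\<^sup>N\<close> and \<open>f\<^sub>N b = N div l\<close>. The Fourier sum \<open>\<Sum> a\<^sub>i K\<^sup>i\<close> takes the value \<open>(N mod l) / l\<close>,
  so the element \<open>p\<close> of the theorem satisfies \<open>f\<^sub>N p = N / l\<close>. The functionals \<open>f\<^sub>N\<close> separate the spanning
  elements \<open>K\<^sup>i p\<^sup>j\<close> with \<open>i < l\<close>, and the \<open>f\<^sub>n \<otimes> f\<^sub>m\<close> separate their tensors. In particular the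
  comultiplication is single-valued there, and \<open>x\<close> is primitive if and only if \<open>N \<mapsto> f\<^sub>N x\<close> is
  additive, that is, \<open>f\<^sub>N x = N f\<^sub>1 x\<close>.

  That the subalgebra is closed under comultiplication and antipode rests on the commutation
  formula for divided powers, which puts \<open>[K; c choose t]\<close> into Lusztig's form, and on the
  \<open>q\<close>-Vandermonde identity for the comultiplication of \<open>b\<close>.
\<close>


section \<open>Algebras over a commutative ring\<close>

text \<open>No basis of the quantized enveloping algebra, of Lusztig's form or of the whole
  specialization is constructed. Whatever must not collapse is detected by functionals, which exist
  because the explicit operators \<open>rho N\<close> satisfy the defining relations. Accordingly
  the comultiplication of the specialization, given as a relation, is not shown to be a function
  everywhere. All its values at one element agree under every f_n \<otimes> f_m, and this decides
  equality inside the tensor square of the small subalgebra.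

  Oddness of l makes \<zeta>^s - \<zeta>^-s invertible for 0 < s < l, so that below l nothing new
  has to be adjoined to K, and it gives (-1)^(l-1) = 1, so that f_N b = N div l comes without a
  sign. Characteristic 0 makes l invertible and provides infinitely many values N / l, so that a
  polynomial in N / l is determined by them. Of the two factors 1 / l in a_i, one is Fourier
  inversion on Z/l; the other belongs to (N mod l) / l, the fractional part that completes N div l
  to N / l.\<close>

locale algebra_over = ring M for M :: "('r::comm_ring_1, 'm) module" (structure) +
  assumes smult_closed [simp, intro]: "x \<in> carrier M \<Longrightarrow> a \<odot> x \<in> carrier M"
    and smult_l_distr: "x \<in> carrier M \<Longrightarrow> (a + b) \<odot> x = a \<odot> x \<oplus> b \<odot> x"
    and smult_r_distr: "x \<in> carrier M \<Longrightarrow> y \<in> carrier M \<Longrightarrow> a \<odot> (x \<oplus> y) = a \<odot> x \<oplus> a \<odot> y"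
    and smult_assoc: "x \<in> carrier M \<Longrightarrow> (a * b) \<odot> x = a \<odot> (b \<odot> x)"
    and smult_one [simp]: "x \<in> carrier M \<Longrightarrow> 1 \<odot> x = x"
    and smult_mult_l: "x \<in> carrier M \<Longrightarrow> y \<in> carrier M \<Longrightarrow> (a \<odot> x) \<otimes> y = a \<odot> (x \<otimes> y)"
    and smult_mult_r: "x \<in> carrier M \<Longrightarrow> y \<in> carrier M \<Longrightarrow> x \<otimes> (a \<odot> y) = a \<odot> (x \<otimes> y)"
begin

lemma smult_zero_l [simp]: "x \<in> carrier M \<Longrightarrow> 0 \<odot> x = \<zero>"
proof -
  assume x: "x \<in> carrier M"
  have "0 \<odot> x \<oplus> 0 \<odot> x = 0 \<odot> x \<oplus> \<zero>" using smult_l_distr[OF x, of 0 0] x by simp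
  then show ?thesis using x by (metis add.l_cancel_one' r_zero smult_closed)
qed

lemma smult_zero_r [simp]: "a \<odot> \<zero> = \<zero>"
proof -
  have "a \<odot> \<zero> \<oplus> a \<odot> \<zero> = a \<odot> \<zero> \<oplus> \<zero>" using smult_r_distr[of \<zero> \<zero> a] by simp
  then show ?thesis by (metis add.l_cancel_one' r_zero smult_closed zero_closed)
qed

lemma smult_minus_one: "x \<in> carrier M \<Longrightarrow> (- 1) \<odot> x = \<ominus> x"
proof -
  assume x: "x \<in> carrier M"
  have "(- 1) \<odot> x \<oplus> x = \<zero>" using smult_l_distr[OF x, of "- 1" 1] x by simp
  then show ?thesis using x by (simp add: minus_equality)
qed

lemma smult_as_mult: "x \<in> carrier M \<Longrightarrow> a \<odot> x = (a \<odot> \<one>) \<otimes> x"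
  by (simp add: smult_mult_l)

end

text \<open>The negative of \<open>x\<close> is supplied as \<open>(- 1) \<odot> x\<close>, so
  existence of additive inverses becomes one more equation between closed operations.\<close>

lemma algebra_overI:
  fixes M :: "('r::comm_ring_1, 'm) module" (structure)
  assumes "\<And>x y. \<lbrakk> x \<in> carrier M; y \<in> carrier M \<rbrakk> \<Longrightarrow> x \<oplus> y \<in> carrier M"
    "\<zero> \<in> carrier M"
    "\<And>x y z. \<lbrakk> x \<in> carrier M; y \<in> carrier M; z \<in> carrier M \<rbrakk> \<Longrightarrow> (x \<oplus> y) \<oplus> z = x \<oplus> (y \<oplus> z)"
    "\<And>x y. \<lbrakk> x \<in> carrier M; y \<in> carrier M \<rbrakk> \<Longrightarrow> x \<oplus> y = y \<oplus> x"
    "\<And>x. x \<in> carrier M \<Longrightarrow> \<zero> \<oplus> x = x"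
    "\<And>x. x \<in> carrier M \<Longrightarrow> (- 1) \<odot> x \<oplus> x = \<zero>"
    "\<And>x y. \<lbrakk> x \<in> carrier M; y \<in> carrier M \<rbrakk> \<Longrightarrow> x \<otimes> y \<in> carrier M"
    "\<one> \<in> carrier M"
    "\<And>x y z. \<lbrakk> x \<in> carrier M; y \<in> carrier M; z \<in> carrier M \<rbrakk> \<Longrightarrow> (x \<otimes> y) \<otimes> z = x \<otimes> (y \<otimes> z)"
    "\<And>x. x \<in> carrier M \<Longrightarrow> \<one> \<otimes> x = x" "\<And>x. x \<in> carrier M \<Longrightarrow> x \<otimes> \<one> = x"
    "\<And>x y z. \<lbrakk> x \<in> carrier M; y \<in> carrier M; z \<in> carrier M \<rbrakk> \<Longrightarrow> (x \<oplus> y) \<otimes> z = x \<otimes> z \<oplus> y \<otimes> z"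
    "\<And>x y z. \<lbrakk> x \<in> carrier M; y \<in> carrier M; z \<in> carrier M \<rbrakk> \<Longrightarrow> z \<otimes> (x \<oplus> y) = z \<otimes> x \<oplus> z \<otimes> y"
    and "\<And>a x. x \<in> carrier M \<Longrightarrow> a \<odot> x \<in> carrier M"
    "\<And>a b x. x \<in> carrier M \<Longrightarrow> (a + b) \<odot> x = a \<odot> x \<oplus> b \<odot> x"
    "\<And>a x y. x \<in> carrier M \<Longrightarrow> y \<in> carrier M \<Longrightarrow> a \<odot> (x \<oplus> y) = a \<odot> x \<oplus> a \<odot> y"
    "\<And>a b x. x \<in> carrier M \<Longrightarrow> (a * b) \<odot> x = a \<odot> (b \<odot> x)"
    "\<And>x. x \<in> carrier M \<Longrightarrow> 1 \<odot> x = x"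
    "\<And>a x y. x \<in> carrier M \<Longrightarrow> y \<in> carrier M \<Longrightarrow> (a \<odot> x) \<otimes> y = a \<odot> (x \<otimes> y)"
    "\<And>a x y. x \<in> carrier M \<Longrightarrow> y \<in> carrier M \<Longrightarrow> x \<otimes> (a \<odot> y) = a \<odot> (x \<otimes> y)"
  shows "algebra_over M"
proof -
  have "abelian_group M"
  proof (rule abelian_groupI)
    fix x assume x: "x \<in> carrier M"
    show "\<exists>y\<in>carrier M. y \<oplus> x = \<zero>" using assms(6)[OF x] assms(14)[OF x] by blast
  qed (fact assms)+
  moreover have "monoid M" by (rule monoidI) (fact assms)+
  ultimately have "ring M" by (rule ringI) (fact assms)+
  then show ?thesis
    by (intro algebra_over.intro algebra_over_axioms.intro assms)
qed

text \<open>The twist \<open>\<phi>\<close> is needed on Lusztig's form, where functionals with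
  values in the field are linear only through evaluation of Laurent polynomials at \<zeta>.
  Extension of scalars turns them into linear ones.\<close>

definition semilin :: "('r \<Rightarrow> 's::comm_ring_1) \<Rightarrow> ('r, 'm) module \<Rightarrow> ('m \<Rightarrow> 's) \<Rightarrow> bool" where
  "semilin \<phi> M f \<longleftrightarrow>
    (\<forall>x\<in>carrier M. \<forall>y\<in>carrier M. f (x \<oplus>\<^bsub>M\<^esub> y) = f x + f y) \<and>
    (\<forall>a. \<forall>x\<in>carrier M. f (a \<odot>\<^bsub>M\<^esub> x) = \<phi> a * f x)"

abbreviation "lin \<equiv> semilin (\<lambda>a. a)"

lemma semilin_add: "semilin \<phi> M f \<Longrightarrow> x \<in> carrier M \<Longrightarrow> y \<in> carrier M \<Longrightarrow> f (x \<oplus>\<^bsub>M\<^esub> y) = f x + f y"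
  and semilin_smult: "semilin \<phi> M f \<Longrightarrow> x \<in> carrier M \<Longrightarrow> f (a \<odot>\<^bsub>M\<^esub> x) = \<phi> a * f x"
  by (auto simp: semilin_def)

lemma (in algebra_over) lin_zero: "lin M f \<Longrightarrow> f \<zero> = 0"
  using semilin_smult[of "\<lambda>a. a" M f \<zero> 0] by simp

lemma (in algebra_over) lin_minus: "lin M f \<Longrightarrow> x \<in> carrier M \<Longrightarrow> f (\<ominus> x) = - f x"
  using semilin_smult[of "\<lambda>a. a" M f x "- 1"] by (simp add: smult_minus_one)

subsection \<open>Monoid algebras\<close>

lemma monoid_algebra_simps:
  "carrier (monoid_algebra G) = {f. Poly_Mapping.keys f \<subseteq> carrier G}"
  "\<one>\<^bsub>monoid_algebra G\<^esub> = sg \<one>\<^bsub>G\<^esub> 1"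
  "\<zero>\<^bsub>monoid_algebra G\<^esub> = 0"
  "x \<oplus>\<^bsub>monoid_algebra G\<^esub> y = x + y"
  "r \<odot>\<^bsub>monoid_algebra G\<^esub> x = Poly_Mapping.map ((*) r) x"
  by (simp_all add: monoid_algebra_def)

lemma poly_mapping_sum_single:
  "(f :: 'a \<Rightarrow>\<^sub>0 'b::comm_monoid_add) = (\<Sum>x\<in>Poly_Mapping.keys f. sg x (Poly_Mapping.lookup f x))"
proof (rule poly_mapping_eqI)
  fix k
  show "Poly_Mapping.lookup f k = Poly_Mapping.lookup (\<Sum>x\<in>Poly_Mapping.keys f. sg x (Poly_Mapping.lookup f x)) k"
    by (simp add: lookup_sum lookup_single when_def in_keys_iff)
qed

text \<open>One application per argument reduces a multilinear identity in a monoid algebra to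
  single terms.\<close>

lemma poly_mapping_span_induct [consumes 1, case_names zero single add]:
  fixes f :: "'a \<Rightarrow>\<^sub>0 'b::comm_monoid_add"
  assumes "Poly_Mapping.keys f \<subseteq> A"
    and "P 0" and "\<And>x a. x \<in> A \<Longrightarrow> P (sg x a)"
    and "\<And>f g. Poly_Mapping.keys f \<subseteq> A \<Longrightarrow> Poly_Mapping.keys g \<subseteq> A \<Longrightarrow> P f \<Longrightarrow> P g \<Longrightarrow> P (f + g)"
  shows "P f"
proof -
  have "Poly_Mapping.keys (\<Sum>x\<in>B. sg x (c x)) \<subseteq> A \<and> P (\<Sum>x\<in>B. sg x (c x))"
    if "finite B" "B \<subseteq> A" for B and c :: "'a \<Rightarrow> 'b"
    using that
  proof (induction B)
    case (insert x B)
    then have "Poly_Mapping.keys (sg x (c x)) \<subseteq> A" by auto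
    with insert show ?case
      using assms(3)[of x "c x"] assms(4)[of "sg x (c x)" "\<Sum>x\<in>B. sg x (c x)"]
        Poly_Mapping.keys_add[of "sg x (c x)" "\<Sum>x\<in>B. sg x (c x)"] by (simp) blast
  qed (simp add: assms(2))
  from this[of "Poly_Mapping.keys f" "Poly_Mapping.lookup f"] assms(1) show ?thesis
    by (simp flip: poly_mapping_sum_single)
qed

text \<open>Outside the supports all terms vanish, so the sums may run over larger finite sets. Then
  \<open>f\<close>, \<open>g\<close> and \<open>f + g\<close> share one index range, which is how
  additivity is proved here and for the other sums over \<open>keys\<close>.\<close>

lemma monoid_algebra_mult:
  assumes "finite A" "finite B" "Poly_Mapping.keys f \<subseteq> A" "Poly_Mapping.keys g \<subseteq> B"
  shows "f \<otimes>\<^bsub>monoid_algebra G\<^esub> g =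
    (\<Sum>x\<in>A. \<Sum>y\<in>B. sg (x \<otimes>\<^bsub>G\<^esub> y) (Poly_Mapping.lookup f x * Poly_Mapping.lookup g y))"
proof -
  have "f \<otimes>\<^bsub>monoid_algebra G\<^esub> g = (\<Sum>x\<in>Poly_Mapping.keys f. \<Sum>y\<in>Poly_Mapping.keys g.
      sg (x \<otimes>\<^bsub>G\<^esub> y) (Poly_Mapping.lookup f x * Poly_Mapping.lookup g y))"
    by (simp add: monoid_algebra_def)
  also have "\<dots> = (\<Sum>x\<in>Poly_Mapping.keys f. \<Sum>y\<in>B.
      sg (x \<otimes>\<^bsub>G\<^esub> y) (Poly_Mapping.lookup f x * Poly_Mapping.lookup g y))"
    using assms by (intro sum.cong refl sum.mono_neutral_left) (auto simp: in_keys_iff)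
  also have "\<dots> = (\<Sum>x\<in>A. \<Sum>y\<in>B.
      sg (x \<otimes>\<^bsub>G\<^esub> y) (Poly_Mapping.lookup f x * Poly_Mapping.lookup g y))"
    using assms by (intro sum.mono_neutral_left) (auto simp: in_keys_iff)
  finally show ?thesis .
qed

lemma monoid_algebra_mult_single [simp]:
  "sg x a \<otimes>\<^bsub>monoid_algebra G\<^esub> sg y b = sg (x \<otimes>\<^bsub>G\<^esub> y) (a * b)"
  by (subst monoid_algebra_mult[of "{x}" "{y}"]) (auto split: if_splits)

lemma monoid_algebra_mult_add_left:
  "(f + g) \<otimes>\<^bsub>monoid_algebra G\<^esub> h = f \<otimes>\<^bsub>monoid_algebra G\<^esub> h + g \<otimes>\<^bsub>monoid_algebra G\<^esub> h"
proof -
  have "Poly_Mapping.keys (f + g) \<subseteq> Poly_Mapping.keys f \<union> Poly_Mapping.keys g"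
    by (rule Poly_Mapping.keys_add)
  then show ?thesis
    by (subst (1 2 3) monoid_algebra_mult[of "Poly_Mapping.keys f \<union> Poly_Mapping.keys g" "Poly_Mapping.keys h"])
      (auto simp: lookup_add distrib_right single_add sum.distrib)
qed

lemma monoid_algebra_mult_add_right:
  "h \<otimes>\<^bsub>monoid_algebra G\<^esub> (f + g) = h \<otimes>\<^bsub>monoid_algebra G\<^esub> f + h \<otimes>\<^bsub>monoid_algebra G\<^esub> g"
proof -
  have "Poly_Mapping.keys (f + g) \<subseteq> Poly_Mapping.keys f \<union> Poly_Mapping.keys g"
    by (rule Poly_Mapping.keys_add)
  then show ?thesis
    by (subst (1 2 3) monoid_algebra_mult[of "Poly_Mapping.keys h" "Poly_Mapping.keys f \<union> Poly_Mapping.keys g"])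
      (auto simp: lookup_add distrib_left single_add sum.distrib)
qed

lemma monoid_algebra_mult_zero [simp]:
  "0 \<otimes>\<^bsub>monoid_algebra G\<^esub> h = 0" "h \<otimes>\<^bsub>monoid_algebra G\<^esub> 0 = 0"
  by (simp_all add: monoid_algebra_def)

lemma lookup_map_times [simp]:
  "Poly_Mapping.lookup (Poly_Mapping.map ((*) r) f) k = (r::'r::comm_ring_1) * Poly_Mapping.lookup f k"
  by (simp add: map.rep_eq when_def)

lemma keys_map_times: "Poly_Mapping.keys (Poly_Mapping.map ((*) (r::'r::comm_ring_1)) f) \<subseteq> Poly_Mapping.keys f"
  by (auto simp: in_keys_iff)

lemma map_times_single [simp]: "Poly_Mapping.map ((*) r) (sg x a) = sg x ((r::'r::comm_ring_1) * a)"
  by (simp add: map_single)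

lemma map_times_add: "Poly_Mapping.map ((*) (r::'r::comm_ring_1)) (f + g) = Poly_Mapping.map ((*) r) f + Poly_Mapping.map ((*) r) g"
  by (rule poly_mapping_eqI) (simp add: lookup_add distrib_left)

lemma map_times_zero [simp]: "Poly_Mapping.map ((*) (r::'r::comm_ring_1)) 0 = 0"
  by (rule poly_mapping_eqI) simp

lemma keys_add_subsetI:
  "Poly_Mapping.keys f \<subseteq> A \<Longrightarrow> Poly_Mapping.keys g \<subseteq> A \<Longrightarrow> Poly_Mapping.keys (f + g) \<subseteq> A"
  using Poly_Mapping.keys_add[of f g] by blast

lemma monoid_algebra_mult_closed:
  assumes "monoid G" "Poly_Mapping.keys f \<subseteq> carrier G" "Poly_Mapping.keys g \<subseteq> carrier G"
  shows "Poly_Mapping.keys (f \<otimes>\<^bsub>monoid_algebra G\<^esub> g) \<subseteq> carrier G"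
  using assms(2)
proof (induction rule: poly_mapping_span_induct)
  case (single x a)
  show ?case using assms(3)
  proof (induction rule: poly_mapping_span_induct)
    case (single y b)
    then show ?case using \<open>x \<in> carrier G\<close> assms(1) by (auto simp: monoid.m_closed)
  next
    case (add f g)
    then show ?case by (simp add: monoid_algebra_mult_add_right keys_add_subsetI)
  qed simp
next
  case (add f g)
  then show ?case by (simp add: monoid_algebra_mult_add_left keys_add_subsetI)
qed simp

lemma monoid_algebra_assoc:
  assumes "monoid G" "Poly_Mapping.keys f \<subseteq> carrier G" "Poly_Mapping.keys g \<subseteq> carrier G" "Poly_Mapping.keys h \<subseteq> carrier G"
  shows "(f \<otimes>\<^bsub>monoid_algebra G\<^esub> g) \<otimes>\<^bsub>monoid_algebra G\<^esub> h = f \<otimes>\<^bsub>monoid_algebra G\<^esub> (g \<otimes>\<^bsub>monoid_algebra G\<^esub> h)"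
  using assms(2)
proof (induction rule: poly_mapping_span_induct)
  case (single x a)
  show ?case using assms(3)
  proof (induction rule: poly_mapping_span_induct)
    case (single y b)
    show ?case using assms(4)
    proof (induction rule: poly_mapping_span_induct)
      case (single z c)
      then show ?case using \<open>x \<in> carrier G\<close> \<open>y \<in> carrier G\<close> assms(1)
        by (simp add: monoid.m_assoc mult.assoc)
    qed (simp_all add: monoid_algebra_mult_add_right)
  qed (simp_all add: monoid_algebra_mult_add_right monoid_algebra_mult_add_left)
qed (simp_all add: monoid_algebra_mult_add_left)

lemma monoid_algebra_mult_smult:
  "Poly_Mapping.map ((*) r) f \<otimes>\<^bsub>monoid_algebra G\<^esub> g = Poly_Mapping.map ((*) r) (f \<otimes>\<^bsub>monoid_algebra G\<^esub> g)"
  "f \<otimes>\<^bsub>monoid_algebra G\<^esub> Poly_Mapping.map ((*) r) g = Poly_Mapping.map ((*) r) (f \<otimes>\<^bsub>monoid_algebra G\<^esub> g)"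
proof -
  have *: "Poly_Mapping.map ((*) r) f \<otimes>\<^bsub>monoid_algebra G\<^esub> g = Poly_Mapping.map ((*) r) (f \<otimes>\<^bsub>monoid_algebra G\<^esub> g)
    \<and> f \<otimes>\<^bsub>monoid_algebra G\<^esub> Poly_Mapping.map ((*) r) g = Poly_Mapping.map ((*) r) (f \<otimes>\<^bsub>monoid_algebra G\<^esub> g)"
    using subset_UNIV[of "Poly_Mapping.keys f"]
  proof (induction rule: poly_mapping_span_induct)
    case (single x a)
    show ?case using subset_UNIV[of "Poly_Mapping.keys g"]
      by (induction rule: poly_mapping_span_induct)
        (simp_all add: monoid_algebra_mult_add_right map_times_add mult.assoc mult.left_commute)
  qed (simp_all add: monoid_algebra_mult_add_left map_times_add)
  show "Poly_Mapping.map ((*) r) f \<otimes>\<^bsub>monoid_algebra G\<^esub> g = Poly_Mapping.map ((*) r) (f \<otimes>\<^bsub>monoid_algebra G\<^esub> g)"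
  "f \<otimes>\<^bsub>monoid_algebra G\<^esub> Poly_Mapping.map ((*) r) g = Poly_Mapping.map ((*) r) (f \<otimes>\<^bsub>monoid_algebra G\<^esub> g)"
    using * by blast+
qed

lemma monoid_algebra_one:
  assumes "monoid G" "Poly_Mapping.keys f \<subseteq> carrier G"
  shows "sg \<one>\<^bsub>G\<^esub> 1 \<otimes>\<^bsub>monoid_algebra G\<^esub> f = f" "f \<otimes>\<^bsub>monoid_algebra G\<^esub> sg \<one>\<^bsub>G\<^esub> 1 = f"
proof -
  have *: "sg \<one>\<^bsub>G\<^esub> 1 \<otimes>\<^bsub>monoid_algebra G\<^esub> f = f \<and> f \<otimes>\<^bsub>monoid_algebra G\<^esub> sg \<one>\<^bsub>G\<^esub> 1 = f"
    using assms(2) by (induction rule: poly_mapping_span_induct)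
     (simp_all add: monoid_algebra_mult_add_right monoid_algebra_mult_add_left monoid.l_one[OF assms(1)] monoid.r_one[OF assms(1)])
  show "sg \<one>\<^bsub>G\<^esub> 1 \<otimes>\<^bsub>monoid_algebra G\<^esub> f = f" "f \<otimes>\<^bsub>monoid_algebra G\<^esub> sg \<one>\<^bsub>G\<^esub> 1 = f"
    using * by blast+
qed

lemma monoid_algebra_is_algebra:
  assumes "monoid G"
  shows "algebra_over (monoid_algebra G :: ('r::comm_ring_1, _) module)"
proof (rule algebra_overI, unfold monoid_algebra_simps mem_Collect_eq, goal_cases)
  case (1 x y) then show ?case by (rule keys_add_subsetI)
next
  case 2 show ?case by simp
next
  case (3 x y z) show ?case by (rule add.assoc)
next
  case (4 x y) show ?case by (rule add.commute)
next
  case (5 x) show ?case by simp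
next
  case (6 x) show ?case by (rule poly_mapping_eqI) (simp add: lookup_add)
next
  case (7 x y) then show ?case using assms by (rule_tac monoid_algebra_mult_closed)
next
  case 8 show ?case using assms by (simp add: monoid.one_closed)
next
  case (9 x y z) then show ?case using assms by (rule_tac monoid_algebra_assoc)
next
  case (10 x) then show ?case using assms by (simp add: monoid_algebra_one)
next
  case (11 x) then show ?case using assms by (simp add: monoid_algebra_one)
next
  case (14 a x) then show ?case using keys_map_times[of a x] by blast
next
  case (15 a b x) show ?case by (rule poly_mapping_eqI) (simp add: lookup_add distrib_right)
next
  case (17 a b x) show ?case by (rule poly_mapping_eqI) (simp add: mult.assoc)
next
  case (18 x) show ?case by (rule poly_mapping_eqI) simp
qed (simp_all add: monoid_algebra_mult_smult map_times_add monoid_algebra_mult_add_left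
       monoid_algebra_mult_add_right)


subsection \<open>Quotients\<close>

definition alg_hom :: "('r::comm_ring_1, 'm) module \<Rightarrow> ('r, 'n) module \<Rightarrow> ('m \<Rightarrow> 'n) \<Rightarrow> bool" where
  "alg_hom M N f \<longleftrightarrow> f ` carrier M \<subseteq> carrier N \<and> f \<one>\<^bsub>M\<^esub> = \<one>\<^bsub>N\<^esub> \<and>
    (\<forall>x\<in>carrier M. \<forall>y\<in>carrier M. f (x \<oplus>\<^bsub>M\<^esub> y) = f x \<oplus>\<^bsub>N\<^esub> f y) \<and>
    (\<forall>x\<in>carrier M. \<forall>y\<in>carrier M. f (x \<otimes>\<^bsub>M\<^esub> y) = f x \<otimes>\<^bsub>N\<^esub> f y) \<and>
    (\<forall>a. \<forall>x\<in>carrier M. f (a \<odot>\<^bsub>M\<^esub> x) = a \<odot>\<^bsub>N\<^esub> f x)"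

lemma alg_homD:
  assumes "alg_hom M N f"
  shows "x \<in> carrier M \<Longrightarrow> f x \<in> carrier N"
    "f \<one>\<^bsub>M\<^esub> = \<one>\<^bsub>N\<^esub>"
    "x \<in> carrier M \<Longrightarrow> y \<in> carrier M \<Longrightarrow> f (x \<oplus>\<^bsub>M\<^esub> y) = f x \<oplus>\<^bsub>N\<^esub> f y"
    "x \<in> carrier M \<Longrightarrow> y \<in> carrier M \<Longrightarrow> f (x \<otimes>\<^bsub>M\<^esub> y) = f x \<otimes>\<^bsub>N\<^esub> f y"
    "x \<in> carrier M \<Longrightarrow> f (a \<odot>\<^bsub>M\<^esub> x) = a \<odot>\<^bsub>N\<^esub> f x"
  using assms unfolding alg_hom_def by blast+

lemma alg_hom_zero:
  assumes "algebra_over M" "algebra_over N" "alg_hom M N f"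
  shows "f \<zero>\<^bsub>M\<^esub> = \<zero>\<^bsub>N\<^esub>"
proof -
  interpret M: algebra_over M by fact
  interpret N: algebra_over N by fact
  have "f \<zero>\<^bsub>M\<^esub> = f (0 \<odot>\<^bsub>M\<^esub> \<zero>\<^bsub>M\<^esub>)" by simp
  also have "\<dots> = 0 \<odot>\<^bsub>N\<^esub> f \<zero>\<^bsub>M\<^esub>" by (rule alg_homD(5)[OF assms(3)]) simp
  also have "\<dots> = \<zero>\<^bsub>N\<^esub>" using alg_homD(1)[OF assms(3)] by simp
  finally show ?thesis .
qed

lemma alg_hom_diff:
  assumes "algebra_over M" "algebra_over N" "alg_hom M N f" "x \<in> carrier M" "y \<in> carrier M"
  shows "f (x \<ominus>\<^bsub>M\<^esub> y) = f x \<ominus>\<^bsub>N\<^esub> f y"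
proof -
  interpret M: algebra_over M by fact
  interpret N: algebra_over N by fact
  show ?thesis unfolding M.minus_eq N.minus_eq using assms(4-) alg_homD[OF assms(3)]
    by (simp flip: M.smult_minus_one N.smult_minus_one)
qed

section \<open>The quotient algebra, and descent of functionals and homomorphisms to it\<close>

context algebra_over
begin

context
  fixes S assumes S: "S \<subseteq> carrier M"
begin

interpretation I: ideal "Idl S" M
  using S by (rule genideal_ideal)

lemma quot_alg_carrier: "carrier (quot_alg M S) = quot_map M S ` carrier M"
  unfolding quot_alg_def quot_map_def FactRing_def A_RCOSETS_def' Let_def by (simp, blast)

lemma quot_map_closed: "x \<in> carrier M \<Longrightarrow> quot_map M S x \<in> carrier (quot_alg M S)"
  by (simp add: quot_alg_carrier)

lemma quot_map_add: "x \<in> carrier M \<Longrightarrow> y \<in> carrier M \<Longrightarrow>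
    quot_map M S x \<oplus>\<^bsub>quot_alg M S\<^esub> quot_map M S y = quot_map M S (x \<oplus> y)"
  by (simp add: quot_alg_def quot_map_def FactRing_def Let_def I.a_rcos_sum)

lemma quot_map_mult: "x \<in> carrier M \<Longrightarrow> y \<in> carrier M \<Longrightarrow>
    quot_map M S x \<otimes>\<^bsub>quot_alg M S\<^esub> quot_map M S y = quot_map M S (x \<otimes> y)"
  by (simp add: quot_alg_def quot_map_def FactRing_def Let_def I.rcoset_mult_add)

lemma quot_map_one: "\<one>\<^bsub>quot_alg M S\<^esub> = quot_map M S \<one>"
  by (simp add: quot_alg_def quot_map_def FactRing_def Let_def)

lemma quot_map_eq_iff:
  assumes "x \<in> carrier M" "y \<in> carrier M"
  shows "quot_map M S x = quot_map M S y \<longleftrightarrow> x \<ominus> y \<in> Idl S"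
  using assms unfolding quot_map_def
  by (metis I.is_ideal ring.quotient_eq_iff_same_a_r_cos ring_axioms)

lemma quot_map_zero: "\<zero>\<^bsub>quot_alg M S\<^esub> = quot_map M S \<zero>"
proof -
  have "Idl S +> \<zero> = Idl S"
    by (simp add: I.a_subset)
  then show ?thesis by (simp add: quot_alg_def quot_map_def FactRing_def Let_def)
qed

text \<open>A two-sided ideal of the ring is automatically stable under scalars, because
  \<open>r \<odot> i = (r \<odot> \<one>) \<otimes> i\<close>. Hence all cosets in the union that
  defines the scalar action coincide.\<close>

lemma quot_map_smult:
  assumes x: "x \<in> carrier M"
  shows "r \<odot>\<^bsub>quot_alg M S\<^esub> quot_map M S x = quot_map M S (r \<odot> x)"
proof -
  have "Idl S +> r \<odot> y = Idl S +> r \<odot> x" if y: "y \<in> Idl S +> x" for y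
  proof -
    from y obtain i where i: "i \<in> Idl S" "y = i \<oplus> x" by (auto simp: a_r_coset_def')
    then have ic: "i \<in> carrier M" by (simp add: I.a_Hcarr)
    have "r \<odot> i = (r \<odot> \<one>) \<otimes> i" using ic by (rule smult_as_mult)
    then have ri: "r \<odot> i \<in> Idl S" using i by (simp add: I.I_l_closed)
    have "r \<odot> y \<ominus> r \<odot> x = r \<odot> i"
      using i ic x by (simp add: smult_r_distr minus_eq a_assoc r_neg)
    then have "quot_map M S (r \<odot> y) = quot_map M S (r \<odot> x)"
      using ri i ic x by (subst quot_map_eq_iff) auto
    then show ?thesis by (simp add: quot_map_def)
  qed
  moreover have "x \<in> Idl S +> x" using x I.a_rcos_self by blast
  ultimately have "(\<Union>y\<in>Idl S +> x. Idl S +> r \<odot> y) = Idl S +> r \<odot> x" by blast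
  then show ?thesis by (simp add: quot_alg_def quot_map_def Let_def)
qed

lemmas quot_alg_simps = quot_map_closed quot_map_add quot_map_mult quot_map_one quot_map_zero quot_map_smult

lemma quot_alg_is_algebra: "algebra_over (quot_alg M S)"
proof -
  note s = quot_alg_simps
  show ?thesis
  proof (rule algebra_overI, unfold quot_alg_carrier, goal_cases)
    case (6 x) then show ?case by (clarsimp simp: s smult_minus_one l_neg)
  next
    case (3 x y z) then show ?case by (clarsimp simp: s a_assoc)
  next
    case (4 x y) then show ?case by (clarsimp simp: s a_comm)
  next
    case (9 x y z) then show ?case by (clarsimp simp: s m_assoc)
  next
    case (12 x y z) then show ?case by (clarsimp simp: s l_distr)
  next
    case (13 x y z) then show ?case by (clarsimp simp: s r_distr)
  next
    case (15 a b x) then show ?case by (clarsimp simp: s smult_l_distr)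
  next
    case (16 a x y) then show ?case by (clarsimp simp: s smult_r_distr)
  next
    case (17 a b x) then show ?case by (clarsimp simp: s smult_assoc)
  next
    case (19 a x y) then show ?case by (clarsimp simp: s smult_mult_l)
  next
    case (20 a x y) then show ?case by (clarsimp simp: s smult_mult_r)
  qed (auto simp: s)
qed

lemma quot_map_hom: "alg_hom M (quot_alg M S) (quot_map M S)"
  by (simp add: alg_hom_def quot_alg_simps image_subset_iff)

lemma quot_map_rel: "s \<in> S \<Longrightarrow> quot_map M S s = \<zero>\<^bsub>quot_alg M S\<^esub>"
  using S genideal_self[OF S] by (subst quot_map_zero, subst quot_map_eq_iff) (auto simp: minus_eq)

text \<open>A functional that is merely linear may kill the generators without killing the ideal.
  The elements \<open>x\<close> with \<open>f (y \<otimes> x \<otimes> z) = 0\<close> for all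
  \<open>y\<close> and \<open>z\<close> do form an ideal, which explains the two-sided
  hypothesis.\<close>

lemma lin_vanishes_on_ideal:
  assumes f: "lin M f"
    and vanish: "\<And>y s z. y \<in> carrier M \<Longrightarrow> s \<in> S \<Longrightarrow> z \<in> carrier M \<Longrightarrow> f (y \<otimes> s \<otimes> z) = 0"
    and x: "x \<in> Idl S"
  shows "f x = 0"
proof -
  define J where "J = {x \<in> carrier M. \<forall>y\<in>carrier M. \<forall>z\<in>carrier M. f (y \<otimes> x \<otimes> z) = 0}"
  have "ideal J M"
  proof (rule idealI)
    show "ring M" by (rule ring_axioms)
    show "subgroup J (add_monoid M)"
    proof (rule add.subgroupI)
      show "J \<subseteq> carrier M" by (auto simp: J_def)
      have "\<zero> \<in> J" by (auto simp: J_def lin_zero[OF f])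
      then show "J \<noteq> {}" by blast
      show "\<ominus> a \<in> J" if "a \<in> J" for a
        using that by (auto simp: J_def l_minus r_minus lin_minus[OF f])
      show "a \<oplus> b \<in> J" if "a \<in> J" "b \<in> J" for a b
        using that by (auto simp: J_def l_distr r_distr semilin_add[OF f])
    qed
    show "x \<otimes> a \<in> J" if "a \<in> J" "x \<in> carrier M" for a x
      using that by (auto simp: J_def) (metis m_assoc m_closed)
    show "a \<otimes> x \<in> J" if "a \<in> J" "x \<in> carrier M" for a x
      using that by (auto simp: J_def) (metis m_assoc m_closed)
  qed
  moreover have "S \<subseteq> J" using vanish S by (auto simp: J_def)
  ultimately have "x \<in> J" using x genideal_minimal by blast
  then have "f (\<one> \<otimes> x \<otimes> \<one>) = 0" "x \<in> carrier M" unfolding J_def by blast+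
  then show ?thesis by simp
qed

lemma alg_hom_vanishes_on_ideal:
  assumes N: "algebra_over N" and f: "alg_hom M N f"
    and vanish: "\<And>s. s \<in> S \<Longrightarrow> f s = \<zero>\<^bsub>N\<^esub>"
    and x: "x \<in> Idl S"
  shows "f x = \<zero>\<^bsub>N\<^esub>"
proof -
  interpret N: algebra_over N by fact
  note h = alg_homD[OF f]
  define J where "J = {x \<in> carrier M. f x = \<zero>\<^bsub>N\<^esub>}"
  have "ideal J M"
  proof (rule idealI)
    show "ring M" by (rule ring_axioms)
    show "subgroup J (add_monoid M)"
    proof (rule add.subgroupI)
      show "J \<subseteq> carrier M" by (auto simp: J_def)
      have "\<zero> \<in> J" by (auto simp: J_def alg_hom_zero[OF algebra_over_axioms N f])
      then show "J \<noteq> {}" by blast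
      show "\<ominus> a \<in> J" if "a \<in> J" for a
        using that h(5)[of a "-1"] by (auto simp: J_def smult_minus_one)
      show "a \<oplus> b \<in> J" if "a \<in> J" "b \<in> J" for a b
        using that by (auto simp: J_def h)
    qed
  qed (auto simp: J_def h)
  moreover have "S \<subseteq> J" using vanish S by (auto simp: J_def)
  ultimately have "x \<in> J" using x genideal_minimal by blast
  then show ?thesis by (auto simp: J_def)
qed

text \<open>The image of a coset under a function constant on it is a singleton. All descended maps
  are read off in this way, as in \<open>uq_hom\<close>.\<close>

lemma the_elem_quot_map:
  assumes x: "x \<in> carrier M" and "\<And>i. i \<in> Idl S \<Longrightarrow> f (i \<oplus> x) = f x"
  shows "the_elem (f ` quot_map M S x) = f x"
proof -
  have "f ` quot_map M S x = {f x}"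
    using assms I.a_rcos_self[OF x] by (auto simp: quot_map_def a_r_coset_def')
  then show ?thesis by simp
qed

lemma quot_alg_functional:
  assumes f: "lin M f"
    and vanish: "\<And>y s z. y \<in> carrier M \<Longrightarrow> s \<in> S \<Longrightarrow> z \<in> carrier M \<Longrightarrow> f (y \<otimes> s \<otimes> z) = 0"
  shows "\<And>x. x \<in> carrier M \<Longrightarrow> the_elem (f ` quot_map M S x) = f x"
    and "lin (quot_alg M S) (\<lambda>X. the_elem (f ` X))"
proof -
  show *: "the_elem (f ` quot_map M S x) = f x" if "x \<in> carrier M" for x
    using that lin_vanishes_on_ideal[OF assms]
    by (intro the_elem_quot_map) (auto simp: semilin_add[OF f] I.a_Hcarr)
  show "lin (quot_alg M S) (\<lambda>X. the_elem (f ` X))"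
    by (simp add: semilin_def quot_alg_carrier quot_alg_simps * semilin_add[OF f] semilin_smult[OF f])
qed

lemma quot_alg_lift:
  assumes N: "algebra_over N" and f: "alg_hom M N f"
    and vanish: "\<And>s. s \<in> S \<Longrightarrow> f s = \<zero>\<^bsub>N\<^esub>"
  shows "\<And>x. x \<in> carrier M \<Longrightarrow> the_elem (f ` quot_map M S x) = f x"
    and "alg_hom (quot_alg M S) N (\<lambda>X. the_elem (f ` X))"
proof -
  interpret N: algebra_over N by fact
  note h = alg_homD[OF f]
  show *: "the_elem (f ` quot_map M S x) = f x" if "x \<in> carrier M" for x
    using that alg_hom_vanishes_on_ideal[OF assms]
    by (intro the_elem_quot_map) (auto simp: h I.a_Hcarr)
  show "alg_hom (quot_alg M S) N (\<lambda>X. the_elem (f ` X))"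
    by (simp add: alg_hom_def quot_alg_carrier quot_alg_simps * h image_subset_iff)
qed

end
end

subsection \<open>Functionals on monoid algebras\<close>

definition mlin :: "('g \<Rightarrow> 'r) \<Rightarrow> ('g \<Rightarrow>\<^sub>0 'r::comm_ring_1) \<Rightarrow> 'r" where
  "mlin f g = (\<Sum>x\<in>Poly_Mapping.keys g. Poly_Mapping.lookup g x * f x)"

lemma mlin_superset:
  "finite A \<Longrightarrow> Poly_Mapping.keys g \<subseteq> A \<Longrightarrow> mlin f g = (\<Sum>x\<in>A. Poly_Mapping.lookup g x * f x)"
  unfolding mlin_def by (rule sum.mono_neutral_left) (auto simp: in_keys_iff)

lemma mlin_add: "mlin f (g + h) = mlin f g + mlin f h"
proof -
  let ?A = "Poly_Mapping.keys g \<union> Poly_Mapping.keys h"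
  have "mlin f k = (\<Sum>x\<in>?A. Poly_Mapping.lookup k x * f x)" if "k \<in> {g, h, g + h}" for k
    using that keys_add_subsetI[of g ?A h] by (intro mlin_superset) auto
  then show ?thesis by (simp add: lookup_add distrib_right sum.distrib)
qed

lemma mlin_smult: "mlin f (Poly_Mapping.map ((*) r) g) = r * mlin f g"
proof -
  have "mlin f (Poly_Mapping.map ((*) r) g) = (\<Sum>x\<in>Poly_Mapping.keys g. r * Poly_Mapping.lookup g x * f x)"
    by (subst mlin_superset[OF _ keys_map_times]) simp_all
  then show ?thesis by (simp add: mlin_def sum_distrib_left mult.assoc)
qed

lemma mlin_single [simp]: "mlin f (sg x a) = a * f x"
  by (subst mlin_superset[of "{x}"]) auto

lemma mlin_zero [simp]: "mlin f 0 = 0"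
  by (simp add: mlin_def)

lemma mlin_diff: "mlin f (g - h) = mlin f g - mlin f h"
  using mlin_add[of f "g - h" h] by simp

lemma mlin_lin: "lin (monoid_algebra G) (mlin f)"
  by (simp add: semilin_def monoid_algebra_simps mlin_add mlin_smult)

text \<open>Bilinearity in \<open>y\<close> and \<open>z\<close> reduces the two-sided condition to
  multiplication by elements of the monoid itself.\<close>

lemma mlin_vanishes:
  assumes G: "monoid G" and s: "Poly_Mapping.keys s \<subseteq> carrier G"
    and y: "Poly_Mapping.keys y \<subseteq> carrier G" and z: "Poly_Mapping.keys z \<subseteq> carrier G"
    and vanish: "\<And>a b. a \<in> carrier G \<Longrightarrow> b \<in> carrier G \<Longrightarrow>
      mlin f (sg a 1 \<otimes>\<^bsub>monoid_algebra G\<^esub> s \<otimes>\<^bsub>monoid_algebra G\<^esub> sg b 1) = 0"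
  shows "mlin f (y \<otimes>\<^bsub>monoid_algebra G\<^esub> s \<otimes>\<^bsub>monoid_algebra G\<^esub> z) = 0"
  using y
proof (induction rule: poly_mapping_span_induct)
  case (single a c)
  show ?case using z
  proof (induction rule: poly_mapping_span_induct)
    case (single b d)
    have "mlin f (Poly_Mapping.map ((*) c) (sg a 1) \<otimes>\<^bsub>monoid_algebra G\<^esub> s
        \<otimes>\<^bsub>monoid_algebra G\<^esub> Poly_Mapping.map ((*) d) (sg b 1)) = 0"
      using vanish[OF \<open>a \<in> carrier G\<close> single]
      by (simp add: monoid_algebra_mult_smult mlin_smult del: map_times_single map_single)
    then show ?case by simp
  next
    case zero show ?case by simp
  next
    case (add f g) then show ?case by (simp add: monoid_algebra_mult_add_right mlin_add)
  qed
next
  case zero show ?case by simp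
next
  case (add f g) then show ?case by (simp add: monoid_algebra_mult_add_left mlin_add)
qed

lemma monoid_algebra_quot_functional:
  assumes G: "monoid G" and S: "S \<subseteq> carrier (monoid_algebra G)"
    and vanish: "\<And>a b s. a \<in> carrier G \<Longrightarrow> b \<in> carrier G \<Longrightarrow> s \<in> S \<Longrightarrow>
      mlin f (sg a 1 \<otimes>\<^bsub>monoid_algebra G\<^esub> s \<otimes>\<^bsub>monoid_algebra G\<^esub> sg b 1) = 0"
  shows "\<And>x. x \<in> carrier (monoid_algebra G) \<Longrightarrow>
      the_elem (mlin f ` quot_map (monoid_algebra G) S x) = mlin f x"
    and "lin (quot_alg (monoid_algebra G) S) (\<lambda>X. the_elem (mlin f ` X))"
proof -
  interpret algebra_over "monoid_algebra G" using G by (rule monoid_algebra_is_algebra)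
  have *: "mlin f (y \<otimes>\<^bsub>monoid_algebra G\<^esub> s \<otimes>\<^bsub>monoid_algebra G\<^esub> z) = 0"
    if "y \<in> carrier (monoid_algebra G)" "s \<in> S" "z \<in> carrier (monoid_algebra G)" for y s z
  proof (rule mlin_vanishes[OF G])
    show "Poly_Mapping.keys s \<subseteq> carrier G" "Poly_Mapping.keys y \<subseteq> carrier G" "Poly_Mapping.keys z \<subseteq> carrier G"
      using that S unfolding monoid_algebra_simps by blast+
  qed (rule vanish[OF _ _ that(2)])
  show "the_elem (mlin f ` quot_map (monoid_algebra G) S x) = mlin f x"
    if "x \<in> carrier (monoid_algebra G)" for x
    by (rule quot_alg_functional(1)[OF S mlin_lin _ that]) (rule *)
  show "lin (quot_alg (monoid_algebra G) S) (\<lambda>X. the_elem (mlin f ` X))"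
    by (rule quot_alg_functional(2)[OF S mlin_lin]) (rule *)
qed

lemma monoid_algebra_quot_induct [consumes 3, case_names zero single add]:
  assumes G: "monoid G" and S: "S \<subseteq> carrier (monoid_algebra G)"
    and X: "X \<in> carrier (quot_alg (monoid_algebra G) S)"
    and zero: "P \<zero>\<^bsub>quot_alg (monoid_algebra G) S\<^esub>"
    and single: "\<And>x a. x \<in> carrier G \<Longrightarrow>
      P (a \<odot>\<^bsub>quot_alg (monoid_algebra G) S\<^esub> quot_map (monoid_algebra G) S (sg x 1))"
    and add: "\<And>X Y. X \<in> carrier (quot_alg (monoid_algebra G) S) \<Longrightarrow>
      Y \<in> carrier (quot_alg (monoid_algebra G) S) \<Longrightarrow> P X \<Longrightarrow> P Y \<Longrightarrow>
      P (X \<oplus>\<^bsub>quot_alg (monoid_algebra G) S\<^esub> Y)"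
  shows "P X"
proof -
  interpret algebra_over "monoid_algebra G" using G by (rule monoid_algebra_is_algebra)
  note q = quot_alg_simps[OF S]
  obtain f where f: "X = quot_map (monoid_algebra G) S f" "Poly_Mapping.keys f \<subseteq> carrier G"
    using X by (auto simp: quot_alg_carrier[OF S] monoid_algebra_simps)
  have "P (quot_map (monoid_algebra G) S f)"
    using f(2)
  proof (induction rule: poly_mapping_span_induct)
    case zero
    then show ?case using assms(4) by (simp add: q monoid_algebra_simps)
  next
    case (single x a)
    then have "a \<odot>\<^bsub>quot_alg (monoid_algebra G) S\<^esub> quot_map (monoid_algebra G) S (sg x 1) = quot_map (monoid_algebra G) S (sg x a)"
      by (subst q) (auto simp: monoid_algebra_simps)
    then show ?case using assms(5)[OF single, of a] by simp
  next
    case (add f g)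
    then show ?case
      using assms(6)[of "quot_map (monoid_algebra G) S f" "quot_map (monoid_algebra G) S g"]
      by (simp add: q monoid_algebra_simps)
  qed
  then show ?thesis using f by simp
qed


subsection \<open>Subalgebras, opposite algebras, restriction of scalars\<close>

lemma restrict_scalars_is_algebra:
  assumes M: "algebra_over (M :: ('r::comm_ring_1, 'm) module)"
    and \<phi>: "\<And>a b :: 's::comm_ring_1. \<phi> (a + b) = \<phi> a + \<phi> b" "\<And>a b. \<phi> (a * b) = \<phi> a * \<phi> b" "\<phi> 1 = 1"
  shows "algebra_over (restrict_scalars \<phi> M)"
proof -
  interpret M: algebra_over M by fact
  have "\<phi> 0 = 0" using \<phi>(1)[of 0 0] by simp
  then have m: "\<phi> (- 1) = - 1" using \<phi>(1)[of "- 1" 1] \<phi>(3) by (simp add: eq_neg_iff_add_eq_0)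
  show ?thesis
    by (rule algebra_overI; simp add: restrict_scalars_def \<phi> m M.a_assoc M.a_comm M.m_assoc M.l_distr M.r_distr
      M.smult_l_distr M.smult_r_distr M.smult_assoc M.smult_mult_l M.smult_mult_r M.smult_minus_one M.l_neg M.r_neg M.a_lcomm)
qed

lemma opposite_alg_is_algebra:
  assumes M: "algebra_over M"
  shows "algebra_over (opposite_alg M)"
proof -
  interpret M: algebra_over M by fact
  show ?thesis
    by (rule algebra_overI; simp add: opposite_alg_def M.a_assoc M.a_comm M.m_assoc M.l_distr M.r_distr
      M.smult_l_distr M.smult_r_distr M.smult_assoc M.smult_mult_l M.smult_mult_r M.smult_minus_one M.l_neg M.r_neg M.a_lcomm)
qed

lemma carrier_update_is_algebra:
  assumes M: "algebra_over M" and "C \<subseteq> carrier M" "\<one>\<^bsub>M\<^esub> \<in> C"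
    and "\<And>x y. x \<in> C \<Longrightarrow> y \<in> C \<Longrightarrow> x \<oplus>\<^bsub>M\<^esub> y \<in> C"
    and "\<And>x y. x \<in> C \<Longrightarrow> y \<in> C \<Longrightarrow> x \<otimes>\<^bsub>M\<^esub> y \<in> C"
    and "\<And>a x. x \<in> C \<Longrightarrow> a \<odot>\<^bsub>M\<^esub> x \<in> C"
  shows "algebra_over (M\<lparr>carrier := C\<rparr>)"
proof -
  interpret M: algebra_over M by fact
  have c: "x \<in> C \<Longrightarrow> x \<in> carrier M" for x using assms(2) by blast
  have z: "\<zero>\<^bsub>M\<^esub> \<in> C" using assms(6)[OF assms(3), of 0] by simp
  show ?thesis
    by (rule algebra_overI; simp add: assms c z M.a_assoc M.a_comm M.m_assoc M.l_distr M.r_distr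
      M.smult_l_distr M.smult_r_distr M.smult_assoc M.smult_mult_l M.smult_mult_r M.smult_minus_one M.l_neg M.r_neg M.a_lcomm)
qed

lemma (in algebra_over) subalg_gen_closed:
  assumes "S \<subseteq> carrier M" "x \<in> subalg_gen M S"
  shows "x \<in> carrier M"
  using assms(2,1) by induction auto

lemma subalg_gen_is_algebra:
  assumes M: "algebra_over M" and S: "S \<subseteq> carrier M"
  shows "algebra_over (M\<lparr>carrier := subalg_gen M S\<rparr>)"
  using algebra_over.subalg_gen_closed[OF assms]
  by (intro carrier_update_is_algebra[OF M]) (auto intro: subalg_gen.intros)

lemma monoid_algebra_quot_rel:
  assumes G: "monoid G" and S: "S \<subseteq> carrier (monoid_algebra G)"
    and f: "Poly_Mapping.keys f \<subseteq> carrier G" and g: "Poly_Mapping.keys g \<subseteq> carrier G"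
    and rel: "f - g \<in> S"
  shows "quot_map (monoid_algebra G) S f = quot_map (monoid_algebra G) S g"
proof -
  interpret MA: algebra_over "monoid_algebra G" using G by (rule monoid_algebra_is_algebra)
  have c: "f \<in> carrier (monoid_algebra G)" "g \<in> carrier (monoid_algebra G)" "f - g \<in> carrier (monoid_algebra G)"
    using f g S rel unfolding monoid_algebra_simps by blast+
  have "quot_map (monoid_algebra G) S f = quot_map (monoid_algebra G) S ((f - g) \<oplus>\<^bsub>monoid_algebra G\<^esub> g)"
    by (simp add: monoid_algebra_simps)
  also have "\<dots> = quot_map (monoid_algebra G) S g"
    using c MA.quot_map_rel[OF S rel] MA.quot_map_add[OF S c(3,2)] MA.quot_map_closed[OF S c(2)]
    by (metis MA.quot_alg_is_algebra[OF S] algebra_over.axioms(1) ring.ring_simprules(8))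
  finally show ?thesis .
qed

lemma keys_single_subset [simp]: "x \<in> A \<Longrightarrow> Poly_Mapping.keys (sg x a) \<subseteq> A"
  by simp

lemma keys_diff_subsetI:
  "Poly_Mapping.keys f \<subseteq> A \<Longrightarrow> Poly_Mapping.keys g \<subseteq> A \<Longrightarrow> Poly_Mapping.keys (f - g) \<subseteq> A"
  using Poly_Mapping.keys_diff[of f g] by blast

subsection \<open>Extension of scalars\<close>

lemma (in algebra_over) underlying_monoid [simp]: "monoid M"
  by (rule monoid_axioms)

context
  fixes \<phi> :: "'s::comm_ring_1 \<Rightarrow> 'r::comm_ring_1" and L :: "('s, 'm) module" (structure)
  assumes L: "algebra_over L"
begin

interpretation L: algebra_over L by (rule L)

lemma extend_scalars_rels_closed: "extend_scalars_rels \<phi> L \<subseteq> carrier (monoid_algebra L)"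
proof
  fix s assume "s \<in> extend_scalars_rels \<phi> L"
  then consider x y where "x \<in> carrier L" "y \<in> carrier L" "s = sg (x \<oplus> y) 1 - sg x 1 - sg y 1"
    | c x where "x \<in> carrier L" "s = sg (c \<odot> x) 1 - sg x (\<phi> c)"
    unfolding extend_scalars_rels_def by blast
  then show "s \<in> carrier (monoid_algebra L)"
    by cases (simp_all add: monoid_algebra_simps keys_diff_subsetI)
qed

lemma extend_scalars_is_algebra: "algebra_over (extend_scalars \<phi> L)"
  unfolding extend_scalars_def
  by (intro algebra_over.quot_alg_is_algebra monoid_algebra_is_algebra extend_scalars_rels_closed) simp

lemma extend_scalars_map_closed:
  "x \<in> carrier L \<Longrightarrow> extend_scalars_map \<phi> L x \<in> carrier (extend_scalars \<phi> L)"
  unfolding extend_scalars_def extend_scalars_map_def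
  by (rule algebra_over.quot_map_closed[OF monoid_algebra_is_algebra extend_scalars_rels_closed])
    (auto simp: monoid_algebra_simps)

lemma extend_scalars_map_mult:
  "x \<in> carrier L \<Longrightarrow> y \<in> carrier L \<Longrightarrow>
    extend_scalars_map \<phi> L (x \<otimes> y) = extend_scalars_map \<phi> L x \<otimes>\<^bsub>extend_scalars \<phi> L\<^esub> extend_scalars_map \<phi> L y"
  unfolding extend_scalars_def extend_scalars_map_def
  by (subst algebra_over.quot_map_mult[OF monoid_algebra_is_algebra extend_scalars_rels_closed])
    (auto simp: monoid_algebra_simps)

lemma extend_scalars_map_one: "extend_scalars_map \<phi> L \<one> = \<one>\<^bsub>extend_scalars \<phi> L\<^esub>"
  unfolding extend_scalars_def extend_scalars_map_def
  by (subst algebra_over.quot_map_one[OF monoid_algebra_is_algebra extend_scalars_rels_closed])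
    (auto simp: monoid_algebra_simps)

lemma extend_scalars_map_add:
  assumes "x \<in> carrier L" "y \<in> carrier L"
  shows "extend_scalars_map \<phi> L (x \<oplus> y) = extend_scalars_map \<phi> L x \<oplus>\<^bsub>extend_scalars \<phi> L\<^esub> extend_scalars_map \<phi> L y"
proof -
  have "quot_map (monoid_algebra L) (extend_scalars_rels \<phi> L) (sg (x \<oplus> y) 1) =
    quot_map (monoid_algebra L) (extend_scalars_rels \<phi> L) (sg x 1 + sg y 1)"
    using assms by (intro monoid_algebra_quot_rel extend_scalars_rels_closed keys_add_subsetI keys_single_subset)
      (auto simp: extend_scalars_rels_def simp flip: diff_diff_eq)
  also have "\<dots> = extend_scalars_map \<phi> L x \<oplus>\<^bsub>extend_scalars \<phi> L\<^esub> extend_scalars_map \<phi> L y"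
    using assms unfolding extend_scalars_def extend_scalars_map_def
    by (subst algebra_over.quot_map_add[OF monoid_algebra_is_algebra extend_scalars_rels_closed])
      (simp_all add: monoid_algebra_simps)
  finally show ?thesis by (simp add: extend_scalars_map_def)
qed

lemma extend_scalars_map_smult:
  assumes "x \<in> carrier L"
  shows "extend_scalars_map \<phi> L (a \<odot> x) = \<phi> a \<odot>\<^bsub>extend_scalars \<phi> L\<^esub> extend_scalars_map \<phi> L x"
proof -
  have "quot_map (monoid_algebra L) (extend_scalars_rels \<phi> L) (sg (a \<odot> x) 1) =
    quot_map (monoid_algebra L) (extend_scalars_rels \<phi> L) (sg x (\<phi> a))"
    using assms by (intro monoid_algebra_quot_rel extend_scalars_rels_closed keys_add_subsetI keys_single_subset)
      (auto simp: extend_scalars_rels_def)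
  also have "\<dots> = \<phi> a \<odot>\<^bsub>extend_scalars \<phi> L\<^esub> extend_scalars_map \<phi> L x"
    using assms unfolding extend_scalars_def extend_scalars_map_def
    by (subst algebra_over.quot_map_smult[OF monoid_algebra_is_algebra extend_scalars_rels_closed])
      (simp_all add: monoid_algebra_simps)
  finally show ?thesis by (simp add: extend_scalars_map_def)
qed

lemma extend_scalars_induct [consumes 1, case_names zero smult add]:
  assumes X: "X \<in> carrier (extend_scalars \<phi> L)"
    and "P \<zero>\<^bsub>extend_scalars \<phi> L\<^esub>"
    and "\<And>x c. x \<in> carrier L \<Longrightarrow> P (c \<odot>\<^bsub>extend_scalars \<phi> L\<^esub> extend_scalars_map \<phi> L x)"
    and "\<And>X Y. X \<in> carrier (extend_scalars \<phi> L) \<Longrightarrow> Y \<in> carrier (extend_scalars \<phi> L) \<Longrightarrow>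
      P X \<Longrightarrow> P Y \<Longrightarrow> P (X \<oplus>\<^bsub>extend_scalars \<phi> L\<^esub> Y)"
  shows "P X"
  using L.underlying_monoid extend_scalars_rels_closed X[unfolded extend_scalars_def]
  by (rule monoid_algebra_quot_induct)
    (fact assms(2)[unfolded extend_scalars_def]
      | rule assms(3)[unfolded extend_scalars_def extend_scalars_map_def] assms(4)[unfolded extend_scalars_def], assumption+)+

definition extend_scalars_fun :: "('m \<Rightarrow> 'r) \<Rightarrow> ('m \<Rightarrow>\<^sub>0 'r) set \<Rightarrow> 'r" where
  "extend_scalars_fun f X = the_elem (mlin f ` X)"

lemma
  assumes f: "semilin \<phi> L f"
  shows extend_scalars_fun_map: "\<And>x. x \<in> carrier L \<Longrightarrow> extend_scalars_fun f (extend_scalars_map \<phi> L x) = f x"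
    and extend_scalars_fun_lin: "lin (extend_scalars \<phi> L) (extend_scalars_fun f)"
proof -
  \<comment> \<open>Multiplying a relation by basis elements on both sides yields a relation of the
    same kind, with \<open>x\<close> replaced by the product of \<open>a\<close>, \<open>x\<close>
    and \<open>b\<close>. So semilinearity of \<open>f\<close> suffices, and no multiplicativity is
    required.\<close>
  have *: "mlin f (sg a 1 \<otimes>\<^bsub>monoid_algebra L\<^esub> s \<otimes>\<^bsub>monoid_algebra L\<^esub> sg b 1) = 0"
    if a: "a \<in> carrier L" and b: "b \<in> carrier L" and s: "s \<in> extend_scalars_rels \<phi> L" for a b s
  proof -
    have m: "sg a 1 \<otimes>\<^bsub>monoid_algebra L\<^esub> (u - v) \<otimes>\<^bsub>monoid_algebra L\<^esub> sg b 1 =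
       sg a 1 \<otimes>\<^bsub>monoid_algebra L\<^esub> u \<otimes>\<^bsub>monoid_algebra L\<^esub> sg b 1 -
       sg a (1::'r) \<otimes>\<^bsub>monoid_algebra L\<^esub> v \<otimes>\<^bsub>monoid_algebra L\<^esub> sg b 1" for u v
      using monoid_algebra_mult_add_right[of L "sg a 1" "u - v" v]
        monoid_algebra_mult_add_left[of L "sg a 1 \<otimes>\<^bsub>monoid_algebra L\<^esub> (u - v)" "sg a 1 \<otimes>\<^bsub>monoid_algebra L\<^esub> v" "sg b 1"]
      by simp
    consider x y where "x \<in> carrier L" "y \<in> carrier L" "s = sg (x \<oplus> y) 1 - sg x 1 - sg y 1"
      | c x where "x \<in> carrier L" "s = sg (c \<odot> x) 1 - sg x (\<phi> c)"
      using s unfolding extend_scalars_rels_def by blast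
    then show ?thesis
    proof cases
      case 1
      then show ?thesis using a b
        by (simp add: m mlin_diff L.r_distr L.l_distr semilin_add[OF f])
    next
      case 2
      then show ?thesis using a b
        by (simp add: m mlin_diff L.smult_mult_r L.smult_mult_l semilin_smult[OF f])
    qed
  qed
  note q = monoid_algebra_quot_functional[OF L.underlying_monoid extend_scalars_rels_closed]
  show "extend_scalars_fun f (extend_scalars_map \<phi> L x) = f x" if "x \<in> carrier L" for x
  proof -
    have "the_elem (mlin f ` quot_map (monoid_algebra L) (extend_scalars_rels \<phi> L) (sg x 1)) = mlin f (sg x 1)"
      by (rule q(1), erule (2) *) (use that in \<open>simp add: monoid_algebra_simps\<close>)
    then show ?thesis by (simp only: extend_scalars_fun_def extend_scalars_map_def mlin_single mult_1_left)
  qed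
  show "lin (extend_scalars \<phi> L) (extend_scalars_fun f)"
    unfolding extend_scalars_def extend_scalars_fun_def by (rule q(2)) (rule *)
qed

end

subsection \<open>Tensor products\<close>

context
  fixes M :: "('r::comm_ring_1, 'm) module" and N :: "('r, 'n) module"
  assumes M: "algebra_over M" and N: "algebra_over N"
begin

interpretation M: algebra_over M by (rule M)
interpretation N: algebra_over N by (rule N)

lemma monoid_prod: "monoid (M \<times>\<times> N)"
  by (simp add: DirProd_monoid)

lemma bilinear_rels_cases [consumes 1]:
  assumes "s \<in> bilinear_rels M N"
  obtains x x' y where "s = sg (x \<oplus>\<^bsub>M\<^esub> x', y) 1 - sg (x, y) 1 - sg (x', y) 1" "x \<in> carrier M" "x' \<in> carrier M" "y \<in> carrier N"
    | x y y' where "s = sg (x, y \<oplus>\<^bsub>N\<^esub> y') 1 - sg (x, y) 1 - sg (x, y') 1" "x \<in> carrier M" "y \<in> carrier N" "y' \<in> carrier N"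
    | r x y where "s = sg (r \<odot>\<^bsub>M\<^esub> x, y) 1 - sg (x, y) r" "x \<in> carrier M" "y \<in> carrier N"
    | r x y where "s = sg (x, r \<odot>\<^bsub>N\<^esub> y) 1 - sg (x, y) r" "x \<in> carrier M" "y \<in> carrier N"
  using assms unfolding bilinear_rels_def
  by (elim UnE CollectE exE conjE)
    (rule that(1), assumption+ | rule that(2), assumption+ | rule that(3), assumption+ | rule that(4), assumption+)+

lemma bilinear_rels_closed: "bilinear_rels M N \<subseteq> carrier (monoid_algebra (M \<times>\<times> N))"
proof
  fix s assume "s \<in> bilinear_rels M N"
  then show "s \<in> carrier (monoid_algebra (M \<times>\<times> N))"
    by (cases rule: bilinear_rels_cases) (simp_all add: monoid_algebra_simps keys_diff_subsetI)
qed

lemma tensor_is_algebra: "algebra_over (tensor M N)"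
  unfolding tensor_def
  by (intro algebra_over.quot_alg_is_algebra monoid_algebra_is_algebra bilinear_rels_closed monoid_prod)

lemma tens_closed: "x \<in> carrier M \<Longrightarrow> y \<in> carrier N \<Longrightarrow> tens M N x y \<in> carrier (tensor M N)"
  unfolding tensor_def tens_def
  by (rule algebra_over.quot_map_closed[OF monoid_algebra_is_algebra bilinear_rels_closed])
    (simp_all add: monoid_algebra_simps monoid_prod)

lemma tens_mult:
  "x \<in> carrier M \<Longrightarrow> y \<in> carrier N \<Longrightarrow> x' \<in> carrier M \<Longrightarrow> y' \<in> carrier N \<Longrightarrow>
    tens M N x y \<otimes>\<^bsub>tensor M N\<^esub> tens M N x' y' = tens M N (x \<otimes>\<^bsub>M\<^esub> x') (y \<otimes>\<^bsub>N\<^esub> y')"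
  unfolding tensor_def tens_def
  by (subst algebra_over.quot_map_mult[OF monoid_algebra_is_algebra bilinear_rels_closed])
    (simp_all add: monoid_algebra_simps monoid_prod)

lemma tens_one: "\<one>\<^bsub>tensor M N\<^esub> = tens M N \<one>\<^bsub>M\<^esub> \<one>\<^bsub>N\<^esub>"
  unfolding tensor_def tens_def
  by (subst algebra_over.quot_map_one[OF monoid_algebra_is_algebra bilinear_rels_closed])
    (simp_all add: monoid_algebra_simps monoid_prod)

lemma tens_add:
  "x \<in> carrier M \<Longrightarrow> x' \<in> carrier M \<Longrightarrow> y \<in> carrier N \<Longrightarrow>
    tens M N (x \<oplus>\<^bsub>M\<^esub> x') y = tens M N x y \<oplus>\<^bsub>tensor M N\<^esub> tens M N x' y" (is "_ \<Longrightarrow> _ \<Longrightarrow> _ \<Longrightarrow> ?l")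
  "x \<in> carrier M \<Longrightarrow> y \<in> carrier N \<Longrightarrow> y' \<in> carrier N \<Longrightarrow>
    tens M N x (y \<oplus>\<^bsub>N\<^esub> y') = tens M N x y \<oplus>\<^bsub>tensor M N\<^esub> tens M N x y'" (is "_ \<Longrightarrow> _ \<Longrightarrow> _ \<Longrightarrow> ?r")
proof -
  let ?q = "quot_map (monoid_algebra (M \<times>\<times> N)) (bilinear_rels M N)"
  have add: "?q (sg (x, y) 1 + sg (x', y') 1) = tens M N x y \<oplus>\<^bsub>tensor M N\<^esub> tens M N x' y'"
    if "x \<in> carrier M" "x' \<in> carrier M" "y \<in> carrier N" "y' \<in> carrier N" for x x' y y'
    using that unfolding tensor_def tens_def
    by (subst algebra_over.quot_map_add[OF monoid_algebra_is_algebra bilinear_rels_closed])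
      (simp_all add: monoid_algebra_simps monoid_prod)
  show ?l if c: "x \<in> carrier M" "x' \<in> carrier M" "y \<in> carrier N"
  proof -
    have "sg (x \<oplus>\<^bsub>M\<^esub> x', y) 1 - sg (x, y) 1 - sg (x', y) 1 \<in> bilinear_rels M N"
      using c unfolding bilinear_rels_def by blast
    then have "tens M N (x \<oplus>\<^bsub>M\<^esub> x') y = ?q (sg (x, y) 1 + sg (x', y) 1)"
      using c unfolding tens_def
      by (intro monoid_algebra_quot_rel bilinear_rels_closed keys_add_subsetI monoid_prod)
        (simp_all add: diff_diff_eq)
    also note add
    finally show ?thesis using c by simp
  qed
  show ?r if c: "x \<in> carrier M" "y \<in> carrier N" "y' \<in> carrier N"
  proof -
    have "sg (x, y \<oplus>\<^bsub>N\<^esub> y') 1 - sg (x, y) 1 - sg (x, y') 1 \<in> bilinear_rels M N"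
      using c unfolding bilinear_rels_def by blast
    then have "tens M N x (y \<oplus>\<^bsub>N\<^esub> y') = ?q (sg (x, y) 1 + sg (x, y') 1)"
      using c unfolding tens_def
      by (intro monoid_algebra_quot_rel bilinear_rels_closed keys_add_subsetI monoid_prod)
        (simp_all add: diff_diff_eq)
    also note add
    finally show ?thesis using c by simp
  qed
qed

lemma tens_smult:
  "x \<in> carrier M \<Longrightarrow> y \<in> carrier N \<Longrightarrow> tens M N (r \<odot>\<^bsub>M\<^esub> x) y = r \<odot>\<^bsub>tensor M N\<^esub> tens M N x y"  (is "_ \<Longrightarrow> _ \<Longrightarrow> ?l")
  "x \<in> carrier M \<Longrightarrow> y \<in> carrier N \<Longrightarrow> tens M N x (r \<odot>\<^bsub>N\<^esub> y) = r \<odot>\<^bsub>tensor M N\<^esub> tens M N x y" (is "_ \<Longrightarrow> _ \<Longrightarrow> ?r")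
proof -
  let ?q = "quot_map (monoid_algebra (M \<times>\<times> N)) (bilinear_rels M N)"
  have smult: "?q (sg (x, y) r) = r \<odot>\<^bsub>tensor M N\<^esub> tens M N x y"
    if "x \<in> carrier M" "y \<in> carrier N" for x y
    using that unfolding tensor_def tens_def
    by (subst algebra_over.quot_map_smult[OF monoid_algebra_is_algebra bilinear_rels_closed])
      (simp_all add: monoid_algebra_simps monoid_prod)
  assume c: "x \<in> carrier M" "y \<in> carrier N"
  have "sg (r \<odot>\<^bsub>M\<^esub> x, y) 1 - sg (x, y) r \<in> bilinear_rels M N" "sg (x, r \<odot>\<^bsub>N\<^esub> y) 1 - sg (x, y) r \<in> bilinear_rels M N"
    using c unfolding bilinear_rels_def by blast+
  then have "?q (sg (r \<odot>\<^bsub>M\<^esub> x, y) 1) = ?q (sg (x, y) r)" "?q (sg (x, r \<odot>\<^bsub>N\<^esub> y) 1) = ?q (sg (x, y) r)"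
    using c by (intro monoid_algebra_quot_rel monoid_prod bilinear_rels_closed; simp)+
  then show ?l ?r
    using smult[OF c] by (simp_all only: tens_def)
qed

lemma tensor_induct [consumes 1, case_names zero smult add]:
  assumes X: "X \<in> carrier (tensor M N)"
    and "P \<zero>\<^bsub>tensor M N\<^esub>"
    and "\<And>x y c. x \<in> carrier M \<Longrightarrow> y \<in> carrier N \<Longrightarrow> P (c \<odot>\<^bsub>tensor M N\<^esub> tens M N x y)"
    and "\<And>X Y. X \<in> carrier (tensor M N) \<Longrightarrow> Y \<in> carrier (tensor M N) \<Longrightarrow>
      P X \<Longrightarrow> P Y \<Longrightarrow> P (X \<oplus>\<^bsub>tensor M N\<^esub> Y)"
  shows "P X"
  using monoid_prod bilinear_rels_closed X[unfolded tensor_def]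
proof (rule monoid_algebra_quot_induct)
  fix p c assume "p \<in> carrier (M \<times>\<times> N)"
  then obtain x y where p: "p = (x, y)" "x \<in> carrier M" "y \<in> carrier N" by auto
  show "P (c \<odot>\<^bsub>quot_alg (monoid_algebra (M \<times>\<times> N)) (bilinear_rels M N)\<^esub>
      quot_map (monoid_algebra (M \<times>\<times> N)) (bilinear_rels M N) (sg p 1))"
    unfolding p(1) by (rule assms(3)[unfolded tensor_def tens_def, OF p(2,3)])
qed (fact assms(2)[unfolded tensor_def] | rule assms(4)[unfolded tensor_def], assumption+)+

definition tensor_fun :: "('m \<Rightarrow> 'r) \<Rightarrow> ('n \<Rightarrow> 'r) \<Rightarrow> ('m \<times> 'n \<Rightarrow>\<^sub>0 'r) set \<Rightarrow> 'r" where
  "tensor_fun f g X = the_elem (mlin (\<lambda>(x, y). f x * g y) ` X)"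

lemma
  assumes f: "lin M f" and g: "lin N g"
  shows tensor_fun_tens: "\<And>x y. x \<in> carrier M \<Longrightarrow> y \<in> carrier N \<Longrightarrow> tensor_fun f g (tens M N x y) = f x * g y"
    and tensor_fun_lin: "lin (tensor M N) (tensor_fun f g)"
proof -
  let ?G = "M \<times>\<times> N" and ?h = "\<lambda>(x, y). f x * g y"
  have *: "mlin ?h (sg p 1 \<otimes>\<^bsub>monoid_algebra ?G\<^esub> s \<otimes>\<^bsub>monoid_algebra ?G\<^esub> sg q 1) = 0"
    if p: "p \<in> carrier ?G" and q: "q \<in> carrier ?G" and s: "s \<in> bilinear_rels M N" for p q s
  proof -
    obtain a a' b b' where ab: "p = (a, a')" "q = (b, b')" "a \<in> carrier M" "a' \<in> carrier N" "b \<in> carrier M" "b' \<in> carrier N"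
      using p q by auto
    have m: "sg p 1 \<otimes>\<^bsub>monoid_algebra ?G\<^esub> (u - v) \<otimes>\<^bsub>monoid_algebra ?G\<^esub> sg q 1 =
       sg p 1 \<otimes>\<^bsub>monoid_algebra ?G\<^esub> u \<otimes>\<^bsub>monoid_algebra ?G\<^esub> sg q 1 -
       sg p (1::'r) \<otimes>\<^bsub>monoid_algebra ?G\<^esub> v \<otimes>\<^bsub>monoid_algebra ?G\<^esub> sg q 1" for u v p q
      using monoid_algebra_mult_add_right[of ?G "sg p 1" "u - v" v]
        monoid_algebra_mult_add_left[of ?G "sg p 1 \<otimes>\<^bsub>monoid_algebra ?G\<^esub> (u - v)" "sg p 1 \<otimes>\<^bsub>monoid_algebra ?G\<^esub> v" "sg q 1"]
      by simp
    from s show ?thesis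
      by (cases rule: bilinear_rels_cases) (simp_all add: ab m mlin_diff M.r_distr M.l_distr N.r_distr N.l_distr semilin_add[OF f] semilin_add[OF g]
        M.smult_mult_r M.smult_mult_l semilin_smult[OF f] N.smult_mult_r N.smult_mult_l semilin_smult[OF g] distrib_right distrib_left)
  qed
  note q = monoid_algebra_quot_functional[OF monoid_prod bilinear_rels_closed]
  show "tensor_fun f g (tens M N x y) = f x * g y" if "x \<in> carrier M" "y \<in> carrier N" for x y
  proof -
    have "the_elem (mlin ?h ` quot_map (monoid_algebra ?G) (bilinear_rels M N) (sg (x, y) 1)) = mlin ?h (sg (x, y) 1)"
      by (rule q(1), erule (2) *) (use that in \<open>simp add: monoid_algebra_simps\<close>)
    then show ?thesis by (simp only: tensor_fun_def tens_def mlin_single mult_1_left prod.case)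
  qed
  show "lin (tensor M N) (tensor_fun f g)"
    unfolding tensor_def tensor_fun_def by (rule q(2)) (rule *)
qed

end


section \<open>The quantized enveloping algebra\<close>

subsection \<open>Quantum integers\<close>

lemma qq_pow: "qq ^ n = Fract (monom 1 n) 1"
  by (induction n) (simp_all add: qq_def One_fract_def monom_0 monom_Suc one_pCons)

lemma qq_pow_neq_one: "n > 0 \<Longrightarrow> qq ^ n \<noteq> 1"
proof
  assume n: "n > 0" and "qq ^ n = 1"
  then have "monom (1::rat) n = 1" by (simp add: qq_pow One_fract_def eq_fract)
  then have "degree (monom (1::rat) n) = 0" by simp
  with n show False by (simp add: degree_monom_eq)
qed

lemma qq_neq_zero [simp]: "qq \<noteq> 0"
  by (simp add: qq_def Zero_fract_def eq_fract)

lemma qq_powi_diff_neq_zero: "m \<noteq> 0 \<Longrightarrow> qq powi m - qq powi (- m) \<noteq> 0"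
proof
  assume m: "m \<noteq> 0" and "qq powi m - qq powi (- m) = 0"
  then have "qq powi m = qq powi (- m)" by simp
  then have e: "qq powi (2 * m) = 1"
    using power_int_add[of qq m m] power_int_add[of qq m "- m"] by simp
  show False
  proof (cases "m > 0")
    case True
    then have "qq ^ nat (2 * m) = 1" using e by (simp add: power_int_def)
    then show False using qq_pow_neq_one[of "nat (2 * m)"] True by simp
  next
    case False
    then have "inverse (qq ^ nat (- (2 * m))) = 1" using e m by (simp add: power_int_def power_inverse)
    then have "qq ^ nat (- (2 * m)) = 1" by (metis inverse_inverse_eq inverse_1)
    then show False using qq_pow_neq_one[of "nat (- (2 * m))"] False m by simp
  qed
qed

lemma qq_inverse_diff_neq_zero [simp]: "qq - inverse qq \<noteq> 0" "qq \<noteq> inverse qq"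
  using qq_powi_diff_neq_zero[of 1] by (simp_all add: power_int_minus)

definition qn :: "int \<Rightarrow> ratfun" where
  "qn m = (qq powi m - qq powi (- m)) / (qq - inverse qq)"

lemma qn_0 [simp]: "qn 0 = 0" and qn_1 [simp]: "qn 1 = 1"
  by (simp_all add: qn_def power_int_minus)

lemma qn_neq_zero: "m \<noteq> 0 \<Longrightarrow> qn m \<noteq> 0"
  using qq_powi_diff_neq_zero by (simp add: qn_def)

text \<open>With a = i and b = N - i this is the relation for EF - FE on the coordinate i of the
  module of highest weight N.\<close>

lemma qn_mult_diff: "qn (a + 1) * qn b - qn a * qn (b + 1) = qn (b - a)"
proof -
  have "qq powi a \<noteq> 0" "qq powi b \<noteq> 0" by simp_all
  moreover obtain d where d: "d = qq - inverse qq" "d \<noteq> 0" by simp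
  ultimately show ?thesis unfolding qn_def d(1)[symmetric]
    by (simp add: power_int_add power_int_diff power_int_minus divide_simps) (simp add: d(1) field_simps)
qed

text \<open>The source of the q-Pascal rules: splitting a quantum integer as [(m - t) + (t + 1)]
  gives the rule for Gaussian binomials, and [(l + 1 - t) + t] the one for the
  comultiplication.\<close>

lemma qn_add: "qn (a + b) = qq powi b * qn a + qq powi (- a) * qn b"
  by (simp add: qn_def power_int_add power_int_diff power_int_minus divide_simps) (simp add: algebra_simps)

subsection \<open>Homomorphisms out of the free algebra\<close>

lemma monoid_free_monoid [simp]: "monoid free_monoid"
  by (rule monoidI) (auto simp: free_monoid_def)

lemma free_alg_is_algebra: "algebra_over free_alg"
  unfolding free_alg_def by (rule monoid_algebra_is_algebra) simp

lemma free_monoid_simps [simp]: "carrier free_monoid = UNIV" "x \<otimes>\<^bsub>free_monoid\<^esub> y = x @ y" "\<one>\<^bsub>free_monoid\<^esub> = []"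
  by (simp_all add: free_monoid_def)

lemma uq_rels_closed: "uq_rels \<subseteq> carrier (monoid_algebra free_monoid)"
  by (simp add: monoid_algebra_simps)

text \<open>Triple products are bracketed to the right because words are evaluated by
  \<open>foldr\<close>.\<close>

definition uq_relations :: "(ratfun, 'm) module \<Rightarrow> (gen \<Rightarrow> 'm) \<Rightarrow> bool" where
  "uq_relations N h \<longleftrightarrow> range h \<subseteq> carrier N \<and>
    h GK \<otimes>\<^bsub>N\<^esub> h GKi = \<one>\<^bsub>N\<^esub> \<and> h GKi \<otimes>\<^bsub>N\<^esub> h GK = \<one>\<^bsub>N\<^esub> \<and>
    h GK \<otimes>\<^bsub>N\<^esub> (h GE \<otimes>\<^bsub>N\<^esub> h GKi) = (qq powi 2) \<odot>\<^bsub>N\<^esub> h GE \<and>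
    h GK \<otimes>\<^bsub>N\<^esub> (h GF \<otimes>\<^bsub>N\<^esub> h GKi) = (qq powi (- 2)) \<odot>\<^bsub>N\<^esub> h GF \<and>
    h GE \<otimes>\<^bsub>N\<^esub> h GF \<ominus>\<^bsub>N\<^esub> h GF \<otimes>\<^bsub>N\<^esub> h GE =
      (1 / (qq - inverse qq)) \<odot>\<^bsub>N\<^esub> h GK \<ominus>\<^bsub>N\<^esub> (1 / (qq - inverse qq)) \<odot>\<^bsub>N\<^esub> h GKi"

context
  fixes N :: "(ratfun, 'm) module" and h :: "gen \<Rightarrow> 'm"
  assumes N: "algebra_over N" and h: "range h \<subseteq> carrier N"
begin

interpretation N: algebra_over N by (rule N)

definition word_eval :: "gen list \<Rightarrow> 'm" where
  "word_eval w = foldr (\<lambda>g x. h g \<otimes>\<^bsub>N\<^esub> x) w \<one>\<^bsub>N\<^esub>"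

lemma h_closed [simp]: "h g \<in> carrier N"
  using h by blast

lemma word_eval_closed [simp]: "word_eval w \<in> carrier N"
  by (induction w) (simp_all add: word_eval_def)

lemma word_eval_append: "word_eval (u @ v) = word_eval u \<otimes>\<^bsub>N\<^esub> word_eval v"
proof (induction u)
  case (Cons g u)
  have "word_eval (x # w) = h x \<otimes>\<^bsub>N\<^esub> word_eval w" for x w by (simp add: word_eval_def)
  with Cons show ?case by (simp add: N.m_assoc)
qed (simp add: word_eval_def[of "[]"])

lemma free_eval_superset:
  assumes "finite A" "Poly_Mapping.keys f \<subseteq> A"
  shows "free_eval N h f = (\<Oplus>\<^bsub>N\<^esub>w\<in>A. Poly_Mapping.lookup f w \<odot>\<^bsub>N\<^esub> word_eval w)"
  unfolding free_eval_def word_eval_def[symmetric]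
  by (rule N.add.finprod_mono_neutral_cong_left) (use assms in \<open>auto simp: in_keys_iff\<close>)

lemma free_eval_closed: "free_eval N h f \<in> carrier N"
  unfolding free_eval_def word_eval_def[symmetric] by (rule N.finsum_closed) auto

lemma free_eval_add: "free_eval N h (f + g) = free_eval N h f \<oplus>\<^bsub>N\<^esub> free_eval N h g"
proof -
  let ?A = "Poly_Mapping.keys f \<union> Poly_Mapping.keys g"
  have "free_eval N h k = (\<Oplus>\<^bsub>N\<^esub>w\<in>?A. Poly_Mapping.lookup k w \<odot>\<^bsub>N\<^esub> word_eval w)" if "k \<in> {f, g, f + g}" for k
    using that keys_add_subsetI[of f ?A g] by (intro free_eval_superset) auto
  then show ?thesis by (simp add: lookup_add N.smult_l_distr N.finsum_addf)
qed

lemma free_eval_single: "free_eval N h (sg w a) = a \<odot>\<^bsub>N\<^esub> word_eval w"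
  by (subst free_eval_superset[of "{w}"]) (auto simp: N.finsum_insert)

lemma free_eval_zero: "free_eval N h 0 = \<zero>\<^bsub>N\<^esub>"
  by (simp add: free_eval_def)

lemma free_eval_smult: "free_eval N h (Poly_Mapping.map ((*) r) f) = r \<odot>\<^bsub>N\<^esub> free_eval N h f"
  using subset_UNIV[of "Poly_Mapping.keys f"]
proof (induction rule: poly_mapping_span_induct)
  case (add f g)
  then show ?case by (simp add: map_times_add free_eval_add N.smult_r_distr free_eval_closed)
qed (simp_all add: free_eval_single free_eval_zero N.smult_assoc)

lemma free_eval_mult: "free_eval N h (f \<otimes>\<^bsub>monoid_algebra free_monoid\<^esub> g) = free_eval N h f \<otimes>\<^bsub>N\<^esub> free_eval N h g"
  using subset_UNIV[of "Poly_Mapping.keys f"]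
proof (induction rule: poly_mapping_span_induct)
  case (single u a)
  show ?case using subset_UNIV[of "Poly_Mapping.keys g"]
  proof (induction rule: poly_mapping_span_induct)
    case (add f g)
    then show ?case by (simp add: monoid_algebra_mult_add_right free_eval_add N.r_distr free_eval_closed)
  qed (simp_all add: free_eval_single free_eval_zero word_eval_append N.smult_mult_l N.smult_mult_r mult.commute
      flip: N.smult_assoc)
next
  case (add f g)
  then show ?case by (simp add: monoid_algebra_mult_add_left free_eval_add N.l_distr free_eval_closed)
qed (simp add: free_eval_zero free_eval_closed)

lemma free_eval_hom: "alg_hom free_alg N (free_eval N h)"
  by (simp add: alg_hom_def free_alg_def monoid_algebra_simps free_eval_closed image_subset_iff
    free_eval_single word_eval_def free_eval_add free_eval_mult free_eval_smult)

lemma free_eval_diff: "free_eval N h (f - g) = free_eval N h f \<ominus>\<^bsub>N\<^esub> free_eval N h g"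
proof -
  have "free_eval N h (f - g) \<oplus>\<^bsub>N\<^esub> free_eval N h g = free_eval N h f"
    by (simp flip: free_eval_add)
  then show ?thesis
    by (metis N.add.inv_closed N.add.m_assoc N.minus_eq N.r_neg N.r_zero free_eval_closed)
qed

lemma word_eval_simps: "word_eval [] = \<one>\<^bsub>N\<^esub>" "word_eval (g # w) = h g \<otimes>\<^bsub>N\<^esub> word_eval w"
  by (simp_all add: word_eval_def)

lemma free_eval_uq_rels:
  assumes "uq_relations N h" "r \<in> uq_rels"
  shows "free_eval N h r = \<zero>\<^bsub>N\<^esub>"
proof -
  have d: "x \<ominus>\<^bsub>N\<^esub> x = \<zero>\<^bsub>N\<^esub>" if "x \<in> carrier N" for x using that by (simp add: N.minus_eq N.r_neg)
  show ?thesis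
    using assms(2,1) unfolding uq_rels_def uq_relations_def
    by (elim insertE emptyE; hypsubst; simp add: free_eval_diff free_eval_single word_eval_simps d)
qed

end

lemma uq_hom:
  assumes N: "algebra_over N" and h: "uq_relations N h"
  shows uq_hom_alg_hom: "alg_hom Uq N (uq_hom N h)" and uq_hom_ug: "uq_hom N h (ug g) = h g"
proof -
  interpret N: algebra_over N by fact
  interpret free: algebra_over free_alg by (rule free_alg_is_algebra)
  have r: "range h \<subseteq> carrier N" using h by (simp add: uq_relations_def)
  note l = free.quot_alg_lift[OF uq_rels_closed[folded free_alg_def] N free_eval_hom[OF N r] free_eval_uq_rels[OF N r h]]
  show "alg_hom Uq N (uq_hom N h)"
    using l(2) by (simp add: Uq_def uq_hom_def[abs_def])
  have "uq_hom N h (ug g) = free_eval N h (sg [g] 1)"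
    using l(1)[of "sg [g] 1"] by (simp add: uq_hom_def ug_def free_alg_def monoid_algebra_simps)
  also have "\<dots> = h g"
    using N.one_closed r by (simp add: free_eval_single[OF N r] word_eval_simps[OF N r] h_closed[OF N r])
  finally show "uq_hom N h (ug g) = h g" .
qed

lemma Uq_is_algebra: "algebra_over Uq"
  unfolding Uq_def free_alg_def
  by (rule algebra_over.quot_alg_is_algebra[OF monoid_algebra_is_algebra uq_rels_closed]) simp

lemma ug_closed: "ug g \<in> carrier Uq"
  unfolding Uq_def ug_def
  by (rule algebra_over.quot_map_closed[OF free_alg_is_algebra])
    (simp_all add: uq_rels_closed free_alg_def monoid_algebra_simps)

text \<open>Elements are built by left multiplication with generators only. This suits functionals
  whose behaviour is prescribed under left multiplication.\<close>

lemma Uq_generators_induct [consumes 1, case_names one gen add smult]: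
  assumes X: "X \<in> carrier Uq"
    and one: "P \<one>\<^bsub>Uq\<^esub>"
    and gen: "\<And>X g. X \<in> carrier Uq \<Longrightarrow> P X \<Longrightarrow> P (ug g \<otimes>\<^bsub>Uq\<^esub> X)"
    and add: "\<And>X Y. X \<in> carrier Uq \<Longrightarrow> Y \<in> carrier Uq \<Longrightarrow> P X \<Longrightarrow> P Y \<Longrightarrow> P (X \<oplus>\<^bsub>Uq\<^esub> Y)"
    and smult: "\<And>X a. X \<in> carrier Uq \<Longrightarrow> P X \<Longrightarrow> P (a \<odot>\<^bsub>Uq\<^esub> X)"
  shows "P X"
proof -
  interpret U: algebra_over Uq by (rule Uq_is_algebra)
  interpret free: algebra_over "monoid_algebra free_monoid :: (ratfun, _) module" by (rule monoid_algebra_is_algebra) simp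
  note c = uq_rels_closed
  let ?q = "quot_map (monoid_algebra free_monoid) uq_rels"
  have word: "P (?q (sg w 1)) \<and> ?q (sg w 1) \<in> carrier Uq" for w
  proof (induction w)
    case Nil
    show ?case using one free.quot_map_one[OF c] U.one_closed by (simp add: Uq_def free_alg_def monoid_algebra_simps)
  next
    case (Cons g w)
    have "?q (sg (g # w) 1) = ug g \<otimes>\<^bsub>Uq\<^esub> ?q (sg w 1)"
      by (simp add: Uq_def ug_def free_alg_def free.quot_map_mult[OF c] monoid_algebra_simps)
    then show ?case using gen[of "?q (sg w 1)" g] Cons ug_closed[of g] by simp
  qed
  have zero: "P \<zero>\<^bsub>Uq\<^esub>" using smult[OF U.one_closed one, of 0] by simp
  show ?thesis
    using monoid_free_monoid c X[unfolded Uq_def free_alg_def]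
  proof (rule monoid_algebra_quot_induct)
    fix w a
    show "P (a \<odot>\<^bsub>quot_alg (monoid_algebra free_monoid) uq_rels\<^esub> ?q (sg w 1))"
      using smult[of "?q (sg w 1)" a] word[of w] unfolding Uq_def free_alg_def by blast
  qed (fact zero[unfolded Uq_def free_alg_def] | rule add[unfolded Uq_def free_alg_def], assumption+)+
qed

lemma ug_relations: "uq_relations Uq ug"
proof -
  interpret U: algebra_over Uq by (rule Uq_is_algebra)
  interpret free: algebra_over "free_alg" by (rule free_alg_is_algebra)
  note c = uq_rels_closed[folded free_alg_def]
  have m: "quot_map free_alg uq_rels (sg (g # w) a) = ug g \<otimes>\<^bsub>Uq\<^esub> quot_map free_alg uq_rels (sg w a)" for g w a
    unfolding Uq_def ug_def
    by (subst free.quot_map_mult[OF c]) (simp_all add: free_alg_def monoid_algebra_simps)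
  have n: "quot_map free_alg uq_rels (sg [] a) = a \<odot>\<^bsub>Uq\<^esub> \<one>\<^bsub>Uq\<^esub>" for a
    unfolding Uq_def
    by (subst free.quot_map_one[OF c], subst free.quot_map_smult[OF c]) (simp_all add: free_alg_def monoid_algebra_simps)
  have d: "quot_map free_alg uq_rels (f - g) = quot_map free_alg uq_rels f \<ominus>\<^bsub>Uq\<^esub> quot_map free_alg uq_rels g" for f g
  proof -
    have fg: "f - g = f \<ominus>\<^bsub>free_alg\<^esub> g"
    proof -
      have "f - g = f \<oplus>\<^bsub>free_alg\<^esub> (- 1) \<odot>\<^bsub>free_alg\<^esub> g"
        by (rule poly_mapping_eqI) (simp add: free_alg_def monoid_algebra_simps lookup_add lookup_minus)
      then show ?thesis
        by (subst (asm) free.smult_minus_one) (simp_all add: free_alg_def monoid_algebra_simps free.minus_eq[unfolded free_alg_def])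
    qed
    show ?thesis
      unfolding fg Uq_def
      by (rule alg_hom_diff[OF free_alg_is_algebra _ free.quot_map_hom[OF c]])
        (simp_all add: Uq_is_algebra[unfolded Uq_def free_alg_def] free_alg_def monoid_algebra_simps)
  qed
  let ?q = "quot_map free_alg uq_rels" and ?c = "1 / (qq - inverse qq)"
  have rel: "?q f = ?q g" if "f - g \<in> uq_rels" for f g
    using that unfolding free_alg_def by (intro monoid_algebra_quot_rel uq_rels_closed) simp_all
  have o: "a \<odot>\<^bsub>Uq\<^esub> \<one>\<^bsub>Uq\<^esub> \<in> carrier Uq" for a by simp
  have mult_n: "ug g \<otimes>\<^bsub>Uq\<^esub> (a \<odot>\<^bsub>Uq\<^esub> \<one>\<^bsub>Uq\<^esub>) = a \<odot>\<^bsub>Uq\<^esub> ug g" for g a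
    by (simp add: U.smult_mult_r ug_closed)
  show ?thesis
    unfolding uq_relations_def
  proof (intro conjI)
    show "range ug \<subseteq> carrier Uq" using ug_closed by blast
    have "?q (sg [GK, GKi] 1) = ?q (sg [] 1)" by (rule rel) (unfold uq_rels_def, blast)
    then show "ug GK \<otimes>\<^bsub>Uq\<^esub> ug GKi = \<one>\<^bsub>Uq\<^esub>" by (simp only: m n mult_n) (simp add: ug_closed)
    have "?q (sg [GKi, GK] 1) = ?q (sg [] 1)" by (rule rel) (unfold uq_rels_def, blast)
    then show "ug GKi \<otimes>\<^bsub>Uq\<^esub> ug GK = \<one>\<^bsub>Uq\<^esub>" by (simp only: m n mult_n) (simp add: ug_closed)
    have "?q (sg [GK, GE, GKi] 1) = ?q (sg [GE] (qq powi 2))" by (rule rel) (unfold uq_rels_def, blast)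
    then show "ug GK \<otimes>\<^bsub>Uq\<^esub> (ug GE \<otimes>\<^bsub>Uq\<^esub> ug GKi) = (qq powi 2) \<odot>\<^bsub>Uq\<^esub> ug GE"
      by (simp only: m n mult_n) (simp add: ug_closed)
    have "?q (sg [GK, GF, GKi] 1) = ?q (sg [GF] (qq powi (- 2)))" by (rule rel) (unfold uq_rels_def, blast)
    then show "ug GK \<otimes>\<^bsub>Uq\<^esub> (ug GF \<otimes>\<^bsub>Uq\<^esub> ug GKi) = (qq powi (- 2)) \<odot>\<^bsub>Uq\<^esub> ug GF"
      by (simp only: m n mult_n) (simp add: ug_closed)
    have "?q (sg [GE, GF] 1 - sg [GF, GE] 1) = ?q (sg [GK] ?c - sg [GKi] ?c)"
      by (rule rel) (unfold uq_rels_def, blast)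
    then show "ug GE \<otimes>\<^bsub>Uq\<^esub> ug GF \<ominus>\<^bsub>Uq\<^esub> ug GF \<otimes>\<^bsub>Uq\<^esub> ug GE =
      ?c \<odot>\<^bsub>Uq\<^esub> ug GK \<ominus>\<^bsub>Uq\<^esub> ?c \<odot>\<^bsub>Uq\<^esub> ug GKi"
      by (simp only: d m n mult_n U.smult_one[OF ug_closed])
  qed
qed


subsection \<open>The algebra and its tensor square as types\<close>

text \<open>The calculations with divided powers take place in types rather than carriers, so that
  ring simplification works without closure conditions. The algebra and its tensor square share this
  class.\<close>

class ratfun_algebra = ring + monoid_mult +
  fixes scal :: "ratfun \<Rightarrow> 'a \<Rightarrow> 'a" (infixr \<open>*\<^sub>q\<close> 75)
  assumes scal_add_right: "a *\<^sub>q (x + y) = a *\<^sub>q x + a *\<^sub>q y"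
    and scal_add_left: "(a + b) *\<^sub>q x = a *\<^sub>q x + b *\<^sub>q x"
    and scal_scal [simp]: "a *\<^sub>q b *\<^sub>q x = (a * b) *\<^sub>q x"
    and scal_one [simp]: "1 *\<^sub>q x = x"
    and scal_mult_left [simp]: "(a *\<^sub>q x) * y = a *\<^sub>q (x * y)"
    and scal_mult_right [simp]: "x * (a *\<^sub>q y) = a *\<^sub>q (x * y)"
begin

lemma scal_zero_right [simp]: "a *\<^sub>q 0 = 0"
  using scal_add_right[of a 0 0] by simp

lemma scal_zero_left [simp]: "0 *\<^sub>q x = 0"
  using scal_add_left[of 0 0 x] by simp

lemma scal_minus_right: "a *\<^sub>q (- x) = - (a *\<^sub>q x)"
  using scal_add_right[of a x "- x"] by (simp add: eq_neg_iff_add_eq_0 add.commute)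

lemma scal_minus_left: "(- a) *\<^sub>q x = - (a *\<^sub>q x)"
  using scal_add_left[of a "- a" x] by (simp add: eq_neg_iff_add_eq_0 add.commute)

lemma scal_diff_right: "a *\<^sub>q (x - y) = a *\<^sub>q x - a *\<^sub>q y"
  using scal_add_right[of a x "- y"] by (simp add: scal_minus_right)

lemma scal_diff_left: "(a - b) *\<^sub>q x = a *\<^sub>q x - b *\<^sub>q x"
  using scal_add_left[of a "- b" x] by (simp add: scal_minus_left)

lemma scal_sum_right: "a *\<^sub>q (\<Sum>i\<in>A. f i) = (\<Sum>i\<in>A. a *\<^sub>q f i)"
  by (induction A rule: infinite_finite_induct) (simp_all add: scal_add_right)

lemma scal_cancel: "a \<noteq> 0 \<Longrightarrow> a *\<^sub>q x = a *\<^sub>q y \<Longrightarrow> x = y"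
proof -
  assume a: "a \<noteq> 0" and "a *\<^sub>q x = a *\<^sub>q y"
  then have "inverse a *\<^sub>q a *\<^sub>q x = inverse a *\<^sub>q a *\<^sub>q y" by (simp only:)
  then show ?thesis using a by simp
qed

end

lemmas scal_distribs = scal_add_right scal_add_left scal_diff_right scal_diff_left scal_minus_left scal_minus_right

interpretation Uq: algebra_over Uq
  by (rule Uq_is_algebra)

interpretation UqUq: algebra_over "tensor Uq Uq"
  by (rule tensor_is_algebra[OF Uq_is_algebra Uq_is_algebra])

typedef uqt = "carrier Uq" morphisms rep_u abs_u
  using Uq.zero_closed by blast

typedef tqt = "carrier (tensor Uq Uq)" morphisms rep_t abs_t
  using UqUq.zero_closed by blast

lemmas rep_u_closed [simp] = rep_u and rep_t_closed [simp] = rep_t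

instantiation uqt :: ratfun_algebra
begin
definition "0 = abs_u \<zero>\<^bsub>Uq\<^esub>"
definition "1 = abs_u \<one>\<^bsub>Uq\<^esub>"
definition "x + y = abs_u (rep_u x \<oplus>\<^bsub>Uq\<^esub> rep_u y)"
definition "x * y = abs_u (rep_u x \<otimes>\<^bsub>Uq\<^esub> rep_u y)"
definition "- x = abs_u (\<ominus>\<^bsub>Uq\<^esub> rep_u x)"
definition "(x :: uqt) - y = x + (- y)"
definition "a *\<^sub>q x = abs_u (a \<odot>\<^bsub>Uq\<^esub> rep_u x)"
instance
proof
  fix x y z :: uqt and a b :: ratfun
  note d = zero_uqt_def one_uqt_def plus_uqt_def times_uqt_def uminus_uqt_def scal_uqt_def abs_u_inverse rep_u_inverse
  show "(x + y) + z = x + (y + z)" by (simp add: d Uq.a_assoc)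
  show "x + y = y + x" by (simp add: d Uq.a_comm)
  show "0 + x = x" by (simp add: d Uq.l_zero)
  show "- x + x = 0" by (simp add: d Uq.l_neg)
  show "(x * y) * z = x * (y * z)" by (simp add: d Uq.m_assoc)
  show "1 * x = x" by (simp add: d Uq.l_one)
  show "x * 1 = x" by (simp add: d Uq.r_one)
  show "(x + y) * z = x * z + y * z" by (simp add: d Uq.l_distr)
  show "x * (y + z) = x * y + x * z" by (simp add: d Uq.r_distr)
  show "a *\<^sub>q (x + y) = a *\<^sub>q x + a *\<^sub>q y" by (simp add: d Uq.smult_r_distr)
  show "(a + b) *\<^sub>q x = a *\<^sub>q x + b *\<^sub>q x" by (simp add: d Uq.smult_l_distr)
  show "a *\<^sub>q b *\<^sub>q x = (a * b) *\<^sub>q x" by (simp add: d Uq.smult_assoc)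
  show "1 *\<^sub>q x = x" by (simp add: d Uq.smult_one)
  show "(a *\<^sub>q x) * y = a *\<^sub>q (x * y)" by (simp add: d Uq.smult_mult_l)
  show "x * (a *\<^sub>q y) = a *\<^sub>q (x * y)" by (simp add: d Uq.smult_mult_r)
  show "x - y = x + - y" by (rule minus_uqt_def)
qed
end

instantiation tqt :: ratfun_algebra
begin
definition "0 = abs_t \<zero>\<^bsub>tensor Uq Uq\<^esub>"
definition "1 = abs_t \<one>\<^bsub>tensor Uq Uq\<^esub>"
definition "x + y = abs_t (rep_t x \<oplus>\<^bsub>tensor Uq Uq\<^esub> rep_t y)"
definition "x * y = abs_t (rep_t x \<otimes>\<^bsub>tensor Uq Uq\<^esub> rep_t y)"
definition "- x = abs_t (\<ominus>\<^bsub>tensor Uq Uq\<^esub> rep_t x)"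
definition "(x :: tqt) - y = x + (- y)"
definition "a *\<^sub>q x = abs_t (a \<odot>\<^bsub>tensor Uq Uq\<^esub> rep_t x)"
instance
proof
  fix x y z :: tqt and a b :: ratfun
  note d = zero_tqt_def one_tqt_def plus_tqt_def times_tqt_def uminus_tqt_def scal_tqt_def abs_t_inverse rep_t_inverse
  show "(x + y) + z = x + (y + z)" by (simp add: d UqUq.a_assoc)
  show "x + y = y + x" by (simp add: d UqUq.a_comm)
  show "0 + x = x" by (simp add: d UqUq.l_zero)
  show "- x + x = 0" by (simp add: d UqUq.l_neg)
  show "(x * y) * z = x * (y * z)" by (simp add: d UqUq.m_assoc)
  show "1 * x = x" by (simp add: d UqUq.l_one)
  show "x * 1 = x" by (simp add: d UqUq.r_one)
  show "(x + y) * z = x * z + y * z" by (simp add: d UqUq.l_distr)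
  show "x * (y + z) = x * y + x * z" by (simp add: d UqUq.r_distr)
  show "a *\<^sub>q (x + y) = a *\<^sub>q x + a *\<^sub>q y" by (simp add: d UqUq.smult_r_distr)
  show "(a + b) *\<^sub>q x = a *\<^sub>q x + b *\<^sub>q x" by (simp add: d UqUq.smult_l_distr)
  show "a *\<^sub>q b *\<^sub>q x = (a * b) *\<^sub>q x" by (simp add: d UqUq.smult_assoc)
  show "1 *\<^sub>q x = x" by (simp add: d UqUq.smult_one)
  show "(a *\<^sub>q x) * y = a *\<^sub>q (x * y)" by (simp add: d UqUq.smult_mult_l)
  show "x * (a *\<^sub>q y) = a *\<^sub>q (x * y)" by (simp add: d UqUq.smult_mult_r)
  show "x - y = x + - y" by (rule minus_tqt_def)
qed
end

lemma rep_u_simps: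
  "rep_u 0 = \<zero>\<^bsub>Uq\<^esub>" "rep_u 1 = \<one>\<^bsub>Uq\<^esub>" "rep_u (x + y) = rep_u x \<oplus>\<^bsub>Uq\<^esub> rep_u y"
  "rep_u (x * y) = rep_u x \<otimes>\<^bsub>Uq\<^esub> rep_u y" "rep_u (- x) = \<ominus>\<^bsub>Uq\<^esub> rep_u x"
  "rep_u (x - y) = rep_u x \<ominus>\<^bsub>Uq\<^esub> rep_u y" "rep_u (a *\<^sub>q x) = a \<odot>\<^bsub>Uq\<^esub> rep_u x"
  by (simp_all add: zero_uqt_def one_uqt_def plus_uqt_def times_uqt_def uminus_uqt_def minus_uqt_def
    scal_uqt_def abs_u_inverse Uq.minus_eq)

lemma rep_t_simps:
  "rep_t 0 = \<zero>\<^bsub>tensor Uq Uq\<^esub>" "rep_t 1 = \<one>\<^bsub>tensor Uq Uq\<^esub>" "rep_t (s + t) = rep_t s \<oplus>\<^bsub>tensor Uq Uq\<^esub> rep_t t"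
  "rep_t (s * t) = rep_t s \<otimes>\<^bsub>tensor Uq Uq\<^esub> rep_t t" "rep_t (- s) = \<ominus>\<^bsub>tensor Uq Uq\<^esub> rep_t s"
  "rep_t (s - t) = rep_t s \<ominus>\<^bsub>tensor Uq Uq\<^esub> rep_t t" "rep_t (a *\<^sub>q s) = a \<odot>\<^bsub>tensor Uq Uq\<^esub> rep_t s"
  by (simp_all add: zero_tqt_def one_tqt_def plus_tqt_def times_tqt_def uminus_tqt_def minus_tqt_def
    scal_tqt_def abs_t_inverse UqUq.minus_eq)

definition "uE = abs_u (ug GE)"
definition "uF = abs_u (ug GF)"
definition "uK = abs_u (ug GK)"
definition "uKi = abs_u (ug GKi)"

lemma rep_u_gens: "rep_u uE = ug GE" "rep_u uF = ug GF" "rep_u uK = ug GK" "rep_u uKi = ug GKi"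
  by (simp_all add: uE_def uF_def uK_def uKi_def abs_u_inverse ug_closed)

lemma uqt_induct [case_names one E F K Ki add scal]:
  assumes "P 1" "\<And>u. P u \<Longrightarrow> P (uE * u)" "\<And>u. P u \<Longrightarrow> P (uF * u)" "\<And>u. P u \<Longrightarrow> P (uK * u)" "\<And>u. P u \<Longrightarrow> P (uKi * u)"
    and "\<And>u v. P u \<Longrightarrow> P v \<Longrightarrow> P (u + v)" and "\<And>u a. P u \<Longrightarrow> P (a *\<^sub>q u)"
  shows "P u"
proof -
  have "P (abs_u X)" if "X \<in> carrier Uq" for X
    using that
  proof (induction rule: Uq_generators_induct)
    case one show ?case using assms(1) by (simp add: one_uqt_def)
  next
    case (gen X g)
    then have "abs_u (ug g \<otimes>\<^bsub>Uq\<^esub> X) = abs_u (ug g) * abs_u X"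
      by (simp add: times_uqt_def abs_u_inverse ug_closed)
    then show ?case using gen assms(2-5)[of "abs_u X"] by (cases g) (simp_all add: uE_def uF_def uK_def uKi_def)
  next
    case (add X Y)
    then show ?case using assms(6)[of "abs_u X" "abs_u Y"] by (simp add: plus_uqt_def abs_u_inverse)
  next
    case (smult X a)
    then show ?case using assms(7)[of "abs_u X" a] by (simp add: scal_uqt_def abs_u_inverse)
  qed
  from this[of "rep_u u"] show ?thesis by (simp add: rep_u_inverse)
qed

lemma uK_uKi [simp]: "uK * uKi = 1" "uKi * uK = 1"
  and uK_uE_uKi: "uK * (uE * uKi) = (qq powi 2) *\<^sub>q uE"
  and uK_uF_uKi: "uK * (uF * uKi) = (qq powi (- 2)) *\<^sub>q uF"
  and uE_uF_comm: "uE * uF - uF * uE = (1 / (qq - inverse qq)) *\<^sub>q uK - (1 / (qq - inverse qq)) *\<^sub>q uKi"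
  using ug_relations unfolding uq_relations_def rep_u_gens[symmetric] rep_u_simps[symmetric] rep_u_inject
  by blast+

lemma uK_uKi_assoc [simp]: "uK * (uKi * x) = x" "uKi * (uK * x) = x"
  by (simp_all flip: mult.assoc)

lemma uK_uE: "uK * uE = (qq powi 2) *\<^sub>q (uE * uK)"
proof -
  have "uK * uE = (uK * (uE * uKi)) * uK" by (simp add: mult.assoc)
  then show ?thesis by (simp add: uK_uE_uKi)
qed

lemma uK_uF: "uK * uF = (qq powi (- 2)) *\<^sub>q (uF * uK)"
proof -
  have "uK * uF = (uK * (uF * uKi)) * uK" by (simp add: mult.assoc)
  then show ?thesis by (simp add: uK_uF_uKi)
qed

lemma qq_powi_two_cancel [simp]: "qq powi (- 2) * qq\<^sup>2 = 1" "qq\<^sup>2 * qq powi (- 2) = 1"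
  by (simp_all add: power_int_minus)

lemma uE_uK: "uE * uK = (qq powi (- 2)) *\<^sub>q (uK * uE)" and uF_uK: "uF * uK = (qq powi 2) *\<^sub>q (uK * uF)"
  by (simp_all add: uK_uE uK_uF)

lemma uE_uKi: "uE * uKi = (qq powi 2) *\<^sub>q (uKi * uE)" and uF_uKi: "uF * uKi = (qq powi (- 2)) *\<^sub>q (uKi * uF)"
proof -
  have "uE * uKi = uKi * (uK * (uE * uKi))" "uF * uKi = uKi * (uK * (uF * uKi))" by simp_all
  then show "uE * uKi = (qq powi 2) *\<^sub>q (uKi * uE)" "uF * uKi = (qq powi (- 2)) *\<^sub>q (uKi * uF)"
    by (simp_all only: uK_uE_uKi uK_uF_uKi scal_mult_right)
qed

lemma uKi_uE: "uKi * uE = (qq powi (- 2)) *\<^sub>q (uE * uKi)" and uKi_uF: "uKi * uF = (qq powi 2) *\<^sub>q (uF * uKi)"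
  by (simp_all add: uE_uKi uF_uKi)

text \<open>Rewriting with these moves all powers of \<open>K\<close> to the right.\<close>

lemma K_right:
  "uK * (uE * x) = (qq powi 2) *\<^sub>q (uE * (uK * x))" "uK * (uF * x) = (qq powi (- 2)) *\<^sub>q (uF * (uK * x))"
  "uKi * (uE * x) = (qq powi (- 2)) *\<^sub>q (uE * (uKi * x))" "uKi * (uF * x) = (qq powi 2) *\<^sub>q (uF * (uKi * x))"
  by (simp_all add: uK_uE uK_uF uKi_uE uKi_uF flip: mult.assoc)

lemmas K_right_simps = K_right uK_uE uK_uF uKi_uE uKi_uF

definition tn :: "uqt \<Rightarrow> uqt \<Rightarrow> tqt" where
  "tn x y = abs_t (tens Uq Uq (rep_u x) (rep_u y))"

lemma rep_t_tn: "rep_t (tn x y) = tens Uq Uq (rep_u x) (rep_u y)"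
  by (simp add: tn_def abs_t_inverse tens_closed Uq_is_algebra)

lemma tn_mult [simp]: "tn x y * tn x' y' = tn (x * x') (y * y')"
  and tn_one: "1 = tn 1 1"
  and tn_add_left: "tn (x + x') y = tn x y + tn x' y"
  and tn_add_right: "tn x (y + y') = tn x y + tn x y'"
  and tn_scal_left [simp]: "tn (a *\<^sub>q x) y = a *\<^sub>q tn x y"
  and tn_scal_right [simp]: "tn x (a *\<^sub>q y) = a *\<^sub>q tn x y"
  using tens_mult[OF Uq_is_algebra Uq_is_algebra] tens_add[OF Uq_is_algebra Uq_is_algebra]
    tens_one[OF Uq_is_algebra Uq_is_algebra] tens_smult[OF Uq_is_algebra Uq_is_algebra]
  by (simp_all add: rep_t_simps rep_t_tn rep_u_simps flip: rep_t_inject)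

lemma tn_zero [simp]: "tn 0 y = 0" "tn x 0 = 0"
  using tn_scal_left[of 0 0 y] tn_scal_right[of x 0 0] by simp_all

lemma tn_minus: "tn (- x) y = - tn x y" "tn x (- y) = - tn x y"
  using tn_add_left[of x "- x" y] tn_add_right[of x y "- y"] by (simp_all add: eq_neg_iff_add_eq_0 add.commute)

lemma tn_diff: "tn (x - x') y = tn x y - tn x' y" "tn x (y - y') = tn x y - tn x y'"
  using tn_add_left[of x "- x'" y] tn_add_right[of x y "- y'"] by (simp_all add: tn_minus)

lemma tqt_induct [case_names zero scal add]:
  assumes "P 0" "\<And>x y c. P (c *\<^sub>q tn x y)" "\<And>s t. P s \<Longrightarrow> P t \<Longrightarrow> P (s + t)"
  shows "P t"
proof -
  have "P (abs_t X)" if "X \<in> carrier (tensor Uq Uq)" for X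
    using that
  proof (induction rule: tensor_induct[OF Uq_is_algebra Uq_is_algebra, consumes 1, case_names zero smult add])
    case zero show ?case using assms(1) by (simp add: zero_tqt_def)
  next
    case (smult x y c)
    then show ?case using assms(2)[of c "abs_u x" "abs_u y"]
      by (simp add: scal_tqt_def tn_def abs_u_inverse abs_t_inverse tens_closed Uq_is_algebra)
  next
    case (add X Y)
    then show ?case using assms(3)[of "abs_t X" "abs_t Y"] by (simp add: plus_tqt_def abs_t_inverse)
  qed
  from this[of "rep_t t"] show ?thesis by (simp add: rep_t_inverse)
qed

subsection \<open>Comultiplication and antipode\<close>

lemma comult_relations:
  "uq_relations (tensor Uq Uq) (\<lambda>g. case g of
       GE \<Rightarrow> tens Uq Uq (ug GE) (ug GK) \<oplus>\<^bsub>tensor Uq Uq\<^esub> tens Uq Uq \<one>\<^bsub>Uq\<^esub> (ug GE)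
     | GF \<Rightarrow> tens Uq Uq (ug GF) \<one>\<^bsub>Uq\<^esub> \<oplus>\<^bsub>tensor Uq Uq\<^esub> tens Uq Uq (ug GKi) (ug GF)
     | GK \<Rightarrow> tens Uq Uq (ug GK) (ug GK)
     | GKi \<Rightarrow> tens Uq Uq (ug GKi) (ug GKi))"
proof -
  let ?d = "1 / (qq - inverse qq)"
  \<comment> \<open>The factors q^2 and q^-2 cancel in the mixed product of E \<otimes> K and K^-1
    \<otimes> F, so these two elements commute. What remains of the commutator is [E,F] \<otimes> K
    + K^-1 \<otimes> [E,F], where the terms K^-1 \<otimes> K cancel.\<close>
  have c: "(uE * uKi) = (qq powi 2) *\<^sub>q (uKi * uE)" "uK * uF = (qq powi (- 2)) *\<^sub>q (uF * uK)"
    using uE_uKi uK_uF by auto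
  have EF: "uE * uF = uF * uE + ?d *\<^sub>q uK - ?d *\<^sub>q uKi"
    using uE_uF_comm by (simp add: algebra_simps)
  have "(tn uE uK + tn 1 uE) * (tn uF 1 + tn uKi uF) - (tn uF 1 + tn uKi uF) * (tn uE uK + tn 1 uE)
      = ?d *\<^sub>q tn uK uK - ?d *\<^sub>q tn uKi uKi"
    by (simp add: distrib_left distrib_right EF c tn_add_left tn_add_right tn_diff algebra_simps)
  moreover have "tn uK uK * (tn uE uK + tn 1 uE) * tn uKi uKi = (qq powi 2) *\<^sub>q (tn uE uK + tn 1 uE)"
    "tn uK uK * (tn uF 1 + tn uKi uF) * tn uKi uKi = (qq powi (- 2)) *\<^sub>q (tn uF 1 + tn uKi uF)"
    by (simp_all add: distrib_left distrib_right mult.assoc uK_uE_uKi uK_uF_uKi scal_add_right)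
  moreover have "tn uK uK * tn uKi uKi = 1" "tn uKi uKi * tn uK uK = 1" by (simp_all add: tn_one[symmetric])
  moreover have "ug GK \<otimes>\<^bsub>Uq\<^esub> ug GKi = \<one>\<^bsub>Uq\<^esub>" "ug GKi \<otimes>\<^bsub>Uq\<^esub> ug GK = \<one>\<^bsub>Uq\<^esub>"
    using ug_relations by (simp_all add: uq_relations_def)
  ultimately show ?thesis
    unfolding uq_relations_def
    by (simp add: rep_t_simps rep_t_tn rep_u_simps rep_u_gens image_subset_iff ug_closed tens_closed Uq_is_algebra
        UqUq.m_assoc tens_mult split: gen.split flip: rep_t_inject)
qed

lemma antipode_relations:
  "uq_relations (opposite_alg Uq) (\<lambda>g. case g of
       GE \<Rightarrow> \<ominus>\<^bsub>Uq\<^esub> (ug GE \<otimes>\<^bsub>Uq\<^esub> ug GKi)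
     | GF \<Rightarrow> \<ominus>\<^bsub>Uq\<^esub> (ug GK \<otimes>\<^bsub>Uq\<^esub> ug GF)
     | GK \<Rightarrow> ug GKi
     | GKi \<Rightarrow> ug GK)"
proof -
  let ?d = "1 / (qq - inverse qq)"
  have EF: "uE * uF = uF * uE + ?d *\<^sub>q uK - ?d *\<^sub>q uKi"
    using uE_uF_comm by (simp add: algebra_simps)
  have op: "carrier (opposite_alg Uq) = carrier Uq" "x \<otimes>\<^bsub>opposite_alg Uq\<^esub> y = y \<otimes>\<^bsub>Uq\<^esub> x"
    "\<one>\<^bsub>opposite_alg Uq\<^esub> = \<one>\<^bsub>Uq\<^esub>" "a \<odot>\<^bsub>opposite_alg Uq\<^esub> x = a \<odot>\<^bsub>Uq\<^esub> x"
    "x \<ominus>\<^bsub>opposite_alg Uq\<^esub> y = x \<ominus>\<^bsub>Uq\<^esub> y" for x y a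
    by (simp_all add: opposite_alg_def a_minus_def a_inv_def)
  \<comment> \<open>The products appear in reverse order since the target is the opposite algebra,
    and the last right-hand side has K^-1 before K because the antipode exchanges them.\<close>
  have "(uK * - (uE * uKi)) * uKi = (qq powi 2) *\<^sub>q - (uE * uKi)"
    "(uK * - (uK * uF)) * uKi = (qq powi (- 2)) *\<^sub>q - (uK * uF)"
    "- (uK * uF) * - (uE * uKi) - - (uE * uKi) * - (uK * uF) = ?d *\<^sub>q uKi - ?d *\<^sub>q uK"
    by (simp_all add: mult.assoc K_right_simps scal_minus_right EF)
  moreover have "ug GK \<otimes>\<^bsub>Uq\<^esub> ug GKi = \<one>\<^bsub>Uq\<^esub>" "ug GKi \<otimes>\<^bsub>Uq\<^esub> ug GK = \<one>\<^bsub>Uq\<^esub>"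
    using ug_relations by (simp_all add: uq_relations_def)
  ultimately show ?thesis
    unfolding uq_relations_def op
    by (simp add: rep_u_simps rep_u_gens image_subset_iff ug_closed Uq.l_minus Uq.r_minus split: gen.split flip: rep_u_inject)
qed

definition \<Delta> :: "uqt \<Rightarrow> tqt" where
  "\<Delta> u = abs_t (uq_comult (rep_u u))"

definition \<S> :: "uqt \<Rightarrow> uqt" where
  "\<S> u = abs_u (uq_antipode (rep_u u))"

lemma comult_hom: "alg_hom Uq (tensor Uq Uq) uq_comult"
  unfolding uq_comult_def by (rule uq_hom_alg_hom[OF UqUq.algebra_over_axioms comult_relations])

lemma antipode_hom: "alg_hom Uq (opposite_alg Uq) uq_antipode"
  unfolding uq_antipode_def
  by (rule uq_hom_alg_hom[OF opposite_alg_is_algebra[OF Uq_is_algebra] antipode_relations])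

lemma rep_t_Delta: "rep_t (\<Delta> u) = uq_comult (rep_u u)"
  by (simp add: \<Delta>_def abs_t_inverse alg_homD(1)[OF comult_hom])

lemma rep_u_antipode: "rep_u (\<S> u) = uq_antipode (rep_u u)"
  using alg_homD(1)[OF antipode_hom, of "rep_u u"] by (simp add: \<S>_def abs_u_inverse opposite_alg_def)

lemma Delta_mult: "\<Delta> (u * v) = \<Delta> u * \<Delta> v" and Delta_one: "\<Delta> 1 = 1"
  and Delta_add: "\<Delta> (u + v) = \<Delta> u + \<Delta> v" and Delta_scal: "\<Delta> (a *\<^sub>q u) = a *\<^sub>q \<Delta> u"
  by (simp_all add: rep_t_simps rep_t_Delta rep_u_simps alg_homD[OF comult_hom] flip: rep_t_inject)

lemma antipode_mult: "\<S> (u * v) = \<S> v * \<S> u" and antipode_one: "\<S> 1 = 1"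
  and antipode_add: "\<S> (u + v) = \<S> u + \<S> v" and antipode_scal: "\<S> (a *\<^sub>q u) = a *\<^sub>q \<S> u"
  using alg_homD(2-)[OF antipode_hom]
  by (simp_all add: rep_u_simps rep_u_antipode opposite_alg_def flip: rep_u_inject)

lemma Delta_diff: "\<Delta> (u - v) = \<Delta> u - \<Delta> v"
  using Delta_add[of "u - v" v] by simp

lemma antipode_diff: "\<S> (u - v) = \<S> u - \<S> v"
  using antipode_add[of "u - v" v] by simp

lemma Delta_gens: "\<Delta> uE = tn uE uK + tn 1 uE" "\<Delta> uF = tn uF 1 + tn uKi uF" "\<Delta> uK = tn uK uK" "\<Delta> uKi = tn uKi uKi"
  by (simp_all add: rep_t_simps rep_t_Delta rep_u_simps rep_t_tn rep_u_gens uq_comult_def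
    uq_hom_ug[OF UqUq.algebra_over_axioms comult_relations] flip: rep_t_inject)

lemma antipode_K: "\<S> uK = uKi" "\<S> uKi = uK"
  by (simp_all add: rep_u_antipode rep_u_gens uq_antipode_def
    uq_hom_ug[OF opposite_alg_is_algebra[OF Uq_is_algebra] antipode_relations] flip: rep_u_inject)


subsection \<open>The elements \<open>[K; c choose t]\<close>\<close>

text \<open>This is the element [K; c], acting on a vector of weight N by the quantum integer
  [N + c]. Relations between brackets are thus operator forms of relations between quantum
  integers.\<close>

definition br :: "int \<Rightarrow> uqt" where
  "br c = (1 / (qq - inverse qq)) *\<^sub>q ((qq powi c) *\<^sub>q uK - (qq powi (- c)) *\<^sub>q uKi)"

lemma br_alt: "br c = (1 / (qq - inverse qq) * qq powi c) *\<^sub>q uK - (1 / (qq - inverse qq) * qq powi (- c)) *\<^sub>q uKi"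
  by (simp add: br_def scal_diff_right)

primrec kbin :: "int \<Rightarrow> nat \<Rightarrow> uqt" where
  "kbin c 0 = 1"
| "kbin c (Suc t) = (1 / qn (int t + 1)) *\<^sub>q (br (c - int t) * kbin c t)"

lemma br_comm: "br c * br d = br d * br c" "uK * br c = br c * uK" "uKi * br c = br c * uKi"
  by (simp_all add: br_def scal_distribs left_diff_distrib right_diff_distrib algebra_simps)

lemma kbin_comm_gen:
  assumes "\<And>c. x * br c = br c * x"
  shows "x * kbin c t = kbin c t * x"
proof (induction t)
  case (Suc t)
  have "x * (br (c - int t) * kbin c t) = br (c - int t) * (x * kbin c t)"
    by (simp add: assms flip: mult.assoc)
  then show ?case using Suc by (simp add: mult.assoc)
qed simp

lemmas kbin_comm = kbin_comm_gen[of "br _", OF br_comm(1)] kbin_comm_gen[of uK, OF br_comm(2)] kbin_comm_gen[of uKi, OF br_comm(3)]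

lemma uE_br: "uE * br c = br (c - 2) * uE" and br_uF: "br c * uF = uF * br (c - 2)"
proof -
  have p: "qq powi (c - 2) = qq powi c * qq powi (- 2)" "qq powi (2 - c) = qq powi (- c) * qq\<^sup>2"
    by (simp_all add: power_int_diff power_int_minus divide_simps power_int_add)
  show "uE * br c = br (c - 2) * uE" "br c * uF = uF * br (c - 2)"
    by (simp_all add: br_def scal_distribs left_diff_distrib right_diff_distrib uE_uK uE_uKi uF_uK uF_uKi p algebra_simps)
qed

lemma uE_kbin: "uE * kbin c t = kbin (c - 2) t * uE"
proof (induction t)
  case (Suc t)
  have "uE * (br (c - int t) * kbin c t) = br (c - 2 - int t) * (uE * kbin c t)"
    by (simp add: uE_br algebra_simps flip: mult.assoc)
  then show ?case using Suc by (simp add: mult.assoc)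
qed simp

text \<open>All brackets lie in the span of K and K^-1, so a relation between three of them follows
  from the two equations between coefficients.\<close>

lemma br_lin:
  assumes "x * qq powi c + y * qq powi d = z * qq powi e" "x * qq powi (- c) + y * qq powi (- d) = z * qq powi (- e)"
  shows "x *\<^sub>q br c + y *\<^sub>q br d = z *\<^sub>q br e"
proof -
  let ?D = "1 / (qq - inverse qq)"
  have "x *\<^sub>q br c + y *\<^sub>q br d = ?D *\<^sub>q ((x * qq powi c + y * qq powi d) *\<^sub>q uK - (x * qq powi (- c) + y * qq powi (- d)) *\<^sub>q uKi)"
    by (simp add: br_def scal_distribs algebra_simps)
  also have "\<dots> = z *\<^sub>q br e" unfolding assms by (simp add: br_def scal_distribs algebra_simps)
  finally show ?thesis .
qed

text \<open>The operator form of [a][c - b] + [b][c + a] = [a + b][c]. It merges brackets both when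
  E passes a power of F and in the induction for divided powers.\<close>

lemma br_lin':
  "qn a *\<^sub>q br (c - b) + qn b *\<^sub>q br (c + a) = qn (a + b) *\<^sub>q br c"
proof (rule br_lin)
  have *: "qn (a + b) = qq powi a * qn b + qq powi (- b) * qn a" using qn_add[of b a] by (simp add: add.commute)
  show "qn a * qq powi (c - b) + qn b * qq powi (c + a) = qn (a + b) * qq powi c"
    unfolding * by (simp add: power_int_add power_int_diff power_int_minus field_simps)
  show "qn a * qq powi (- (c - b)) + qn b * qq powi (- (c + a)) = qn (a + b) * qq powi (- c)"
    unfolding qn_add by (simp add: power_int_add power_int_diff power_int_minus field_simps)
qed

text \<open>The definition splits off the bracket with the lowest argument. Here the one with the
  highest is split off, which leaves a binomial with \<open>c\<close> lowered by one.\<close>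

lemma kbin_Suc_shift: "kbin (c + 1) (Suc t) = (1 / qn (int t + 1)) *\<^sub>q (br (c + 1) * kbin c t)"
proof (induction t)
  case (Suc t)
  have "kbin (c + 1) (Suc (Suc t)) = (1 / qn (int t + 2)) *\<^sub>q (br (c - int t) * kbin (c + 1) (Suc t))"
    by (simp add: add.commute)
  also have "\<dots> = (1 / qn (int t + 2)) *\<^sub>q (1 / qn (int t + 1)) *\<^sub>q (br (c - int t) * (br (c + 1) * kbin c t))"
    unfolding Suc by simp
  also have "br (c - int t) * (br (c + 1) * kbin c t) = br (c + 1) * (br (c - int t) * kbin c t)"
    by (simp add: br_comm(1)[of "c - int t"] flip: mult.assoc)
  finally show ?case by (simp add: mult.commute add.commute)
qed simp

text \<open>Changes \<open>c\<close> by one at the cost of a term with smaller \<open>t\<close>,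
  with powers of q as coefficients. Since these are units, the rule can also be solved for
  \<open>kbin c (Suc t)\<close>, so integrality propagates in both directions.\<close>

lemma kbin_pascal:
  "kbin (c + 1) (Suc t) = (qq powi (int t + 1)) *\<^sub>q kbin c (Suc t) + (qq powi (int t - c)) *\<^sub>q (uKi * kbin c t)"
proof -
  let ?n = "qn (int t + 1)"
  have n: "?n \<noteq> 0" by (rule qn_neq_zero) simp
  \<comment> \<open>The bracket is split so that its first part is the factor missing from
    \<open>kbin c (Suc t)\<close>; the remainder is then a multiple of K^-1 alone, and its factor
    \<open>?n\<close> cancels the denominator.\<close>
  have b: "br (c + 1) = (qq powi (int t + 1)) *\<^sub>q br (c - int t) + (?n * qq powi (int t - c)) *\<^sub>q uKi"
  proof -
    let ?D = "1 / (qq - inverse qq)"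
    have e1: "qq powi (int t + 1) * (?D * qq powi (c - int t)) = ?D * qq powi (c + 1)"
      by (simp add: power_int_add power_int_diff)
    have e2: "?n * qq powi (int t - c) = qq powi (int t + 1) * (?D * qq powi (- (c - int t))) - ?D * qq powi (- (c + 1))"
    proof -
      have "(qq powi (int t + 1) - qq powi (- (int t + 1))) * d * qq powi (int t - c) =
          qq powi (int t + 1) * (d * qq powi (- (c - int t))) - d * qq powi (- (c + 1))" for d
        by (simp add: power_int_add power_int_diff power_int_minus field_simps)
      from this[of ?D] show ?thesis by (simp only: qn_def times_divide_eq_right mult_1_right)
    qed
    show ?thesis unfolding e2 br_alt scal_diff_right scal_diff_left scal_scal e1 by simp
  qed
  have "kbin (c + 1) (Suc t) = (qq powi (int t + 1) / ?n) *\<^sub>q (br (c - int t) * kbin c t) + (?n * qq powi (int t - c) / ?n) *\<^sub>q (uKi * kbin c t)"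
    unfolding kbin_Suc_shift b by (simp add: distrib_right scal_distribs mult.commute)
  then show ?thesis using n by simp
qed

subsection \<open>Divided powers\<close>

text \<open>Integer indices with value 0 below zero let the commutation formula be summed over all t
  \<le> r, whether or not t exceeds s.\<close>

definition Fd :: "int \<Rightarrow> uqt" where
  "Fd s = (if s < 0 then 0 else (1 / qfact (nat s)) *\<^sub>q uF ^ nat s)"

definition Ed :: "nat \<Rightarrow> uqt" where
  "Ed r = (1 / qfact r) *\<^sub>q uE ^ r"

lemma qfact_simps [simp]: "qfact 0 = 1" "qfact (Suc t) = qn (int t + 1) * qfact t"
proof -
  show "qfact 0 = 1" by (simp add: qfact_def)
  have "int (Suc t) = int t + 1" by simp
  then show "qfact (Suc t) = qn (int t + 1) * qfact t"
    by (simp only: qfact_def qn_def prod.cl_ivl_Suc mult.commute) simp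
qed

lemma qfact_neq_zero [simp]: "qfact t \<noteq> 0"
  by (induction t) (simp_all add: qn_neq_zero)

lemma uE_Ed: "uE * Ed r = qn (int r + 1) *\<^sub>q Ed (Suc r)"
  using qn_neq_zero[of "int r + 1"] by (simp add: Ed_def)

lemma uE_uF_power: "uE * uF ^ Suc n = uF ^ Suc n * uE + qn (int n + 1) *\<^sub>q (uF ^ n * br (- int n))"
proof (induction n)
  case 0
  show ?case using uE_uF_comm by (simp add: br_def scal_diff_right algebra_simps)
next
  case (Suc n)
  have EF: "uE * uF = uF * uE + br 0"
    using uE_uF_comm by (simp add: br_def scal_diff_right algebra_simps)
  have "uE * uF ^ Suc (Suc n) = (uE * uF ^ Suc n) * uF"
    by (simp only: power_Suc2 mult.assoc)
  also have "\<dots> = uF ^ Suc n * (uE * uF) + qn (int n + 1) *\<^sub>q (uF ^ n * (br (- int n) * uF))"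
    unfolding Suc by (simp add: distrib_right mult.assoc)
  also have "\<dots> = uF ^ Suc (Suc n) * uE + uF ^ Suc n * (1 *\<^sub>q br 0 + qn (int n + 1) *\<^sub>q br (- int n - 2))"
    unfolding EF br_uF by (simp add: distrib_left power_Suc2 mult.assoc del: power_Suc)
  also have "1 *\<^sub>q br 0 + qn (int n + 1) *\<^sub>q br (- int n - 2) = qn (int n + 2) *\<^sub>q br (- int n - 1)"
    using br_lin'[of "int n + 1" "- int n - 1" 1] by (simp add: add.commute algebra_simps)
  finally have *: "uE * uF ^ Suc (Suc n) = uF ^ Suc (Suc n) * uE + uF ^ Suc n * (qn (int n + 2) *\<^sub>q br (- int n - 1))" .
  have e: "- int (Suc n) = - int n - 1" "int (Suc n) + 1 = int n + 2" by simp_all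
  show ?case unfolding * e by simp
qed

lemma uE_Fd: "uE * Fd s = Fd s * uE + Fd (s - 1) * br (1 - s)"
proof (cases "s \<le> 0")
  case True
  then show ?thesis by (auto simp: Fd_def)
next
  case False
  define n where "n = nat (s - 1)"
  have s: "s = int n + 1" "nat s = Suc n" using False by (simp_all add: n_def)
  have "uE * Fd s = (1 / qfact (Suc n)) *\<^sub>q (uE * uF ^ Suc n)" by (simp add: Fd_def s nat_add_distrib)
  also have "\<dots> = Fd s * uE + (1 / qfact (Suc n) * qn (int n + 1)) *\<^sub>q (uF ^ n * br (- int n))"
    unfolding uE_uF_power by (simp add: Fd_def s scal_add_right nat_add_distrib)
  also have "(1 / qfact (Suc n) * qn (int n + 1)) *\<^sub>q (uF ^ n * br (- int n)) = Fd (s - 1) * br (1 - s)"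
    using qn_neq_zero[of "int n + 1"] by (simp add: Fd_def s)
  finally show ?thesis .
qed

text \<open>With a = r - t this combines the two kinds of terms that reach the same summand in the
  induction for \<open>Ed_Fd\<close>.\<close>

lemma kbin_step: "qn a *\<^sub>q kbin c (Suc t) + br (c + a + 1) * kbin c t = qn (a + int t + 1) *\<^sub>q kbin (c + 1) (Suc t)"
proof -
  have n: "qn (int t + 1) \<noteq> 0" by (rule qn_neq_zero) simp
  have "qn (int t + 1) *\<^sub>q (qn a *\<^sub>q kbin c (Suc t) + br (c + a + 1) * kbin c t)
     = (qn a *\<^sub>q br (c - int t) + qn (int t + 1) *\<^sub>q br (c + a + 1)) * kbin c t"
    using n by (simp add: scal_distribs distrib_right mult.commute)
  also have "qn a *\<^sub>q br (c - int t) + qn (int t + 1) *\<^sub>q br (c + a + 1) = qn (a + int t + 1) *\<^sub>q br (c + 1)"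
    using br_lin'[of a "c + 1" "int t + 1"] by (simp add: algebra_simps)
  also have "(qn (a + int t + 1) *\<^sub>q br (c + 1)) * kbin c t = qn (int t + 1) *\<^sub>q (qn (a + int t + 1) *\<^sub>q kbin (c + 1) (Suc t))"
    unfolding kbin_Suc_shift using n by (simp add: mult.commute)
  finally show ?thesis using n scal_cancel by blast
qed

text \<open>For r = s the summand t = r is \<open>kbin 0 r\<close> itself, with trivial outer
  factors. This is what exhibits the binomials in K inside an algebra generated by K, its inverse
  and divided powers.\<close>

lemma Ed_Fd: "Ed r * Fd s = (\<Sum>t\<le>r. Fd (s - int t) * kbin (2 * int t - int r - s) t * Ed (r - t))"
proof (induction r)
  case 0
  then show ?case by (simp add: Ed_def)
next
  case (Suc r)
  \<comment> \<open>Multiplying the summand t on the left by E gives two contributions: in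
    \<open>X t\<close> the factor E has passed through to the right, in \<open>Y t\<close> it was
    consumed in a commutator with the divided power of F. \<open>X (Suc t)\<close> and
    \<open>Y t\<close> have the same outer factors and together make up
    \<open>Z (Suc t)\<close>.\<close>
  define X where "X t = qn (int r + 1 - int t) *\<^sub>q (Fd (s - int t) * kbin (2 * int t - int r - s - 2) t * Ed (Suc r - t))" for t
  define Y where "Y t = Fd (s - int t - 1) * br (1 - s + int t) * kbin (2 * int t - int r - s) t * Ed (r - t)" for t
  define Z where "Z t = Fd (s - int t) * kbin (2 * int t - int (Suc r) - s) t * Ed (Suc r - t)" for t
  have n: "qn (int r + 1) \<noteq> 0" by (rule qn_neq_zero) simp
  have XY: "uE * (Fd (s - int t) * kbin (2 * int t - int r - s) t * Ed (r - t)) = X t + Y t" if "t \<le> r" for t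
  proof -
    have E: "uE * Ed (r - t) = qn (int r + 1 - int t) *\<^sub>q Ed (Suc r - t)"
      using uE_Ed[of "r - t"] that by (simp add: Suc_diff_le of_nat_diff algebra_simps)
    have "uE * (Fd (s - int t) * kbin (2 * int t - int r - s) t * Ed (r - t)) =
        (uE * Fd (s - int t)) * kbin (2 * int t - int r - s) t * Ed (r - t)"
      by (simp only: mult.assoc)
    also have "\<dots> = Fd (s - int t) * ((uE * kbin (2 * int t - int r - s) t) * Ed (r - t)) +
        Fd (s - int t - 1) * br (1 - (s - int t)) * kbin (2 * int t - int r - s) t * Ed (r - t)"
      unfolding uE_Fd by (simp only: distrib_right mult.assoc)
    also have "\<dots> = X t + Y t"
      unfolding uE_kbin X_def Y_def by (simp add: mult.assoc E algebra_simps)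
    finally show ?thesis .
  qed
  have X0: "X 0 = qn (int r + 1) *\<^sub>q Z 0" by (simp add: X_def Z_def)
  \<comment> \<open>The coefficient is [0], which lets the sum of the \<open>X t\<close> run up to
    \<open>Suc r\<close> before it is shifted.\<close>
  have XS: "X (Suc r) = 0" by (simp add: X_def)
  have ZS: "X (Suc t) + Y t = qn (int r + 1) *\<^sub>q Z (Suc t)" for t
  proof -
    let ?c = "2 * int t - int r - s"
    have "X (Suc t) + Y t = Fd (s - int t - 1) * (qn (int r - int t) *\<^sub>q kbin ?c (Suc t) + br (1 - s + int t) * kbin ?c t) * Ed (r - t)"
      by (simp add: X_def Y_def algebra_simps del: kbin.simps)
    also have "qn (int r - int t) *\<^sub>q kbin ?c (Suc t) + br (1 - s + int t) * kbin ?c t = qn (int r + 1) *\<^sub>q kbin (?c + 1) (Suc t)"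
      using kbin_step[of "int r - int t" ?c t] by (simp add: algebra_simps del: kbin.simps)
    also have "Fd (s - int t - 1) * (qn (int r + 1) *\<^sub>q kbin (?c + 1) (Suc t)) * Ed (r - t) = qn (int r + 1) *\<^sub>q Z (Suc t)"
      by (simp add: Z_def algebra_simps del: kbin.simps)
    finally show ?thesis .
  qed
  have "qn (int r + 1) *\<^sub>q (Ed (Suc r) * Fd s) = uE * (Ed r * Fd s)"
    by (simp add: uE_Ed flip: mult.assoc)
  also have "\<dots> = (\<Sum>t\<le>r. X t + Y t)"
    unfolding Suc sum_distrib_left by (intro sum.cong refl) (simp add: XY)
  also have "\<dots> = (\<Sum>t\<le>Suc r. X t) + (\<Sum>t\<le>r. Y t)" by (simp add: sum.distrib XS)
  also have "\<dots> = X 0 + (\<Sum>t\<le>r. X (Suc t) + Y t)" unfolding sum.atMost_Suc_shift by (simp add: sum.distrib add.assoc)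
  also have "\<dots> = qn (int r + 1) *\<^sub>q (\<Sum>t\<le>Suc r. Z t)"
    unfolding sum.atMost_Suc_shift ZS X0 by (simp add: scal_sum_right scal_add_right)
  finally have "Ed (Suc r) * Fd s = (\<Sum>t\<le>Suc r. Z t)" using n scal_cancel by blast
  then show ?case by (simp add: Z_def)
qed

subsection \<open>Comultiplication and antipode of \<open>[K; 0 choose l]\<close>\<close>

text \<open>The comultiplication of [K; -l] is split as a combination of [K; -t] \<otimes> K and
  K^-1 \<otimes> [K; t - l], where the terms K^-1 \<otimes> K cancel. The parameter t is free, so it
  can be adapted to each summand of \<open>Delta_kbin\<close>.\<close>

lemma Delta_br_tn:
  "\<Delta> (br (- int l)) * tn x y = (qq powi (int t - int l)) *\<^sub>q tn (br (- int t) * x) (uK * y) + (qq powi (int t)) *\<^sub>q tn (uKi * x) (br (int t - int l) * y)"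
proof -
  let ?D = "1 / (qq - inverse qq)"
  have e: "qq powi (int t - int l) * (d * qq powi (- int t)) = d * qq powi (- int l)"
    "qq powi (int t - int l) * (d * qq powi (- (- int t))) = qq powi (int t) * (d * qq powi (int t - int l))"
    "qq powi (int t) * (d * qq powi (- (int t - int l))) = d * qq powi (- (- int l))" for d
    by (simp_all add: power_int_diff power_int_minus field_simps)
  have "\<Delta> (br c) * tn x y = (?D * qq powi c) *\<^sub>q tn (uK * x) (uK * y) - (?D * qq powi (- c)) *\<^sub>q tn (uKi * x) (uKi * y)" for c
    unfolding br_alt by (simp only: Delta_scal Delta_diff Delta_gens left_diff_distrib scal_mult_left tn_mult)
  then show ?thesis
    unfolding br_alt
    by (simp only: left_diff_distrib scal_mult_left tn_diff tn_scal_left tn_scal_right scal_diff_right scal_scal e) simp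
qed

lemma Delta_kbin:
  "\<Delta> (kbin 0 l) = (\<Sum>t\<le>l. tn (kbin 0 t * uKi ^ (l - t)) (kbin 0 (l - t) * uK ^ t))"
proof (induction l)
  case 0
  then show ?case by (simp add: Delta_one tn_one)
next
  case (Suc l)
  define T where "T t = tn (kbin 0 t * uKi ^ (Suc l - t)) (kbin 0 (Suc l - t) * uK ^ t)" for t
  define X where "X t = (qq powi (int t - int l - 1) * qn (int t)) *\<^sub>q T t" for t
  define Y where "Y t = (qq powi (int t) * qn (int l + 1 - int t)) *\<^sub>q T t" for t
  have n: "qn (int l + 1) \<noteq> 0" by (rule qn_neq_zero) simp
  have kb: "br (- int t) * kbin 0 t = qn (int t + 1) *\<^sub>q kbin 0 (Suc t)" for t
    using qn_neq_zero[of "int t + 1"] by simp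
  have step: "\<Delta> (br (- int l)) * tn (kbin 0 t * uKi ^ (l - t)) (kbin 0 (l - t) * uK ^ t) = X (Suc t) + Y t"
    if t: "t \<le> l" for t
  proof -
    have "br (- int t) * (kbin 0 t * uKi ^ (l - t)) = qn (int t + 1) *\<^sub>q (kbin 0 (Suc t) * uKi ^ (l - t))"
      using kb[of t] by (simp del: kbin.simps flip: mult.assoc)
    moreover have "br (int t - int l) * (kbin 0 (l - t) * uK ^ t) = qn (int l + 1 - int t) *\<^sub>q (kbin 0 (Suc l - t) * uK ^ t)"
      using kb[of "l - t"] t by (simp add: of_nat_diff Suc_diff_le algebra_simps del: kbin.simps flip: mult.assoc)
    moreover have "uK * (kbin 0 (l - t) * uK ^ t) = kbin 0 (l - t) * uK ^ Suc t"
      by (simp add: kbin_comm flip: mult.assoc)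
    moreover have "uKi * (kbin 0 t * uKi ^ (l - t)) = kbin 0 t * uKi ^ (Suc l - t)"
      using t by (simp add: kbin_comm Suc_diff_le flip: mult.assoc)
    ultimately show ?thesis
      unfolding Delta_br_tn[of l _ _ t] X_def Y_def T_def
      by (simp add: algebra_simps del: kbin.simps power_Suc)
  qed
  \<comment> \<open>The two ways of reaching \<open>T t\<close> add up by q^(t-l-1) [t] + q^t
    [l+1-t] = [l+1].\<close>
  have XY: "X t + Y t = qn (int l + 1) *\<^sub>q T t" for t
    using qn_add[of "int l + 1 - int t" "int t"] by (simp add: X_def Y_def algebra_simps flip: scal_add_left)
  have "qn (int l + 1) *\<^sub>q \<Delta> (kbin 0 (Suc l)) = \<Delta> (br (- int l)) * \<Delta> (kbin 0 l)"
    using n by (simp add: Delta_scal Delta_mult)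
  also have "\<dots> = (\<Sum>t\<le>l. X (Suc t) + Y t)"
    unfolding Suc sum_distrib_left by (intro sum.cong refl step) simp
  \<comment> \<open>Both ranges may be completed because \<open>X 0\<close> and
    \<open>Y (Suc l)\<close> carry the factor [0].\<close>
  also have "\<dots> = (\<Sum>t\<le>Suc l. X t) + (\<Sum>t\<le>Suc l. Y t)"
    unfolding sum.atMost_Suc_shift[of X] by (simp add: sum.distrib X_def Y_def)
  also have "\<dots> = qn (int l + 1) *\<^sub>q (\<Sum>t\<le>Suc l. T t)"
    by (simp only: XY scal_sum_right flip: sum.distrib)
  finally have "\<Delta> (kbin 0 (Suc l)) = (\<Sum>t\<le>Suc l. T t)" using n scal_cancel by blast
  then show ?case by (simp add: T_def)
qed

text \<open>The antipode sends [K; c] to -[K; -c], so the factors [K; 0], ..., [K; 1-l] become, up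
  to sign, the factors [K; 0], ..., [K; l-1] of \<open>kbin (int l - 1) l\<close>.\<close>

lemma antipode_kbin: "\<S> (kbin 0 l) = ((- 1) ^ l) *\<^sub>q kbin (int l - 1) l"
proof (induction l)
  case (Suc l)
  have "\<S> (br c) = - br (- c)" for c
    by (simp add: br_def antipode_scal antipode_diff antipode_K scal_distribs)
  then have "\<S> (kbin 0 (Suc l)) = (1 / qn (int l + 1) * (- 1) ^ l) *\<^sub>q (kbin (int l - 1) l * - br (int l))"
    by (simp add: antipode_scal antipode_mult Suc scal_minus_right)
  also have "kbin (int l - 1) l * - br (int l) = - (br (int l) * kbin (int l - 1) l)"
    by (simp add: kbin_comm)
  finally show ?case using kbin_Suc_shift[of "int l - 1" l] by (simp add: scal_distribs del: kbin.simps(2))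
qed (simp add: antipode_one)


section \<open>Integrality\<close>

subsection \<open>Laurent polynomials\<close>

lemma laurent_eval_superset:
  "finite A \<Longrightarrow> Poly_Mapping.keys a \<subseteq> A \<Longrightarrow> laurent_eval x a = (\<Sum>n\<in>A. of_int (Poly_Mapping.lookup a n) * x powi n)"
  unfolding laurent_eval_def by (rule sum.mono_neutral_left) (auto simp: in_keys_iff)

lemma laurent_eval_add: "laurent_eval x (a + b) = laurent_eval x a + laurent_eval x b"
proof -
  let ?A = "Poly_Mapping.keys a \<union> Poly_Mapping.keys b"
  have "laurent_eval x c = (\<Sum>n\<in>?A. of_int (Poly_Mapping.lookup c n) * x powi n)" if "c \<in> {a, b, a + b}" for c
    using that keys_add_subsetI[of a ?A b] by (intro laurent_eval_superset) auto
  then show ?thesis by (simp add: lookup_add distrib_right sum.distrib)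
qed

lemma laurent_eval_single [simp]: "laurent_eval x (sg n c) = of_int c * x powi n"
  by (subst laurent_eval_superset[of "{n}"]) auto

lemma laurent_eval_zero [simp]: "laurent_eval x 0 = 0"
  by (simp add: laurent_eval_def)

lemma laurent_eval_one [simp]: "laurent_eval x 1 = 1"
  using laurent_eval_single[of x 0 1] by simp

lemma laurent_eval_mult:
  assumes "x \<noteq> 0"
  shows "laurent_eval x (a * b) = laurent_eval x a * laurent_eval x b"
  using subset_UNIV[of "Poly_Mapping.keys a"]
proof (induction rule: poly_mapping_span_induct)
  case (single n c)
  show ?case using subset_UNIV[of "Poly_Mapping.keys b"]
  proof (induction rule: poly_mapping_span_induct)
    case (single m d)
    then show ?case using assms by (simp add: mult_single power_int_add)
  qed (simp_all add: laurent_eval_add distrib_left)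
qed (simp_all add: laurent_eval_add distrib_right)

lemma Fract_sum: "(\<Sum>x\<in>A. Fract (f x) 1) = Fract (\<Sum>x\<in>A. f x) (1 :: rat poly)"
  by (induction A rule: infinite_finite_induct) (simp_all add: Zero_fract_def)

lemma Fract_of_int: "(of_int c :: ratfun) = Fract (of_int c) 1"
proof (induction c rule: int_induct[of _ 0])
  case base show ?case by (simp add: Zero_fract_def)
next
  case (step1 i) then show ?case by (simp add: One_fract_def)
next
  case (step2 i) then show ?case by (simp add: One_fract_def)
qed

text \<open>After multiplication by a power of q that clears negative exponents, the value is an
  honest polynomial whose coefficients are those of \<open>a\<close>.\<close>

lemma laurent_eval_qq_inj:
  assumes "laurent_eval qq a = 0"
  shows "a = 0"
proof (rule ccontr)
  assume "a \<noteq> 0"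
  then obtain n where n: "n \<in> Poly_Mapping.keys a" using keys_eq_empty by blast
  let ?A = "Poly_Mapping.keys a" and ?c = "Poly_Mapping.lookup a"
  define M where "M = - Min ?A"
  have M: "k + M \<ge> 0" if "k \<in> ?A" for k using that by (simp add: M_def)
  let ?P = "\<Sum>k\<in>?A. monom (of_int (?c k) :: rat) (nat (k + M))"
  have "0 = laurent_eval qq a * qq powi M" using assms by simp
  also have "\<dots> = (\<Sum>k\<in>?A. of_int (?c k) * qq ^ nat (k + M))"
    unfolding laurent_eval_def sum_distrib_right
  proof (rule sum.cong)
    fix k assume "k \<in> ?A"
    then have "qq powi k * qq powi M = qq ^ nat (k + M)"
      using M[of k] power_int_add[of qq k M] by (simp add: power_int_def[of qq "k + M"])
    then show "of_int (?c k) * qq powi k * qq powi M = of_int (?c k) * qq ^ nat (k + M)"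
      by (simp add: mult.assoc)
  qed simp
  also have "\<dots> = Fract ?P 1"
    unfolding Fract_sum[symmetric]
    by (rule sum.cong) (simp_all add: Fract_of_int qq_pow of_int_poly smult_monom)
  finally have "?P = 0" by (simp add: Zero_fract_def eq_fract)
  then have "coeff ?P (nat (n + M)) = 0" by simp
  moreover have "coeff ?P (nat (n + M)) = (\<Sum>k\<in>?A. if k = n then of_int (?c k) else 0)"
    unfolding coeff_sum using M n by (intro sum.cong refl) (auto simp: nat_eq_iff)
  ultimately have "?c n = 0" using n by simp
  with n show False by (simp add: in_keys_iff)
qed

definition Lau :: "ratfun set" where
  "Lau = range (laurent_eval qq)"

text \<open>Specialization q = \<zeta> of an element of \<open>Lau\<close>, legitimate because
  \<open>laurent_eval qq\<close> is injective. Outside \<open>Lau\<close> the value is unspecified,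
  so additivity and multiplicativity carry membership hypotheses.\<close>

definition ev :: "'k::field \<Rightarrow> ratfun \<Rightarrow> 'k" where
  "ev \<zeta> u = laurent_eval \<zeta> (inv_into UNIV (laurent_eval qq) u)"

lemma inj_laurent_eval: "inj (laurent_eval qq)"
proof (rule injI)
  fix a b assume e: "laurent_eval qq a = laurent_eval qq b"
  have "laurent_eval qq a = laurent_eval qq (a - b) + laurent_eval qq b"
    by (simp flip: laurent_eval_add)
  then have "a - b = 0" using e by (intro laurent_eval_qq_inj) simp
  then show "a = b" by simp
qed

lemma ev_laurent_eval [simp]: "ev \<zeta> (laurent_eval qq a) = laurent_eval \<zeta> a"
  by (simp add: ev_def inj_laurent_eval)

lemma Lau_add [intro]: "u \<in> Lau \<Longrightarrow> v \<in> Lau \<Longrightarrow> u + v \<in> Lau"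
  and Lau_mult [intro]: "u \<in> Lau \<Longrightarrow> v \<in> Lau \<Longrightarrow> u * v \<in> Lau"
  unfolding Lau_def by (auto simp flip: laurent_eval_add laurent_eval_mult)

lemma Lau_powi [simp, intro]: "qq powi n \<in> Lau" and ev_powi [simp]: "ev \<zeta> (qq powi n) = \<zeta> powi n"
  using laurent_eval_single[of qq n 1] ev_laurent_eval[of \<zeta> "sg n 1"] unfolding Lau_def
  by (auto intro: range_eqI[of _ _ "sg n 1"])

lemma Lau_of_int [simp, intro]: "of_int n \<in> Lau" and ev_of_int [simp]: "ev \<zeta> (of_int n) = of_int n"
  using laurent_eval_single[of qq 0 n] ev_laurent_eval[of \<zeta> "sg 0 n"] unfolding Lau_def
  by (auto intro: range_eqI[of _ _ "sg 0 n"])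

lemma Lau_0 [simp, intro]: "0 \<in> Lau" and Lau_1 [simp, intro]: "1 \<in> Lau"
  and ev_0 [simp]: "ev \<zeta> 0 = 0" and ev_1 [simp]: "ev \<zeta> 1 = 1"
  using Lau_of_int[of 0] Lau_of_int[of 1] ev_of_int[of \<zeta> 0] ev_of_int[of \<zeta> 1] by simp_all

lemma ev_add:
  assumes "u \<in> Lau" "v \<in> Lau"
  shows "ev \<zeta> (u + v) = ev \<zeta> u + ev \<zeta> v"
proof -
  obtain a b where ab: "u = laurent_eval qq a" "v = laurent_eval qq b"
    using assms unfolding Lau_def by blast
  have "u + v = laurent_eval qq (a + b)" by (simp add: ab laurent_eval_add)
  then have "ev \<zeta> (u + v) = laurent_eval \<zeta> (a + b)" by (simp only: ev_laurent_eval)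
  then show ?thesis by (simp add: ab laurent_eval_add)
qed

lemma ev_mult:
  assumes "\<zeta> \<noteq> 0" "u \<in> Lau" "v \<in> Lau"
  shows "ev \<zeta> (u * v) = ev \<zeta> u * ev \<zeta> v"
proof -
  obtain a b where ab: "u = laurent_eval qq a" "v = laurent_eval qq b"
    using assms unfolding Lau_def by blast
  have "u * v = laurent_eval qq (a * b)" by (simp add: ab laurent_eval_mult)
  then have "ev \<zeta> (u * v) = laurent_eval \<zeta> (a * b)" by (simp only: ev_laurent_eval)
  then show ?thesis using assms(1) by (simp add: ab laurent_eval_mult)
qed

lemma Lau_minus [intro]: "u \<in> Lau \<Longrightarrow> - u \<in> Lau"
  using Lau_mult[OF Lau_of_int[of "- 1"], of u] by simp

lemma Lau_diff [intro]: "u \<in> Lau \<Longrightarrow> v \<in> Lau \<Longrightarrow> u - v \<in> Lau"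
  using Lau_add[OF _ Lau_minus, of u v] by simp

lemma ev_diff: "u \<in> Lau \<Longrightarrow> v \<in> Lau \<Longrightarrow> ev \<zeta> (u - v) = ev \<zeta> u - ev \<zeta> v"
  using ev_add[OF Lau_diff, of u v v \<zeta>] by simp

subsection \<open>Gaussian binomials\<close>

primrec gb :: "int \<Rightarrow> nat \<Rightarrow> ratfun" where
  "gb m 0 = 1"
| "gb m (Suc t) = qn (m - int t) / qn (int t + 1) * gb m t"

lemma gb_Suc_shift: "gb (m + 1) (Suc t) = qn (m + 1) / qn (int t + 1) * gb m t"
proof (induction t)
  case (Suc t)
  have "gb (m + 1) (Suc (Suc t)) = qn (m - int t) / qn (int t + 2) * gb (m + 1) (Suc t)"
    by (simp add: add.commute)
  then show ?case unfolding Suc by (simp add: add.commute)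
qed simp

lemma gb_pascal: "gb (m + 1) (Suc t) = qq powi (int t + 1) * gb m (Suc t) + qq powi (int t - m) * gb m t"
proof -
  have n: "qn (int t + 1) \<noteq> 0" by (rule qn_neq_zero) simp
  have "qn (m + 1) = qq powi (int t + 1) * qn (m - int t) + qq powi (int t - m) * qn (int t + 1)"
    using qn_add[of "m - int t" "int t + 1"] by simp
  then show ?thesis unfolding gb_Suc_shift using n by (simp add: divide_simps) (simp add: algebra_simps)
qed

text \<open>Induction on t, and inside it in both directions from m = 0, where the binomial contains
  the factor [0]. Negative m are reached by solving Pascal's rule for the lower term, whose
  coefficient is a power of q.\<close>

lemma gb_Lau: "gb m t \<in> Lau"
proof (induction t arbitrary: m)
  case (Suc t)
  show ?case
  proof (induction m rule: int_induct[of _ 0])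
    case base
    show ?case using gb_Suc_shift[of "- 1" t] by (simp del: gb.simps)
  next
    case (step1 i)
    then show ?case unfolding gb_pascal by (intro Lau_add Lau_mult Lau_powi Suc)
  next
    case (step2 i)
    have "gb (i - 1) (Suc t) = qq powi (- (int t + 1)) * (gb i (Suc t) - qq powi (int t - (i - 1)) * gb (i - 1) t)"
    proof -
      have "gb i (Suc t) - qq powi (int t - (i - 1)) * gb (i - 1) t = qq powi (int t + 1) * gb (i - 1) (Suc t)"
        using gb_pascal[of "i - 1" t] by (simp del: gb.simps)
      moreover have "qq powi (- (int t + 1)) * qq powi (int t + 1) = 1" by (simp flip: power_int_add)
      ultimately show ?thesis by (simp only: mult_1_left flip: mult.assoc)
    qed
    then show ?case using step2(2) Suc by (metis Lau_mult Lau_diff Lau_powi)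
  qed
qed simp

subsection \<open>The modules with highest weight \<open>N\<close>\<close>

text \<open>The formulas for \<open>rho\<close> below are those of \<open>\<phi> i = H (E\<^sup>i u) / [i]!\<close> under \<open>u \<mapsto> g u\<close>, for a
  linear functional \<open>H\<close> with \<open>H (F u) = 0\<close> and \<open>H (K u) = q\<^sup>N H u\<close>. In these coordinates all
  divided powers act by Gaussian binomials, so that integrality is visible.\<close>

definition endo_alg :: "(ratfun, (nat \<Rightarrow> ratfun) \<Rightarrow> (nat \<Rightarrow> ratfun)) module" where
  "endo_alg = \<lparr>carrier = {f. (\<forall>\<phi> \<psi>. f (\<lambda>i. \<phi> i + \<psi> i) = (\<lambda>i. f \<phi> i + f \<psi> i)) \<and> (\<forall>a \<phi>. f (\<lambda>i. a * \<phi> i) = (\<lambda>i. a * f \<phi> i))},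
     monoid.mult = (\<lambda>f g \<phi>. f (g \<phi>)), one = (\<lambda>\<phi>. \<phi>), zero = (\<lambda>\<phi> i. 0), add = (\<lambda>f g \<phi> i. f \<phi> i + g \<phi> i),
     module.smult = (\<lambda>a f \<phi> i. a * f \<phi> i)\<rparr>"

lemma endo_alg_is_algebra: "algebra_over endo_alg"
  by (rule algebra_overI) (auto simp: endo_alg_def algebra_simps)

definition rho :: "int \<Rightarrow> gen \<Rightarrow> (nat \<Rightarrow> ratfun) \<Rightarrow> (nat \<Rightarrow> ratfun)" where
  "rho N g \<phi> i = (case g of
      GE \<Rightarrow> qn (int i + 1) * \<phi> (i + 1)
    | GF \<Rightarrow> (if i = 0 then 0 else qn (N - int i + 1) * \<phi> (i - 1))
    | GK \<Rightarrow> qq powi (N - 2 * int i) * \<phi> i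
    | GKi \<Rightarrow> qq powi (- (N - 2 * int i)) * \<phi> i)"

lemma rho_relations: "uq_relations endo_alg (rho N)"
proof -
  interpret endo: algebra_over endo_alg by (rule endo_alg_is_algebra)
  have c: "rho N g \<in> carrier endo_alg" for g
    by (cases g) (auto simp: endo_alg_def rho_def algebra_simps fun_eq_iff)
  have minus: "f \<ominus>\<^bsub>endo_alg\<^esub> g = (\<lambda>\<phi> i. f \<phi> i - g \<phi> i)" if "f \<in> carrier endo_alg" "g \<in> carrier endo_alg" for f g
  proof -
    have "f \<ominus>\<^bsub>endo_alg\<^esub> g = f \<oplus>\<^bsub>endo_alg\<^esub> (- 1) \<odot>\<^bsub>endo_alg\<^esub> g"
      using that by (simp add: endo.minus_eq endo.smult_minus_one)
    then show ?thesis by (simp add: endo_alg_def)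
  qed
  have cc: "rho N g \<otimes>\<^bsub>endo_alg\<^esub> rho N h \<in> carrier endo_alg" "a \<odot>\<^bsub>endo_alg\<^esub> rho N g \<in> carrier endo_alg" for g h a
    using c by simp_all
  have comm: "qn (int i + 1) * (qn (N - int i) * x) - qn (int i) * (qn (N - int i + 1) * x)
    = 1 / (qq - inverse qq) * (qq powi (N - 2 * int i) * x) - 1 / (qq - inverse qq) * (qq powi (2 * int i - N) * x)" for i x
  proof -
    have "qn (int i + 1) * (qn (N - int i) * x) - qn (int i) * (qn (N - int i + 1) * x)
       = (qn (int i + 1) * qn (N - int i) - qn (int i) * qn (N - int i + 1)) * x"
      by (simp add: algebra_simps)
    also have "\<dots> = qn (N - 2 * int i) * x" unfolding qn_mult_diff by (simp add: algebra_simps)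
    finally show ?thesis by (simp add: qn_def diff_divide_distrib left_diff_distrib)
  qed
  show ?thesis
    unfolding uq_relations_def
  proof (intro conjI)
    show "range (rho N) \<subseteq> carrier endo_alg" using c by blast
    show "rho N GK \<otimes>\<^bsub>endo_alg\<^esub> rho N GKi = \<one>\<^bsub>endo_alg\<^esub>" "rho N GKi \<otimes>\<^bsub>endo_alg\<^esub> rho N GK = \<one>\<^bsub>endo_alg\<^esub>"
      by (auto simp: endo_alg_def rho_def fun_eq_iff simp flip: mult.assoc power_int_add)
    show "rho N GK \<otimes>\<^bsub>endo_alg\<^esub> (rho N GE \<otimes>\<^bsub>endo_alg\<^esub> rho N GKi) = (qq powi 2) \<odot>\<^bsub>endo_alg\<^esub> rho N GE"
      "rho N GK \<otimes>\<^bsub>endo_alg\<^esub> (rho N GF \<otimes>\<^bsub>endo_alg\<^esub> rho N GKi) = (qq powi (- 2)) \<odot>\<^bsub>endo_alg\<^esub> rho N GF"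
      by (auto simp: endo_alg_def rho_def fun_eq_iff power_int_minus power_int_diff power_int_add of_nat_diff field_simps power2_eq_square)
    show "rho N GE \<otimes>\<^bsub>endo_alg\<^esub> rho N GF \<ominus>\<^bsub>endo_alg\<^esub> rho N GF \<otimes>\<^bsub>endo_alg\<^esub> rho N GE =
      (1 / (qq - inverse qq)) \<odot>\<^bsub>endo_alg\<^esub> rho N GK \<ominus>\<^bsub>endo_alg\<^esub> (1 / (qq - inverse qq)) \<odot>\<^bsub>endo_alg\<^esub> rho N GKi"
      unfolding minus[OF cc(1) cc(1)] minus[OF cc(2) cc(2)]
    proof (intro ext)
      fix \<phi> i
      \<comment> \<open>The coordinate 0 is separate since F has no predecessor to read there; the
        corresponding term in \<open>comm\<close> has the factor [0] and causes no
        discrepancy.\<close>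
      show "(rho N GE \<otimes>\<^bsub>endo_alg\<^esub> rho N GF) \<phi> i - (rho N GF \<otimes>\<^bsub>endo_alg\<^esub> rho N GE) \<phi> i =
        ((1 / (qq - inverse qq)) \<odot>\<^bsub>endo_alg\<^esub> rho N GK) \<phi> i - ((1 / (qq - inverse qq)) \<odot>\<^bsub>endo_alg\<^esub> rho N GKi) \<phi> i"
        using comm[of i "\<phi> i"] by (cases i) (simp_all add: endo_alg_def rho_def algebra_simps)
    qed
  qed
qed

definition act :: "int \<Rightarrow> uqt \<Rightarrow> (nat \<Rightarrow> ratfun) \<Rightarrow> (nat \<Rightarrow> ratfun)" where
  "act N u = uq_hom endo_alg (rho N) (rep_u u)"

lemma act_hom: "alg_hom Uq endo_alg (uq_hom endo_alg (rho N))"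
  by (rule uq_hom_alg_hom[OF endo_alg_is_algebra rho_relations])

lemma act_mult: "act N (u * v) \<phi> = act N u (act N v \<phi>)" and act_one: "act N 1 \<phi> = \<phi>"
  and act_add: "act N (u + v) \<phi> = (\<lambda>i. act N u \<phi> i + act N v \<phi> i)" and act_scal: "act N (a *\<^sub>q u) \<phi> = (\<lambda>i. a * act N u \<phi> i)"
  unfolding act_def rep_u_simps
  by (simp_all only: alg_homD(2-)[OF act_hom] rep_u_closed) (simp_all add: endo_alg_def)

lemma act_linear: "act N u (\<lambda>i. a * \<phi> i) = (\<lambda>i. a * act N u \<phi> i)"
  using alg_homD(1)[OF act_hom, of "rep_u u" N] by (simp add: act_def endo_alg_def)

lemma act_gens:
  "act N uE \<phi> i = qn (int i + 1) * \<phi> (i + 1)"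
  "act N uF \<phi> i = (if i = 0 then 0 else qn (N - int i + 1) * \<phi> (i - 1))"
  "act N uK \<phi> i = qq powi (N - 2 * int i) * \<phi> i"
  "act N uKi \<phi> i = qq powi (- (N - 2 * int i)) * \<phi> i"
  by (simp_all add: act_def rep_u_gens uq_hom_ug[OF endo_alg_is_algebra rho_relations] rho_def)

lemma act_Ed: "act N (Ed t) \<phi> i = gb (int i + int t) t * \<phi> (i + t)"
proof (induction t arbitrary: i)
  case 0 show ?case by (simp add: Ed_def act_one)
next
  case (Suc t)
  have n: "qn (int t + 1) \<noteq> 0" by (rule qn_neq_zero) simp
  have "qn (int t + 1) * act N (Ed (Suc t)) \<phi> i = act N (uE * Ed t) \<phi> i" by (simp add: uE_Ed act_scal)
  also have "\<dots> = qn (int t + 1) * (gb (int i + int (Suc t)) (Suc t) * \<phi> (i + Suc t))"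
    using n by (simp add: act_mult act_gens Suc algebra_simps)
  finally show ?case using n mult_left_cancel by blast
qed

lemma act_Fd: "act N (Fd (int t)) \<phi> i = (if i < t then 0 else gb (N - int i + int t) t * \<phi> (i - t))"
proof (induction t arbitrary: i)
  case 0 show ?case by (simp add: Fd_def act_one)
next
  case (Suc t)
  have n: "qn (int t + 1) \<noteq> 0" by (rule qn_neq_zero) simp
  have "Fd (int (Suc t)) = (1 / qn (int t + 1)) *\<^sub>q (uF * Fd (int t))"
    using n by (simp add: Fd_def nat_add_distrib)
  then have "act N (Fd (int (Suc t))) \<phi> i = 1 / qn (int t + 1) * act N uF (act N (Fd (int t)) \<phi>) i"
    by (simp only: act_scal act_mult)
  also have "\<dots> = (if i < Suc t then 0 else gb (N - int i + int (Suc t)) (Suc t) * \<phi> (i - Suc t))"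
    by (cases i) (simp_all add: act_gens Suc algebra_simps)
  finally show ?case .
qed


subsection \<open>Lusztig's form\<close>

definition Lt :: "uqt set" where
  "Lt = {u. rep_u u \<in> carrier lusztig_form}"

definition gens_L :: "uq set" where
  "gens_L = {ug GK, ug GKi} \<union> range (divided_power GE) \<union> range (divided_power GF)"

lemma rep_u_power: "rep_u (u ^ t) = rep_u u [^]\<^bsub>Uq\<^esub> t"
  by (induction t) (simp_all add: rep_u_simps power_Suc2 del: power_Suc)

lemma rep_u_divided: "rep_u (Ed t) = divided_power GE t" "rep_u (Fd (int t)) = divided_power GF t"
  by (simp_all add: Ed_def Fd_def divided_power_def rep_u_simps rep_u_power rep_u_gens inverse_eq_divide)

lemma gens_L_eq: "gens_L = rep_u ` ({uK, uKi} \<union> range Ed \<union> range (\<lambda>t. Fd (int t)))"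
  unfolding gens_L_def image_Un image_insert image_empty rep_u_gens image_image rep_u_divided ..

lemma carrier_lusztig_form: "carrier lusztig_form = subalg_gen (restrict_scalars (laurent_eval qq) Uq) gens_L"
  by (simp add: lusztig_form_def Let_def gens_L_def)

lemma lusztig_form_simps:
  "x \<oplus>\<^bsub>lusztig_form\<^esub> y = x \<oplus>\<^bsub>Uq\<^esub> y" "x \<otimes>\<^bsub>lusztig_form\<^esub> y = x \<otimes>\<^bsub>Uq\<^esub> y"
  "\<one>\<^bsub>lusztig_form\<^esub> = \<one>\<^bsub>Uq\<^esub>" "\<zero>\<^bsub>lusztig_form\<^esub> = \<zero>\<^bsub>Uq\<^esub>"
  "a \<odot>\<^bsub>lusztig_form\<^esub> x = laurent_eval qq a \<odot>\<^bsub>Uq\<^esub> x"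
  by (simp_all add: lusztig_form_def Let_def restrict_scalars_def)

lemma restricted_Uq_is_algebra: "algebra_over (restrict_scalars (laurent_eval qq) Uq)"
  by (rule restrict_scalars_is_algebra[OF Uq_is_algebra]) (simp_all add: laurent_eval_add laurent_eval_mult)

lemma gens_L_closed: "gens_L \<subseteq> carrier (restrict_scalars (laurent_eval qq) Uq)"
  unfolding gens_L_eq by (auto simp: restrict_scalars_def)

lemma lusztig_form_is_algebra: "algebra_over lusztig_form"
  using subalg_gen_is_algebra[OF restricted_Uq_is_algebra gens_L_closed]
  by (simp add: lusztig_form_def Let_def gens_L_def)

lemma Lt_gens: "uK \<in> Lt" "uKi \<in> Lt" "Ed t \<in> Lt" "Fd s \<in> Lt"
proof -
  have g: "u \<in> Lt" if "rep_u u \<in> gens_L" for u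
    using that unfolding Lt_def carrier_lusztig_form by (simp add: subalg_gen.gen)
  show "uK \<in> Lt" "uKi \<in> Lt" "Ed t \<in> Lt" by (rule g, unfold gens_L_eq, rule imageI, blast)+
  show "Fd s \<in> Lt"
  proof (cases "s < 0")
    case True
    have "\<zero>\<^bsub>lusztig_form\<^esub> \<in> carrier lusztig_form"
      using lusztig_form_is_algebra by (simp add: algebra_over_def ring.ring_simprules)
    then show ?thesis using True by (simp add: Lt_def Fd_def rep_u_simps lusztig_form_simps)
  next
    case False
    then have "Fd (int (nat s)) \<in> Lt" by (intro g, unfold gens_L_eq, intro imageI) blast
    then show ?thesis using False by simp
  qed
qed

lemma Lt_one [simp]: "1 \<in> Lt"
  and Lt_add: "u \<in> Lt \<Longrightarrow> v \<in> Lt \<Longrightarrow> u + v \<in> Lt"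
  and Lt_mult: "u \<in> Lt \<Longrightarrow> v \<in> Lt \<Longrightarrow> u * v \<in> Lt"
  and Lt_scal: "a \<in> Lau \<Longrightarrow> u \<in> Lt \<Longrightarrow> a *\<^sub>q u \<in> Lt"
proof -
  interpret L: algebra_over lusztig_form by (rule lusztig_form_is_algebra)
  show "1 \<in> Lt" using L.one_closed by (simp add: Lt_def rep_u_simps lusztig_form_simps)
  show "u \<in> Lt \<Longrightarrow> v \<in> Lt \<Longrightarrow> u + v \<in> Lt" using L.add.m_closed[of "rep_u u" "rep_u v"]
    by (simp add: Lt_def rep_u_simps lusztig_form_simps)
  show "u \<in> Lt \<Longrightarrow> v \<in> Lt \<Longrightarrow> u * v \<in> Lt" using L.m_closed[of "rep_u u" "rep_u v"]
    by (simp add: Lt_def rep_u_simps lusztig_form_simps)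
  assume "a \<in> Lau" "u \<in> Lt"
  moreover from \<open>a \<in> Lau\<close> obtain b where "a = laurent_eval qq b" unfolding Lau_def by blast
  ultimately show "a *\<^sub>q u \<in> Lt" using L.smult_closed[of "rep_u u" b]
    by (simp add: Lt_def rep_u_simps lusztig_form_simps)
qed

lemma Lt_minus: "u \<in> Lt \<Longrightarrow> - u \<in> Lt"
  using Lt_scal[of "- 1" u] Lau_minus[OF Lau_1] by (simp add: scal_minus_left)

lemma Lt_diff: "u \<in> Lt \<Longrightarrow> v \<in> Lt \<Longrightarrow> u - v \<in> Lt"
  using Lt_add[OF _ Lt_minus, of u v] by simp

lemma Lt_power: "u \<in> Lt \<Longrightarrow> u ^ n \<in> Lt"
  by (induction n) (simp_all add: Lt_mult)

lemma Lt_sum: "(\<And>i. i \<in> A \<Longrightarrow> f i \<in> Lt) \<Longrightarrow> (\<Sum>i\<in>A. f i) \<in> Lt"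
proof (induction A rule: infinite_finite_induct)
  case (insert x A) then show ?case by (simp add: Lt_add)
qed (use Lt_scal[of 0 1] in simp_all)

lemma Lt_induct [consumes 1, case_names K Ki Ed Fd one add mult scal]:
  assumes "u \<in> Lt" "P uK" "P uKi" "\<And>t. P (Ed t)" "\<And>t. P (Fd (int t))" "P 1"
    and add: "\<And>u v. u \<in> Lt \<Longrightarrow> v \<in> Lt \<Longrightarrow> P u \<Longrightarrow> P v \<Longrightarrow> P (u + v)"
    and mult: "\<And>u v. u \<in> Lt \<Longrightarrow> v \<in> Lt \<Longrightarrow> P u \<Longrightarrow> P v \<Longrightarrow> P (u * v)"
    and scal: "\<And>a u. a \<in> Lau \<Longrightarrow> u \<in> Lt \<Longrightarrow> P u \<Longrightarrow> P (a *\<^sub>q u)"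
  shows "P u"
proof -
  have "\<exists>v \<in> Lt. X = rep_u v \<and> P v" if "X \<in> carrier lusztig_form" for X
    using that unfolding carrier_lusztig_form
  proof induction
    case (gen X)
    then show ?case using assms(2-5) Lt_gens by (auto simp: gens_L_eq)
  next
    case one
    then show ?case using assms(6) by (intro bexI[of _ 1]) (simp_all add: restrict_scalars_def rep_u_simps)
  next
    case (add X Y)
    then obtain u v where "u \<in> Lt" "v \<in> Lt" "X = rep_u u" "Y = rep_u v" "P u" "P v" by blast
    then show ?case using assms(7)[of u v] Lt_add[of u v]
      by (intro bexI[of _ "u + v"]) (simp_all add: restrict_scalars_def rep_u_simps)
  next
    case (mult X Y)
    then obtain u v where "u \<in> Lt" "v \<in> Lt" "X = rep_u u" "Y = rep_u v" "P u" "P v" by blast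
    then show ?case using assms(8)[of u v] Lt_mult[of u v]
      by (intro bexI[of _ "u * v"]) (simp_all add: restrict_scalars_def rep_u_simps)
  next
    case (smult X a)
    then obtain u where "u \<in> Lt" "X = rep_u u" "P u" by blast
    moreover have "laurent_eval qq a \<in> Lau" by (simp add: Lau_def)
    ultimately show ?case using assms(9)[of "laurent_eval qq a" u] Lt_scal[of "laurent_eval qq a" u]
      by (intro bexI[of _ "laurent_eval qq a *\<^sub>q u"]) (simp_all add: restrict_scalars_def rep_u_simps)
  qed
  from this[of "rep_u u"] assms(1) show ?thesis by (auto simp: Lt_def rep_u_inject)
qed

text \<open>Strong induction on t settles c = 0 by the commutation formula. Pascal's rule then moves
  c up and down, using smaller t.\<close>

lemma kbin_Lt: "kbin c t \<in> Lt"
proof (induction t arbitrary: c rule: less_induct)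
  case (less t)
  show ?case
  proof (cases t)
    case (Suc s)
    show ?thesis unfolding Suc
    proof (induction c rule: int_induct[of _ 0])
      case base
      have Z: "Fd (int t - int k) * kbin (2 * int k - int t - int t) k * Ed (t - k) \<in> Lt" if "k \<in> {..<t}" for k
        using that by (intro Lt_mult Lt_gens less.IH) simp
      \<comment> \<open>The last summand is isolated: its parameter 2t - t - t is 0, and all other
        summands contain binomials with lower index smaller than t.\<close>
      have "Ed t * Fd (int t) = (\<Sum>k<t. Fd (int t - int k) * kbin (2 * int k - int t - int t) k * Ed (t - k))
          + Fd 0 * kbin 0 t * Ed 0"
        unfolding Ed_Fd lessThan_Suc_atMost[symmetric] by simp
      moreover have "Fd 0 = 1" "Ed 0 = 1" by (simp_all add: Fd_def Ed_def)
      ultimately have "kbin 0 t = Ed t * Fd (int t) - (\<Sum>k<t. Fd (int t - int k) * kbin (2 * int k - int t - int t) k * Ed (t - k))"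
        by simp
      also have "\<dots> \<in> Lt" by (intro Lt_diff Lt_sum Z Lt_mult Lt_gens)
      finally show ?case by (simp add: Suc)
    next
      case (step1 i)
      then show ?case unfolding kbin_pascal
        using less.IH[of s] Suc by (intro Lt_add Lt_scal Lau_powi Lt_mult Lt_gens) simp_all
    next
      case (step2 i)
      have "qq powi (- (int s + 1)) * qq powi (int s + 1) = 1" by (simp flip: power_int_add)
      then have "kbin (i - 1) (Suc s) = (qq powi (- (int s + 1))) *\<^sub>q (kbin i (Suc s) - (qq powi (int s - (i - 1))) *\<^sub>q (uKi * kbin (i - 1) s))"
        using kbin_pascal[of "i - 1" s] by (simp add: scal_add_right del: kbin.simps)
      also have "\<dots> \<in> Lt" using step2 less.IH[of s] Suc by (intro Lt_scal Lt_diff Lau_powi Lt_mult Lt_gens) simp_all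
      finally show ?case .
    qed
  qed simp
qed

text \<open>The recursion of \<open>kbin\<close> puts a new factor in front, whereas the fold puts
  it innermost; the brackets commute. The factor q - q^-1 cancels between \<open>br\<close> and
  \<open>qn\<close>.\<close>

lemma rep_u_kbin: "rep_u (kbin 0 l) = uq_Kbinom l"
proof -
  define g where "g s = (1 / qn (int s)) *\<^sub>q br (1 - int s)" for s :: nat
  have "foldr (\<lambda>s x. g s * x) [1..<Suc l] y = kbin 0 l * y" for y
  proof (induction l arbitrary: y)
    case (Suc l)
    have "foldr (\<lambda>s x. g s * x) [1..<Suc (Suc l)] y = kbin 0 l * (g (Suc l) * y)"
      using Suc[of "g (Suc l) * y"] by simp
    also have "\<dots> = (kbin 0 l * g (Suc l)) * y" by (simp add: mult.assoc)
    also have "kbin 0 l * g (Suc l) = kbin 0 (Suc l)"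
      by (simp add: g_def kbin_comm add.commute)
    finally show ?case .
  qed simp
  from this[of 1] have "kbin 0 l = foldr (\<lambda>s x. g s * x) [1..<Suc l] 1" by simp
  moreover have "rep_u (foldr (\<lambda>s x. g s * x) xs 1) = foldr
     (\<lambda>s x. ((1 / (qq powi int s - qq powi (- int s))) \<odot>\<^bsub>Uq\<^esub>
              ((qq powi (1 - int s) \<odot>\<^bsub>Uq\<^esub> ug GK) \<ominus>\<^bsub>Uq\<^esub> (qq powi (int s - 1) \<odot>\<^bsub>Uq\<^esub> ug GKi)))
            \<otimes>\<^bsub>Uq\<^esub> x) xs \<one>\<^bsub>Uq\<^esub>" for xs
  proof (induction xs)
    case (Cons s xs)
    have "g s = (1 / (qq powi int s - qq powi (- int s))) *\<^sub>q ((qq powi (1 - int s)) *\<^sub>q uK - (qq powi (int s - 1)) *\<^sub>q uKi)"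
      by (simp add: g_def br_def qn_def)
    then have "rep_u (g s) = (1 / (qq powi int s - qq powi (- int s))) \<odot>\<^bsub>Uq\<^esub>
       ((qq powi (1 - int s) \<odot>\<^bsub>Uq\<^esub> ug GK) \<ominus>\<^bsub>Uq\<^esub> (qq powi (int s - 1) \<odot>\<^bsub>Uq\<^esub> ug GKi))"
      by (simp only: rep_u_simps rep_u_gens)
    with Cons show ?case by (simp only: foldr_Cons o_apply rep_u_simps)
  qed (simp add: rep_u_simps)
  ultimately show ?thesis by (simp only: uq_Kbinom_def)
qed

subsection \<open>Highest weight functionals\<close>

text \<open>\<open>hwf N u\<close> is the coefficient of the highest weight vector \<open>v\<close> in \<open>u v\<close>, where \<open>v\<close> generates the
  Verma module of highest weight \<open>N\<close>.\<close>

definition hwf :: "int \<Rightarrow> uqt \<Rightarrow> ratfun" where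
  "hwf N u = act N u (\<lambda>i. if i = 0 then 1 else 0) 0"

text \<open>A description that does not mention \<open>rho N\<close>. As it determines the
  functional, f_n \<otimes> f_m after comultiplication can be identified by checking generators,
  without forming a tensor product of modules.\<close>

definition is_hwf :: "int \<Rightarrow> (uqt \<Rightarrow> ratfun) \<Rightarrow> bool" where
  "is_hwf N H \<longleftrightarrow> (\<forall>u v. H (u + v) = H u + H v) \<and> (\<forall>a u. H (a *\<^sub>q u) = a * H u) \<and> (\<forall>u. H (uF * u) = 0) \<and>
    (\<forall>u. H (uK * u) = qq powi N * H u) \<and> (\<forall>u. H (uKi * u) = qq powi (- N) * H u) \<and> (\<forall>u. H (u * uE) = 0) \<and> H 1 = 1"

lemma is_hwfD:
  assumes "is_hwf N H"
  shows "H (u + v) = H u + H v" "H (a *\<^sub>q u) = a * H u" "H (uF * u) = 0" "H (uK * u) = qq powi N * H u"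
    "H (uKi * u) = qq powi (- N) * H u" "H (u * uE) = 0" "H 1 = 1"
  using assms unfolding is_hwf_def by blast+

lemma is_hwf_hwf: "is_hwf N (hwf N)"
proof -
  have "act N uE (\<lambda>i. if i = 0 then 1 else 0) = (\<lambda>i. 0)" by (simp add: fun_eq_iff act_gens)
  moreover have "act N u (\<lambda>i. 0) = (\<lambda>i. 0)" for u using act_linear[of N u 0] by simp
  ultimately show ?thesis
    by (simp add: is_hwf_def hwf_def act_add act_scal act_mult act_gens act_one)
qed

lemma uE_power_K: "uE ^ i * uK = (qq powi (- 2 * int i)) *\<^sub>q (uK * uE ^ i)"
  and uE_power_Ki: "uE ^ i * uKi = (qq powi (2 * int i)) *\<^sub>q (uKi * uE ^ i)"
proof -
  have "uE ^ i * uK = (qq powi (- 2 * int i)) *\<^sub>q (uK * uE ^ i) \<and> uE ^ i * uKi = (qq powi (2 * int i)) *\<^sub>q (uKi * uE ^ i)"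
  proof (induction i)
    case (Suc i)
    have p: "qq powi (- 2 * int (Suc i)) = qq powi (- 2 * int i) * qq powi (- 2)" "qq powi (2 * int (Suc i)) = qq powi (2 * int i) * qq powi 2"
    proof -
      have "- 2 * int (Suc i) = - 2 * int i + - 2" "2 * int (Suc i) = 2 * int i + 2" by simp_all
      then show "qq powi (- 2 * int (Suc i)) = qq powi (- 2 * int i) * qq powi (- 2)" "qq powi (2 * int (Suc i)) = qq powi (2 * int i) * qq powi 2"
        using power_int_add[of qq "- 2 * int i" "- 2"] power_int_add[of qq "2 * int i" 2] by (metis qq_neq_zero)+
    qed
    have "uE ^ Suc i * uK = uE * (uE ^ i * uK)" "uE ^ Suc i * uKi = uE * (uE ^ i * uKi)" by (simp_all add: mult.assoc)
    then have "uE ^ Suc i * uK = (qq powi (- 2 * int i)) *\<^sub>q ((uE * uK) * uE ^ i)"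
      "uE ^ Suc i * uKi = (qq powi (2 * int i)) *\<^sub>q ((uE * uKi) * uE ^ i)"
      using Suc by (simp_all add: mult.assoc)
    then show ?case unfolding uE_uK uE_uKi p by (simp add: mult.assoc)
  qed simp
  then show "uE ^ i * uK = (qq powi (- 2 * int i)) *\<^sub>q (uK * uE ^ i)" "uE ^ i * uKi = (qq powi (2 * int i)) *\<^sub>q (uKi * uE ^ i)"
    by blast+
qed

text \<open>The axioms do not prescribe the effect of E on the left, so all values at
  \<open>uE ^ i * u\<close> are compared at once: E shifts i, K and K^-1 act by scalars, and F is
  commuted to the front, where it is killed.\<close>

lemma hwf_unique:
  assumes H: "is_hwf N H" and H': "is_hwf N H'"
  shows "H u = H' u"
proof -
  note h = is_hwfD[OF H] and h' = is_hwfD[OF H']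
  have K_step: "H (uE ^ i * (uK * u)) = qq powi (- 2 * int i) * (qq powi N * H (uE ^ i * u))"
    "H (uE ^ i * (uKi * u)) = qq powi (2 * int i) * (qq powi (- N) * H (uE ^ i * u))" if h: "is_hwf N H" for u i H
  proof -
    have "uE ^ i * (uK * u) = (qq powi (- 2 * int i)) *\<^sub>q (uK * (uE ^ i * u))"
      "uE ^ i * (uKi * u) = (qq powi (2 * int i)) *\<^sub>q (uKi * (uE ^ i * u))"
      by (simp_all only: uE_power_K uE_power_Ki scal_mult_left mult.assoc flip: mult.assoc[of "uE ^ i"])
    then show "H (uE ^ i * (uK * u)) = qq powi (- 2 * int i) * (qq powi N * H (uE ^ i * u))"
    "H (uE ^ i * (uKi * u)) = qq powi (2 * int i) * (qq powi (- N) * H (uE ^ i * u))"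
      by (simp_all only: is_hwfD[OF h])
  qed
  \<comment> \<open>Moving one E past F replaces \<open>u\<close> by \<open>uE * u\<close> and
    produces terms in K and K^-1 with lower exponent. Hence \<open>u\<close> is arbitrary in the
    induction on i.\<close>
  have F_step: "\<forall>i. H (uE ^ i * u) = H' (uE ^ i * u) \<Longrightarrow> H (uE ^ i * (uF * u)) = H' (uE ^ i * (uF * u))" for i u
  proof (induction i arbitrary: u)
    case 0
    then show ?case by (simp add: h h')
  next
    case (Suc i)
    have EF: "uE * uF = uF * uE + (1 / (qq - inverse qq)) *\<^sub>q uK + (- (1 / (qq - inverse qq))) *\<^sub>q uKi"
      using uE_uF_comm by (simp add: algebra_simps scal_minus_left)
    have "uE ^ Suc i * (uF * u) = uE ^ i * (uE * uF) * u"
      by (simp only: power_Suc2 mult.assoc)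
    also have "\<dots> = uE ^ i * (uF * (uE * u)) + (1 / (qq - inverse qq)) *\<^sub>q (uE ^ i * (uK * u)) + (- (1 / (qq - inverse qq))) *\<^sub>q (uE ^ i * (uKi * u))"
      unfolding EF by (simp only: distrib_left distrib_right mult.assoc scal_mult_left scal_mult_right)
    finally have e: "uE ^ Suc i * (uF * u) = \<dots>" .
    have "H (uE ^ j * (uE * u)) = H' (uE ^ j * (uE * u))" for j
      using Suc.prems[rule_format, of "Suc j"] by (simp only: power_Suc2 mult.assoc)
    then have "H (uE ^ i * (uF * (uE * u))) = H' (uE ^ i * (uF * (uE * u)))" using Suc.IH by blast
    then show ?case unfolding e by (simp only: h(1,2) h'(1,2) K_step[OF H] K_step[OF H'] Suc.prems)
  qed
  have "\<forall>i. H (uE ^ i * u) = H' (uE ^ i * u)"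
  proof (induction u rule: uqt_induct)
    case one
    show ?case
    proof
      \<comment> \<open>For i > 0 the last E stands on the right, so both values are 0; for i = 0
        both are 1.\<close>
      fix i show "H (uE ^ i * 1) = H' (uE ^ i * 1)"
        by (cases i) (simp_all add: h h' power_Suc2 del: power_Suc)
    qed
  next
    case (E u)
    show ?case
    proof
      fix i show "H (uE ^ i * (uE * u)) = H' (uE ^ i * (uE * u))"
        using E[rule_format, of "Suc i"] by (simp only: power_Suc2 mult.assoc)
    qed
  next
    case (F u) then show ?case using F_step by blast
  next
    case (K u) then show ?case by (simp add: K_step[OF H] K_step[OF H'])
  next
    case (Ki u) then show ?case by (simp add: K_step[OF H] K_step[OF H'])
  next
    case (add u v) then show ?case by (simp add: distrib_left h(1) h'(1))
  next
    case (scal u a) then show ?case by (simp add: h(2) h'(2))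
  qed
  from this[rule_format, of 0] show ?thesis by simp
qed


subsection \<open>Finite sums of tensors\<close>

context
  fixes M :: "('r::comm_ring_1, 'm) module" and N :: "('r, 'n) module"
  assumes M: "algebra_over M" and N: "algebra_over N"
begin

interpretation M: algebra_over M by (rule M)
interpretation N: algebra_over N by (rule N)
interpretation T: algebra_over "tensor M N" by (rule tensor_is_algebra[OF M N])

lemma tens_sum_Nil: "tens_sum M N [] = \<zero>\<^bsub>tensor M N\<^esub>"
  and tens_sum_Cons: "tens_sum M N ((x, y) # ps) = tens M N x y \<oplus>\<^bsub>tensor M N\<^esub> tens_sum M N ps"
  by (simp_all add: tens_sum_def)

lemma tens_sum_closed: "set ps \<subseteq> carrier M \<times> carrier N \<Longrightarrow> tens_sum M N ps \<in> carrier (tensor M N)"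
  by (induction ps) (auto simp: tens_sum_Nil tens_sum_Cons tens_closed[OF M N])

lemma tens_sum_append:
  "set ps \<subseteq> carrier M \<times> carrier N \<Longrightarrow> set qs \<subseteq> carrier M \<times> carrier N \<Longrightarrow>
    tens_sum M N (ps @ qs) = tens_sum M N ps \<oplus>\<^bsub>tensor M N\<^esub> tens_sum M N qs"
proof (induction ps)
  case (Cons p ps)
  then show ?case
    by (cases p) (simp add: tens_sum_Cons T.a_assoc tens_closed[OF M N] tens_sum_closed)
qed (simp add: tens_sum_Nil tens_sum_closed)

lemma tens_sum_smult:
  "set ps \<subseteq> carrier M \<times> carrier N \<Longrightarrow>
    tens_sum M N (map (\<lambda>(x, y). (c \<odot>\<^bsub>M\<^esub> x, y)) ps) = c \<odot>\<^bsub>tensor M N\<^esub> tens_sum M N ps"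
proof (induction ps)
  case (Cons p ps)
  then show ?case
    by (cases p) (simp add: tens_sum_Cons T.smult_r_distr tens_smult[OF M N] tens_closed[OF M N] tens_sum_closed)
qed (simp add: tens_sum_Nil)

text \<open>Products of sums of tensors are kept as explicit lists of pairs, so that specialization
  can be mapped over the factors.\<close>

definition tens_pairs :: "('m \<times> 'n) list \<Rightarrow> ('m \<times> 'n) list \<Rightarrow> ('m \<times> 'n) list" where
  "tens_pairs ps qs = concat (map (\<lambda>(x, y). map (\<lambda>(x', y'). (x \<otimes>\<^bsub>M\<^esub> x', y \<otimes>\<^bsub>N\<^esub> y')) qs) ps)"

lemma set_tens_pairs:
  assumes "set ps \<subseteq> A \<times> B" "set qs \<subseteq> A \<times> B"
    and "\<And>x y. x \<in> A \<Longrightarrow> y \<in> A \<Longrightarrow> x \<otimes>\<^bsub>M\<^esub> y \<in> A" "\<And>x y. x \<in> B \<Longrightarrow> y \<in> B \<Longrightarrow> x \<otimes>\<^bsub>N\<^esub> y \<in> B"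
  shows "set (tens_pairs ps qs) \<subseteq> A \<times> B"
  using assms(1,2) unfolding tens_pairs_def by (auto intro!: assms(3,4))

lemma tens_sum_mult_left:
  assumes "x \<in> carrier M" "y \<in> carrier N"
  shows "set qs \<subseteq> carrier M \<times> carrier N \<Longrightarrow>
    tens_sum M N (map (\<lambda>(x', y'). (x \<otimes>\<^bsub>M\<^esub> x', y \<otimes>\<^bsub>N\<^esub> y')) qs) = tens M N x y \<otimes>\<^bsub>tensor M N\<^esub> tens_sum M N qs"
proof (induction qs)
  case (Cons q qs)
  then show ?case using assms
    by (cases q) (simp add: tens_sum_Cons T.r_distr tens_mult[OF M N] tens_closed[OF M N] tens_sum_closed)
qed (use assms in \<open>simp add: tens_sum_Nil tens_closed[OF M N]\<close>)

lemma tens_sum_mult: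
  assumes qs: "set qs \<subseteq> carrier M \<times> carrier N"
  shows "set ps \<subseteq> carrier M \<times> carrier N \<Longrightarrow>
    tens_sum M N (tens_pairs ps qs) = tens_sum M N ps \<otimes>\<^bsub>tensor M N\<^esub> tens_sum M N qs"
proof (induction ps)
  case (Cons p ps)
  obtain x y where p: "p = (x, y)" "x \<in> carrier M" "y \<in> carrier N" using Cons.prems by (cases p) auto
  let ?q = "map (\<lambda>(x', y'). (x \<otimes>\<^bsub>M\<^esub> x', y \<otimes>\<^bsub>N\<^esub> y')) qs"
  have q: "set ?q \<subseteq> carrier M \<times> carrier N" using qs p by auto
  have r: "set (tens_pairs ps qs) \<subseteq> carrier M \<times> carrier N"
    using Cons.prems qs by (intro set_tens_pairs) auto
  have "tens_pairs (p # ps) qs = ?q @ tens_pairs ps qs" by (simp add: tens_pairs_def p)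
  then have "tens_sum M N (tens_pairs (p # ps) qs) = tens M N x y \<otimes>\<^bsub>tensor M N\<^esub> tens_sum M N qs
      \<oplus>\<^bsub>tensor M N\<^esub> tens_sum M N ps \<otimes>\<^bsub>tensor M N\<^esub> tens_sum M N qs"
    using tens_sum_append[OF q r] tens_sum_mult_left[OF p(2,3) qs] Cons by simp
  then show ?case using Cons.prems qs p by (simp add: tens_sum_Cons T.l_distr tens_closed[OF M N] tens_sum_closed)
qed (simp add: tens_pairs_def tens_sum_Nil tens_sum_closed[OF qs])

lemma tensor_fun_tens_sum:
  assumes f: "lin M f" and g: "lin N g"
  shows "set ps \<subseteq> carrier M \<times> carrier N \<Longrightarrow> tensor_fun f g (tens_sum M N ps) = (\<Sum>(x, y)\<leftarrow>ps. f x * g y)"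
proof (induction ps)
  case Nil
  then show ?case using T.lin_zero[OF tensor_fun_lin[OF M N f g]] by (simp add: tens_sum_Nil)
next
  case (Cons p ps)
  then show ?case
    by (cases p) (simp add: tens_sum_Cons semilin_add[OF tensor_fun_lin[OF M N f g]] tensor_fun_tens[OF M N f g]
      tens_closed[OF M N] tens_sum_closed)
qed

end

subsection \<open>Compatibility of the highest weight functionals with the comultiplication\<close>

definition hwt :: "int \<Rightarrow> int \<Rightarrow> tqt \<Rightarrow> ratfun" where
  "hwt n m t = tensor_fun (\<lambda>X. hwf n (abs_u X)) (\<lambda>X. hwf m (abs_u X)) (rep_t t)"

lemma hwf_lin: "lin Uq (\<lambda>X. hwf n (abs_u X))"
proof -
  have "abs_u (x \<oplus>\<^bsub>Uq\<^esub> y) = abs_u x + abs_u y" "abs_u (a \<odot>\<^bsub>Uq\<^esub> x) = a *\<^sub>q abs_u x" if "x \<in> carrier Uq" "y \<in> carrier Uq" for x y a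
    using that by (simp_all add: plus_uqt_def scal_uqt_def abs_u_inverse)
  then show ?thesis by (simp add: semilin_def is_hwfD[OF is_hwf_hwf])
qed

lemma hwt_tn: "hwt n m (tn x y) = hwf n x * hwf m y"
  by (simp add: hwt_def rep_t_tn tensor_fun_tens[OF Uq_is_algebra Uq_is_algebra hwf_lin hwf_lin] rep_u_inverse)

lemma hwt_add: "hwt n m (s + t) = hwt n m s + hwt n m t" and hwt_scal: "hwt n m (a *\<^sub>q t) = a * hwt n m t"
  by (simp_all add: hwt_def rep_t_simps semilin_add[OF tensor_fun_lin[OF Uq_is_algebra Uq_is_algebra hwf_lin hwf_lin]]
    semilin_smult[OF tensor_fun_lin[OF Uq_is_algebra Uq_is_algebra hwf_lin hwf_lin]])

lemma hwt_zero: "hwt n m 0 = 0"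
  using hwt_scal[of n m 0 0] by simp

text \<open>Each summand of the comultiplication of F has a factor F, killed on the left; each
  summand for E has a factor E, killed on the right; and the two weights add up.\<close>

lemma is_hwf_Delta: "is_hwf (n + m) (\<lambda>u. hwt n m (\<Delta> u))"
proof -
  note h = is_hwfD[OF is_hwf_hwf]
  have F: "hwt n m ((tn uF 1 + tn uKi uF) * t) = 0" for t
    by (induction t rule: tqt_induct) (simp_all add: hwt_zero hwt_add hwt_scal hwt_tn distrib_left distrib_right h)
  have K: "hwt n m (tn uK uK * t) = qq powi (n + m) * hwt n m t" for t
    by (induction t rule: tqt_induct) (simp_all add: hwt_zero hwt_add hwt_scal hwt_tn distrib_left h power_int_add)
  have Ki: "hwt n m (tn uKi uKi * t) = qq powi (- (n + m)) * hwt n m t" for t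
  proof -
    have "qq powi (- n - m) = qq powi (- n) * qq powi (- m)" using power_int_add[of qq "- n" "- m"] by simp
    then show ?thesis
      by (induction t rule: tqt_induct) (simp_all add: hwt_zero hwt_add hwt_scal hwt_tn distrib_left h)
  qed
  have E: "hwt n m (t * (tn uE uK + tn 1 uE)) = 0" for t
    by (induction t rule: tqt_induct) (simp_all add: hwt_zero hwt_add hwt_scal hwt_tn distrib_left distrib_right h)
  show ?thesis
    unfolding is_hwf_def Delta_mult Delta_gens
    by (simp only: F K Ki E Delta_add Delta_scal hwt_add hwt_scal Delta_one tn_one hwt_tn h) simp
qed

lemma hwt_Delta: "hwt n m (\<Delta> u) = hwf (n + m) u"
  by (rule hwf_unique[OF is_hwf_Delta is_hwf_hwf])

lemma tensor_fun_comult: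
  assumes u: "u \<in> carrier Uq" and "set ps \<subseteq> carrier Uq \<times> carrier Uq" "uq_comult u = tens_sum Uq Uq ps"
  shows "hwf (n + m) (abs_u u) = (\<Sum>(x, y)\<leftarrow>ps. hwf n (abs_u x) * hwf m (abs_u y))"
proof -
  have "hwf (n + m) (abs_u u) = tensor_fun (\<lambda>X. hwf n (abs_u X)) (\<lambda>X. hwf m (abs_u X)) (uq_comult u)"
    using u by (simp add: hwt_def rep_t_Delta abs_u_inverse flip: hwt_Delta)
  then show ?thesis
    unfolding assms(3) by (simp add: tensor_fun_tens_sum[OF Uq_is_algebra Uq_is_algebra hwf_lin hwf_lin assms(2)])
qed

text \<open>Under f_N, left multiplication by K is the scalar q^N whatever \<open>u\<close> is, so
  each bracket \<open>br d\<close> contributes [N + d].\<close>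

lemma hwf_kbin: "hwf N (kbin c t * u) = gb (N + c) t * hwf N u"
proof (induction t arbitrary: u)
  case (Suc t)
  have "hwf N (br d * v) = qn (N + d) * hwf N v" for d v
  proof -
    have "br d * v = (1 / (qq - inverse qq)) *\<^sub>q ((qq powi d) *\<^sub>q (uK * v) + (- (qq powi (- d))) *\<^sub>q (uKi * v))"
      by (simp add: br_def scal_distribs left_diff_distrib)
    then have "hwf N (br d * v) = 1 / (qq - inverse qq) * (qq powi d * (qq powi N * hwf N v) + - (qq powi (- d)) * (qq powi (- N) * hwf N v))"
      by (simp only: is_hwfD[OF is_hwf_hwf])
    also have "\<dots> = qn (N + d) * hwf N v"
      by (simp add: qn_def power_int_add power_int_diff power_int_minus divide_simps) (simp add: algebra_simps)
    finally show ?thesis .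
  qed
  then show ?case using Suc by (simp add: is_hwfD[OF is_hwf_hwf] mult.assoc algebra_simps)
qed (simp add: is_hwfD[OF is_hwf_hwf])

text \<open>Two invariants are carried together: Lusztig's form preserves families with integral
  coordinates, and among these the families whose coordinates vanish at q = \<zeta>. The second one
  makes the relation K^l = 1 compatible with the functionals.\<close>

lemma act_Lt:
  fixes \<zeta> :: "'k::field"
  assumes \<zeta>: "\<zeta> \<noteq> 0" and u: "u \<in> Lt"
  shows "(\<forall>i. \<phi> i \<in> Lau) \<longrightarrow> (\<forall>i. act N u \<phi> i \<in> Lau) \<and> ((\<forall>i. ev \<zeta> (\<phi> i) = 0) \<longrightarrow> (\<forall>i. ev \<zeta> (act N u \<phi> i) = 0))"
  using u
proof (induction arbitrary: \<phi> rule: Lt_induct)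
  case (add u v)
  then show ?case by (simp add: act_add ev_add Lau_add)
next
  case (mult u v)
  then show ?case by (simp add: act_mult)
next
  case (scal a u)
  then show ?case by (simp add: act_scal ev_mult \<zeta> Lau_mult)
qed (simp_all add: act_one act_gens act_Ed act_Fd gb_Lau ev_mult[OF \<zeta>] Lau_mult)


section \<open>The specialization\<close>

locale root_of_unity =
  fixes \<zeta> :: "'k::field_char_0" and l :: nat
  assumes l_gt_1: "l > 1" and odd_l: "odd l" and zeta_l: "\<zeta> ^ l = 1"
    and zeta_primitive: "\<And>m. 0 < m \<Longrightarrow> m < l \<Longrightarrow> \<zeta> ^ m \<noteq> 1"
begin

lemma zeta_neq_zero [simp]: "\<zeta> \<noteq> 0"
  using zeta_l l_gt_1 by (auto simp: zero_power)

lemma zeta_powi_l [simp]: "\<zeta> powi (int l * m) = 1"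
  by (simp add: power_int_mult zeta_l)

text \<open>Equality would give \<zeta>^(2s) = 1 with 0 < 2s < 2l. As l is odd, 2s is not l, and
  either 2s or 2s - l contradicts primitivity.\<close>

lemma zeta_diff_neq_zero:
  assumes "0 < s" "s < l"
  shows "\<zeta> powi int s - \<zeta> powi (- int s) \<noteq> 0"
proof
  assume "\<zeta> powi int s - \<zeta> powi (- int s) = 0"
  then have "\<zeta> ^ s = inverse (\<zeta> ^ s)" by (simp add: power_int_minus)
  then have e: "\<zeta> ^ (2 * s) = 1" by (simp add: mult_2 power_add) (metis right_inverse power_eq_0_iff zeta_neq_zero)
  consider "2 * s < l" | "2 * s > l" using odd_l by (metis dvd_triv_left linorder_neqE_nat)
  then show False
  proof cases
    case 1 then show False using e zeta_primitive[of "2 * s"] assms by simp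
  next
    case 2
    then have "\<zeta> ^ (2 * s) = \<zeta> ^ l * \<zeta> ^ (2 * s - l)" by (simp flip: power_add)
    then show False using e zeta_l zeta_primitive[of "2 * s - l"] assms 2 by simp
  qed
qed

abbreviation "L \<equiv> lusztig_form"
abbreviation "B \<equiv> extend_scalars (laurent_eval \<zeta>) lusztig_form"
abbreviation "Z \<equiv> Uz \<zeta> l"
abbreviation "T \<equiv> tensor (Uz \<zeta> l) (Uz \<zeta> l)"

sublocale L: algebra_over L by (rule lusztig_form_is_algebra)
sublocale B: algebra_over B by (rule extend_scalars_is_algebra[OF lusztig_form_is_algebra])

abbreviation "eK \<equiv> extend_scalars_map (laurent_eval \<zeta>) lusztig_form"

lemmas eK_simps = extend_scalars_map_closed[OF lusztig_form_is_algebra, of _ "laurent_eval \<zeta>"]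
  extend_scalars_map_mult[OF lusztig_form_is_algebra, of _ _ "laurent_eval \<zeta>"]
  extend_scalars_map_add[OF lusztig_form_is_algebra, of _ _ "laurent_eval \<zeta>"]
  extend_scalars_map_one[OF lusztig_form_is_algebra, of "laurent_eval \<zeta>"]
  extend_scalars_map_smult[OF lusztig_form_is_algebra, of _ "laurent_eval \<zeta>"]

lemma Lt_iff [simp]: "rep_u u \<in> carrier L \<longleftrightarrow> u \<in> Lt"
  by (simp add: Lt_def)

lemma carrier_L_cases:
  assumes "X \<in> carrier L" obtains u where "u \<in> Lt" "X = rep_u u"
proof -
  have "carrier L \<subseteq> carrier Uq"
    using algebra_over.subalg_gen_closed[OF restricted_Uq_is_algebra gens_L_closed]
    by (auto simp: carrier_lusztig_form restrict_scalars_def)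
  then have X: "rep_u (abs_u X) = X" using assms by (intro abs_u_inverse) blast
  show thesis
  proof (rule that)
    show "abs_u X \<in> Lt" using assms by (simp only: Lt_def X mem_Collect_eq)
    show "X = rep_u (abs_u X)" by (rule X[symmetric])
  qed
qed

lemma eK_power: "u \<in> Lt \<Longrightarrow> eK (rep_u u) [^]\<^bsub>B\<^esub> n = eK (rep_u (u ^ n))"
proof (induction n)
  case 0 show ?case using eK_simps(4) by (simp add: rep_u_simps lusztig_form_simps)
next
  case (Suc n)
  then show ?case using eK_simps(2)[of "rep_u (u ^ n)" "rep_u u"] Lt_power[of u n]
    by (simp add: rep_u_simps lusztig_form_simps power_Suc2 del: power_Suc)
qed

lemma uz_rels_eq: "uz_rels \<zeta> l = {eK (rep_u (uK ^ l)) \<ominus>\<^bsub>B\<^esub> \<one>\<^bsub>B\<^esub>}"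
  using eK_power[OF Lt_gens(1), of l] by (simp add: uz_rels_def Let_def rep_u_gens)

lemma uz_rels_closed: "uz_rels \<zeta> l \<subseteq> carrier B"
  unfolding uz_rels_eq using eK_simps(1)[of "rep_u (uK ^ l)"] Lt_power[OF Lt_gens(1), of l] by simp

sublocale Z: algebra_over Z
  unfolding Uz_def by (rule B.quot_alg_is_algebra[OF uz_rels_closed])

sublocale T: algebra_over T
  by (rule tensor_is_algebra[OF Z.algebra_over_axioms Z.algebra_over_axioms])

lemma Z_algebra: "algebra_over Z"
  by (rule Z.algebra_over_axioms)

definition sp :: "uqt \<Rightarrow> 'k uz" where
  "sp u = spec \<zeta> l (rep_u u)"

lemma sp_closed [simp]: "u \<in> Lt \<Longrightarrow> sp u \<in> carrier Z"
  unfolding sp_def spec_def Uz_def by (rule B.quot_map_closed[OF uz_rels_closed eK_simps(1)]) simp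

lemma sp_add: "u \<in> Lt \<Longrightarrow> v \<in> Lt \<Longrightarrow> sp (u + v) = sp u \<oplus>\<^bsub>Z\<^esub> sp v"
  and sp_mult: "u \<in> Lt \<Longrightarrow> v \<in> Lt \<Longrightarrow> sp (u * v) = sp u \<otimes>\<^bsub>Z\<^esub> sp v"
  and sp_one: "sp 1 = \<one>\<^bsub>Z\<^esub>"
  and sp_scal: "a \<in> Lau \<Longrightarrow> u \<in> Lt \<Longrightarrow> sp (a *\<^sub>q u) = ev \<zeta> a \<odot>\<^bsub>Z\<^esub> sp u"
proof -
  show "u \<in> Lt \<Longrightarrow> v \<in> Lt \<Longrightarrow> sp (u + v) = sp u \<oplus>\<^bsub>Z\<^esub> sp v"
    using eK_simps(3)[of "rep_u u" "rep_u v"] B.quot_map_add[OF uz_rels_closed eK_simps(1) eK_simps(1), of "rep_u u" "rep_u v"]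
    by (simp add: sp_def spec_def Uz_def rep_u_simps lusztig_form_simps)
  show "u \<in> Lt \<Longrightarrow> v \<in> Lt \<Longrightarrow> sp (u * v) = sp u \<otimes>\<^bsub>Z\<^esub> sp v"
    using eK_simps(2)[of "rep_u u" "rep_u v"] B.quot_map_mult[OF uz_rels_closed eK_simps(1) eK_simps(1), of "rep_u u" "rep_u v"]
    by (simp add: sp_def spec_def Uz_def rep_u_simps lusztig_form_simps)
  show "sp 1 = \<one>\<^bsub>Z\<^esub>"
    using eK_simps(4) B.quot_map_one[OF uz_rels_closed]
    by (simp add: sp_def spec_def Uz_def rep_u_simps lusztig_form_simps)
  assume "a \<in> Lau" and u: "u \<in> Lt"
  then obtain b where b: "a = laurent_eval qq b" unfolding Lau_def by blast
  show "sp (a *\<^sub>q u) = ev \<zeta> a \<odot>\<^bsub>Z\<^esub> sp u"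
    using eK_simps(5)[of "rep_u u" b] B.quot_map_smult[OF uz_rels_closed eK_simps(1), of "rep_u u" "laurent_eval \<zeta> b"] u
    by (simp add: sp_def spec_def Uz_def rep_u_simps lusztig_form_simps b)
qed

lemma sp_K_power: "sp (uK ^ l) = \<one>\<^bsub>Z\<^esub>"
proof -
  let ?k = "eK (rep_u (uK ^ l))"
  have k: "?k \<in> carrier B" using eK_simps(1)[of "rep_u (uK ^ l)"] Lt_power[OF Lt_gens(1), of l] by simp
  have "?k \<ominus>\<^bsub>B\<^esub> \<one>\<^bsub>B\<^esub> \<in> Idl\<^bsub>B\<^esub> (uz_rels \<zeta> l)"
    using B.genideal_self[OF uz_rels_closed] by (auto simp: uz_rels_eq)
  then have "quot_map B (uz_rels \<zeta> l) ?k = quot_map B (uz_rels \<zeta> l) \<one>\<^bsub>B\<^esub>"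
    using k by (subst B.quot_map_eq_iff[OF uz_rels_closed]) simp_all
  then show ?thesis using B.quot_map_one[OF uz_rels_closed] by (simp add: sp_def spec_def Uz_def)
qed

lemma Z_induct [consumes 1, case_names zero smult add]:
  assumes X: "X \<in> carrier Z"
    and zero: "P \<zero>\<^bsub>Z\<^esub>" and smult: "\<And>u c. u \<in> Lt \<Longrightarrow> P (c \<odot>\<^bsub>Z\<^esub> sp u)"
    and add: "\<And>X Y. X \<in> carrier Z \<Longrightarrow> Y \<in> carrier Z \<Longrightarrow> P X \<Longrightarrow> P Y \<Longrightarrow> P (X \<oplus>\<^bsub>Z\<^esub> Y)"
  shows "P X"
proof -
  let ?q = "quot_map B (uz_rels \<zeta> l)"
  have "P (?q Y)" if "Y \<in> carrier B" for Y
    using that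
  proof (induction rule: extend_scalars_induct[OF lusztig_form_is_algebra, consumes 1, case_names zero smult add])
    case zero
    then show ?case using assms(2) B.quot_map_zero[OF uz_rels_closed] by (simp add: Uz_def)
  next
    case (smult x c)
    then obtain u where u: "u \<in> Lt" "x = rep_u u" by (rule carrier_L_cases)
    have "c \<odot>\<^bsub>Z\<^esub> sp u = ?q (c \<odot>\<^bsub>B\<^esub> eK x)"
      using B.quot_map_smult[OF uz_rels_closed eK_simps(1)[OF smult], of c] by (simp add: sp_def spec_def Uz_def u)
    then show ?case using assms(3)[OF u(1), of c] by (simp only:)
  next
    case (add X Y)
    then show ?case using assms(4)[of "?q X" "?q Y"] B.quot_map_add[OF uz_rels_closed add.hyps] B.quot_map_closed[OF uz_rels_closed]
      by (simp add: Uz_def)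
  qed
  moreover obtain Y where "Y \<in> carrier B" "X = ?q Y"
    using X unfolding Uz_def B.quot_alg_carrier[OF uz_rels_closed] by blast
  ultimately show ?thesis by blast
qed

subsection \<open>Highest weight functionals of the specialization\<close>

definition fL :: "int \<Rightarrow> uq \<Rightarrow> 'k" where
  "fL N X = ev \<zeta> (hwf N (abs_u X))"

lemma hwf_Lau: "u \<in> Lt \<Longrightarrow> hwf N u \<in> Lau"
  using act_Lt[OF zeta_neq_zero, of u "\<lambda>i. if i = 0 then 1 else 0" N] by (simp add: hwf_def)

lemma fL_rep: "fL N (rep_u u) = ev \<zeta> (hwf N u)"
  by (simp add: fL_def rep_u_inverse)

lemma fL_semilin: "semilin (laurent_eval \<zeta>) L (fL N)"
  unfolding semilin_def
proof (intro conjI ballI allI)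
  fix X Y assume "X \<in> carrier L" "Y \<in> carrier L"
  then obtain u v where uv: "u \<in> Lt" "X = rep_u u" "v \<in> Lt" "Y = rep_u v" by (metis carrier_L_cases)
  then show "fL N (X \<oplus>\<^bsub>L\<^esub> Y) = fL N X + fL N Y"
    by (simp add: lusztig_form_simps fL_rep is_hwfD[OF is_hwf_hwf] ev_add hwf_Lau flip: rep_u_simps)
next
  fix a X assume "X \<in> carrier L"
  then obtain u where u: "u \<in> Lt" "X = rep_u u" by (rule carrier_L_cases)
  have "laurent_eval qq a \<in> Lau" by (simp add: Lau_def)
  then show "fL N (a \<odot>\<^bsub>L\<^esub> X) = laurent_eval \<zeta> a * fL N X" using u
    by (simp add: lusztig_form_simps fL_rep is_hwfD[OF is_hwf_hwf] ev_mult hwf_Lau flip: rep_u_simps)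
qed

definition fB :: "int \<Rightarrow> (uq \<Rightarrow>\<^sub>0 'k) set \<Rightarrow> 'k" where
  "fB N = extend_scalars_fun (fL N)"

lemma fB_lin: "lin B (fB N)" and fB_eK: "u \<in> Lt \<Longrightarrow> fB N (eK (rep_u u)) = ev \<zeta> (hwf N u)"
  using extend_scalars_fun_lin[OF lusztig_form_is_algebra fL_semilin, of N]
    extend_scalars_fun_map[OF lusztig_form_is_algebra fL_semilin, of "rep_u u" N]
  by (simp_all add: fB_def fL_rep)

text \<open>On coordinate i the element K^l acts by q^(l (N - 2i)), which specializes to 1. So
  \<open>uK ^ l - 1\<close> maps integral families to families vanishing at \<zeta>, and
  \<open>u\<close> preserves that property.\<close>

lemma hwf_vanish:
  assumes "u \<in> Lt" "v \<in> Lt"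
  shows "ev \<zeta> (hwf N (u * (uK ^ l - 1) * v)) = 0"
proof -
  define \<phi> where "\<phi> = act N v (\<lambda>i. if i = 0 then 1 else 0)"
  define \<psi> where "\<psi> = act N (uK ^ l - 1) \<phi>"
  have \<phi>: "\<phi> i \<in> Lau" for i using act_Lt[OF zeta_neq_zero assms(2), of "\<lambda>i. if i = 0 then 1 else 0" N] by (simp add: \<phi>_def)
  have K: "act N (uK ^ k) \<phi> i = qq powi (int k * (N - 2 * int i)) * \<phi> i" for k i
    by (induction k) (simp_all add: act_one act_mult act_gens distrib_right power_int_add)
  have d: "uK ^ l - 1 = uK ^ l + (- 1) *\<^sub>q 1" by (simp add: scal_minus_left)
  have \<psi>: "\<psi> i = qq powi (int l * (N - 2 * int i)) * \<phi> i - \<phi> i" for i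
    unfolding \<psi>_def d act_add act_scal act_one K by simp
  have "\<forall>i. \<psi> i \<in> Lau" unfolding \<psi> using \<phi> by (simp add: Lau_diff Lau_mult)
  moreover have "\<forall>i. ev \<zeta> (\<psi> i) = 0"
    unfolding \<psi> using \<phi> by (simp add: ev_diff ev_mult Lau_mult)
  ultimately have "ev \<zeta> (act N u \<psi> 0) = 0" using act_Lt[OF zeta_neq_zero assms(1), of \<psi> N] by simp
  then show ?thesis by (simp add: hwf_def act_mult \<psi>_def \<phi>_def)
qed

lemma fB_vanish:
  assumes y: "y \<in> carrier B" and z: "z \<in> carrier B" and s: "s \<in> uz_rels \<zeta> l"
  shows "fB N (y \<otimes>\<^bsub>B\<^esub> s \<otimes>\<^bsub>B\<^esub> z) = 0"
proof -
  have s_closed: "s \<in> carrier B" using s uz_rels_closed by blast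
  have Kl: "uK ^ l \<in> Lt" by (rule Lt_power[OF Lt_gens(1)])
  \<comment> \<open>The relation is written as the image of a single element of Lusztig's form, so
    that products with it can be computed before extending scalars.\<close>
  have seq: "s = eK (rep_u (uK ^ l - 1))"
  proof -
    have "s = eK (rep_u (uK ^ l)) \<ominus>\<^bsub>B\<^esub> \<one>\<^bsub>B\<^esub>" using s by (simp add: uz_rels_eq)
    moreover have "eK (rep_u (uK ^ l - 1)) \<oplus>\<^bsub>B\<^esub> \<one>\<^bsub>B\<^esub> = eK (rep_u (uK ^ l))"
      using eK_simps(3)[of "rep_u (uK ^ l - 1)" "rep_u 1"] eK_simps(4) Kl Lt_diff[OF Kl Lt_one]
      by (simp add: lusztig_form_simps flip: rep_u_simps)
    ultimately show ?thesis
      using eK_simps(1)[of "rep_u (uK ^ l - 1)"] Lt_diff[OF Kl Lt_one]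
      by (metis B.add.inv_solve_right B.minus_eq B.one_closed B.a_closed Lt_iff)
  qed
  have lin: "fB N (\<zero>\<^bsub>B\<^esub>) = 0" by (rule B.lin_zero[OF fB_lin])
  show ?thesis using y
  proof (induction rule: extend_scalars_induct[OF lusztig_form_is_algebra, consumes 1, case_names zero smult add])
    case zero
    then show ?case using z s_closed lin by simp
  next
    case (add X Y)
    then show ?case using z s_closed by (simp add: B.l_distr semilin_add[OF fB_lin])
  next
    case (smult x c)
    then obtain u where u: "u \<in> Lt" "x = rep_u u" by (rule carrier_L_cases)
    have eu: "eK x \<in> carrier B" using eK_simps(1)[OF smult] .
    have "fB N (eK x \<otimes>\<^bsub>B\<^esub> s \<otimes>\<^bsub>B\<^esub> z) = 0"
      using z
    proof (induction rule: extend_scalars_induct[OF lusztig_form_is_algebra, consumes 1, case_names zero smult add])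
      case zero
      then show ?case using eu s_closed lin by simp
    next
      case (add X Y)
      then show ?case using eu s_closed by (simp add: B.r_distr semilin_add[OF fB_lin])
    next
      case (smult x' c)
      then obtain v where v: "v \<in> Lt" "x' = rep_u v" by (rule carrier_L_cases)
      have ev: "eK x' \<in> carrier B" using eK_simps(1)[OF smult] .
      have m: "u * (uK ^ l - 1) \<in> Lt" using u Kl by (intro Lt_mult Lt_diff Lt_one)
      have "eK x \<otimes>\<^bsub>B\<^esub> s \<otimes>\<^bsub>B\<^esub> eK x' = eK (rep_u (u * (uK ^ l - 1) * v))"
        using eK_simps(2)[of "rep_u u" "rep_u (uK ^ l - 1)"] eK_simps(2)[of "rep_u (u * (uK ^ l - 1))" "rep_u v"]
          u v m Lt_diff[OF Kl Lt_one] by (simp add: seq lusztig_form_simps flip: rep_u_simps)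
      then have "fB N (eK x \<otimes>\<^bsub>B\<^esub> s \<otimes>\<^bsub>B\<^esub> eK x') = 0"
        using hwf_vanish[OF u(1) v(1)] fB_eK[of "u * (uK ^ l - 1) * v"] m v by (simp add: Lt_mult)
      then show ?case using eu ev s_closed by (simp add: B.smult_mult_r semilin_smult[OF fB_lin])
    qed
    then show ?case using eu s_closed z by (simp add: B.smult_mult_l semilin_smult[OF fB_lin])
  qed
qed

text \<open>The functional f_N on the specialization.\<close>

definition hz :: "int \<Rightarrow> 'k uz \<Rightarrow> 'k" where
  "hz N X = the_elem (fB N ` X)"

lemma hz_lin: "lin Z (hz N)" and hz_sp: "u \<in> Lt \<Longrightarrow> hz N (sp u) = ev \<zeta> (hwf N u)"
proof -
  have v: "y \<in> carrier B \<Longrightarrow> s \<in> uz_rels \<zeta> l \<Longrightarrow> z \<in> carrier B \<Longrightarrow> fB N (y \<otimes>\<^bsub>B\<^esub> s \<otimes>\<^bsub>B\<^esub> z) = 0" for y s z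
    by (rule fB_vanish)
  note q = B.quot_alg_functional[OF uz_rels_closed fB_lin]
  have "lin (quot_alg B (uz_rels \<zeta> l)) (\<lambda>X. the_elem (fB N ` X))" by (rule q(2)) (rule v)
  then show "lin Z (hz N)" by (simp add: Uz_def hz_def[abs_def])
  assume u: "u \<in> Lt"
  have "the_elem (fB N ` quot_map B (uz_rels \<zeta> l) (eK (rep_u u))) = fB N (eK (rep_u u))"
    by (rule q(1), erule (2) v) (use u eK_simps(1) in simp)
  then show "hz N (sp u) = ev \<zeta> (hwf N u)" using fB_eK[OF u] by (simp only: hz_def sp_def spec_def)
qed

end


subsection \<open>The comultiplication graph\<close>

context root_of_unity
begin

definition tz :: "int \<Rightarrow> int \<Rightarrow> ('k uz \<times> 'k uz \<Rightarrow>\<^sub>0 'k) set \<Rightarrow> 'k" where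
  "tz n m = tensor_fun (hz n) (hz m)"

lemma tz_lin: "lin T (tz n m)"
  and tz_tens: "x \<in> carrier Z \<Longrightarrow> y \<in> carrier Z \<Longrightarrow> tz n m (tens Z Z x y) = hz n x * hz m y"
  and tz_tens_sum: "set ps \<subseteq> carrier Z \<times> carrier Z \<Longrightarrow> tz n m (tens_sum Z Z ps) = (\<Sum>(x, y)\<leftarrow>ps. hz n x * hz m y)"
proof -
  note Z = Z_algebra Z_algebra hz_lin[of n] hz_lin[of m]
  show "lin T (tz n m)" unfolding tz_def by (rule tensor_fun_lin[OF Z])
  show "x \<in> carrier Z \<Longrightarrow> y \<in> carrier Z \<Longrightarrow> tz n m (tens Z Z x y) = hz n x * hz m y"
    unfolding tz_def by (rule tensor_fun_tens[OF Z])
  show "set ps \<subseteq> carrier Z \<times> carrier Z \<Longrightarrow> tz n m (tens_sum Z Z ps) = (\<Sum>(x, y)\<leftarrow>ps. hz n x * hz m y)"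
    unfolding tz_def by (rule tensor_fun_tens_sum[OF Z])
qed

lemma spec_pairs_closed:
  "set ps \<subseteq> carrier L \<times> carrier L \<Longrightarrow> set (map (map_prod (spec \<zeta> l) (spec \<zeta> l)) ps) \<subseteq> carrier Z \<times> carrier Z"
proof -
  assume ps: "set ps \<subseteq> carrier L \<times> carrier L"
  have "spec \<zeta> l x \<in> carrier Z" if "x \<in> carrier L" for x
    using that sp_closed by (metis carrier_L_cases sp_def)
  then have "map_prod (spec \<zeta> l) (spec \<zeta> l) p \<in> carrier Z \<times> carrier Z" if "p \<in> set ps" for p
    using that ps by (cases p) auto
  then show ?thesis unfolding set_map by (rule image_subsetI)
qed

text \<open>Without single-valuedness, every value of the relation at x still has the same image
  f_(n+m) x under f_n \<otimes> f_m. All later statements about the comultiplication rest on this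
  invariant.\<close>

lemma uz_comult_closed_tz:
  assumes "(x, t) \<in> uz_comult \<zeta> l"
  shows "x \<in> carrier Z \<and> t \<in> carrier T \<and> (\<forall>n m. tz n m t = hz (n + m) x)"
  using assms
proof induction
  case (base u ps)
  obtain v where v: "v \<in> Lt" "u = rep_u v" using base(1) by (rule carrier_L_cases)
  have sub: "X \<in> carrier L \<Longrightarrow> X \<in> carrier Uq" for X by (metis carrier_L_cases rep_u_closed)
  then have psU: "set ps \<subseteq> carrier Uq \<times> carrier Uq" using base(2) by blast
  note c = spec_pairs_closed[OF base(2)]
  have "tz n m (tens_sum Z Z (map (map_prod (spec \<zeta> l) (spec \<zeta> l)) ps)) = hz (n + m) (spec \<zeta> l u)" for n m
  proof -
    have "(\<Sum>(x, y)\<leftarrow>ps. hwf n (abs_u x) * hwf m (abs_u y)) \<in> Lau \<and>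
      ev \<zeta> (\<Sum>(x, y)\<leftarrow>ps. hwf n (abs_u x) * hwf m (abs_u y)) =
      (\<Sum>(x, y)\<leftarrow>map (map_prod (spec \<zeta> l) (spec \<zeta> l)) ps. hz n x * hz m y)"
      using base(2)
    proof (induction ps)
      case (Cons p ps)
      obtain a b where p: "p = (rep_u a, rep_u b)" "a \<in> Lt" "b \<in> Lt"
        using Cons.prems by (cases p) (auto elim!: carrier_L_cases)
      have "hz n (spec \<zeta> l (rep_u a)) = ev \<zeta> (hwf n a)" "hz m (spec \<zeta> l (rep_u b)) = ev \<zeta> (hwf m b)"
        using hz_sp p by (simp_all add: sp_def)
      then show ?case using Cons p
        by (simp add: rep_u_inverse ev_add ev_mult Lau_add Lau_mult hwf_Lau)
    qed simp
    moreover have "hz (n + m) (spec \<zeta> l u) = ev \<zeta> (hwf (n + m) v)" using hz_sp[OF v(1)] by (simp add: sp_def v)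
    moreover have "hwf (n + m) v = (\<Sum>(x, y)\<leftarrow>ps. hwf n (abs_u x) * hwf m (abs_u y))"
      using tensor_fun_comult[OF _ psU base(3), of n m] by (simp add: v rep_u_inverse)
    ultimately show ?thesis by (simp only: tz_tens_sum[OF c])
  qed
  moreover have "spec \<zeta> l u \<in> carrier Z" using sp_closed[OF v(1)] by (simp add: sp_def v)
  ultimately show ?case using tens_sum_closed[OF Z_algebra Z_algebra c] by blast
next
  case (add x t x' t')
  then show ?case by (simp add: semilin_add[OF tz_lin] semilin_add[OF hz_lin])
next
  case (smult x t c)
  then show ?case by (simp add: semilin_smult[OF tz_lin] semilin_smult[OF hz_lin])
qed

lemma spec_tens_pairs:
  assumes "set ps \<subseteq> carrier L \<times> carrier L" "set qs \<subseteq> carrier L \<times> carrier L"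
  shows "map (map_prod (spec \<zeta> l) (spec \<zeta> l)) (tens_pairs L L ps qs) =
    tens_pairs Z Z (map (map_prod (spec \<zeta> l) (spec \<zeta> l)) ps) (map (map_prod (spec \<zeta> l) (spec \<zeta> l)) qs)"
proof -
  have m: "spec \<zeta> l (x \<otimes>\<^bsub>L\<^esub> y) = spec \<zeta> l x \<otimes>\<^bsub>Z\<^esub> spec \<zeta> l y" if xy: "x \<in> carrier L" "y \<in> carrier L" for x y
  proof -
    obtain u where "u \<in> Lt" "x = rep_u u" using xy(1) by (rule carrier_L_cases)
    moreover obtain v where "v \<in> Lt" "y = rep_u v" using xy(2) by (rule carrier_L_cases)
    ultimately show ?thesis using sp_mult[of u v] by (simp add: sp_def lusztig_form_simps rep_u_simps)
  qed
  have "map (map_prod (spec \<zeta> l) (spec \<zeta> l)) (map (\<lambda>(x', y'). (x \<otimes>\<^bsub>L\<^esub> x', y \<otimes>\<^bsub>L\<^esub> y')) qs) =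
     map (\<lambda>(x', y'). (spec \<zeta> l x \<otimes>\<^bsub>Z\<^esub> x', spec \<zeta> l y \<otimes>\<^bsub>Z\<^esub> y')) (map (map_prod (spec \<zeta> l) (spec \<zeta> l)) qs)"
    if "x \<in> carrier L" "y \<in> carrier L" for x y
    using assms(2) that by (induction qs) (auto simp: m)
  then show ?thesis using assms(1)
    unfolding tens_pairs_def[OF L.algebra_over_axioms L.algebra_over_axioms] tens_pairs_def[OF Z_algebra Z_algebra]
    by (induction ps) (auto simp del: map_map)
qed

text \<open>The graph is generated by linear operations only. Compatibility with products comes from
  a double induction down to Lusztig's form, and is what allows one to argue on algebra
  generators.\<close>

lemma uz_comult_mult:
  assumes "(x, t) \<in> uz_comult \<zeta> l" "(x', t') \<in> uz_comult \<zeta> l"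
  shows "(x \<otimes>\<^bsub>Z\<^esub> x', t \<otimes>\<^bsub>T\<^esub> t') \<in> uz_comult \<zeta> l"
  using assms(1)
proof induction
  case (base u ps)
  let ?sp = "map_prod (spec \<zeta> l) (spec \<zeta> l)"
  note c = spec_pairs_closed[OF base(2)]
  have xb: "(spec \<zeta> l u, tens_sum Z Z (map ?sp ps)) \<in> uz_comult \<zeta> l" using base by (rule uz_comult.base)
  note cx = uz_comult_closed_tz[OF xb]
  have sub: "X \<in> carrier L \<Longrightarrow> X \<in> carrier Uq" for X by (metis carrier_L_cases rep_u_closed)
  show ?case using assms(2)
  proof induction
    case (base v qs)
    have "tens_pairs Uq Uq ps qs = tens_pairs L L ps qs"
      by (simp add: tens_pairs_def[OF L.algebra_over_axioms L.algebra_over_axioms] tens_pairs_def[OF Uq_is_algebra Uq_is_algebra] lusztig_form_simps)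
    moreover have "uq_comult (u \<otimes>\<^bsub>Uq\<^esub> v) = tens_sum Uq Uq (tens_pairs Uq Uq ps qs)"
      using alg_homD(4)[OF comult_hom sub sub] \<open>u \<in> carrier L\<close> base \<open>set ps \<subseteq> carrier L \<times> carrier L\<close> \<open>uq_comult u = tens_sum Uq Uq ps\<close>
      by (subst tens_sum_mult[OF Uq_is_algebra Uq_is_algebra]) (auto dest: sub)
    moreover have "set (tens_pairs L L ps qs) \<subseteq> carrier L \<times> carrier L"
      using \<open>set ps \<subseteq> carrier L \<times> carrier L\<close> base(2)
      by (intro set_tens_pairs[OF L.algebra_over_axioms L.algebra_over_axioms]) simp_all
    moreover have "u \<otimes>\<^bsub>Uq\<^esub> v \<in> carrier L"
      using L.m_closed[OF \<open>u \<in> carrier L\<close> base(1)] by (simp only: lusztig_form_simps)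
    ultimately have "(spec \<zeta> l (u \<otimes>\<^bsub>Uq\<^esub> v), tens_sum Z Z (map ?sp (tens_pairs L L ps qs))) \<in> uz_comult \<zeta> l"
      by (intro uz_comult.base) simp_all
    moreover have "spec \<zeta> l (u \<otimes>\<^bsub>Uq\<^esub> v) = spec \<zeta> l u \<otimes>\<^bsub>Z\<^esub> spec \<zeta> l v"
    proof -
      obtain u' where "u' \<in> Lt" "u = rep_u u'" using \<open>u \<in> carrier L\<close> by (rule carrier_L_cases)
      moreover obtain v' where "v' \<in> Lt" "v = rep_u v'" using base(1) by (rule carrier_L_cases)
      ultimately show ?thesis using sp_mult[of u' v'] by (simp add: sp_def rep_u_simps)
    qed
    ultimately show ?case
      unfolding spec_tens_pairs[OF \<open>set ps \<subseteq> carrier L \<times> carrier L\<close> base(2)]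
      by (simp only: tens_sum_mult[OF Z_algebra Z_algebra spec_pairs_closed[OF base(2)] c])
  next
    case (add y s y' s')
    then show ?case using uz_comult.add[OF add(3,4)] cx uz_comult_closed_tz[OF add(1)] uz_comult_closed_tz[OF add(2)]
      by (simp add: Z.r_distr T.r_distr)
  next
    case (smult y s d)
    then show ?case using uz_comult.smult[OF smult(2), of d] cx uz_comult_closed_tz[OF smult(1)]
      by (simp add: Z.smult_mult_r T.smult_mult_r)
  qed
next
  case (add y s y' s')
  then show ?case using uz_comult.add[OF add(3,4)] uz_comult_closed_tz[OF assms(2)] uz_comult_closed_tz[OF add(1)] uz_comult_closed_tz[OF add(2)]
    by (simp add: Z.l_distr T.l_distr)
next
  case (smult y s d)
  then show ?case using uz_comult.smult[OF smult(2), of d] uz_comult_closed_tz[OF assms(2)] uz_comult_closed_tz[OF smult(1)]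
    by (simp add: Z.smult_mult_l T.smult_mult_l)
qed

lemma uz_antipode_sp: "u \<in> Lt \<Longrightarrow> \<S> u \<in> Lt \<Longrightarrow> (sp u, sp (\<S> u)) \<in> uz_antipode \<zeta> l"
  using uz_antipode.base[of "rep_u u" \<zeta> l] by (simp add: sp_def flip: rep_u_antipode)

lemma uz_antipode_closed: "(x, y) \<in> uz_antipode \<zeta> l \<Longrightarrow> x \<in> carrier Z \<and> y \<in> carrier Z"
proof (induction rule: uz_antipode.induct)
  case (base u)
  have "spec \<zeta> l x \<in> carrier Z" if "x \<in> carrier L" for x
    using that sp_closed by (metis carrier_L_cases sp_def)
  with base show ?case by blast
qed simp_all

text \<open>The same double induction as for the comultiplication, with the factors reversed since
  the antipode is an anti-homomorphism.\<close>

lemma uz_antipode_mult: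
  assumes "(x, y) \<in> uz_antipode \<zeta> l" "(x', y') \<in> uz_antipode \<zeta> l"
  shows "(x \<otimes>\<^bsub>Z\<^esub> x', y' \<otimes>\<^bsub>Z\<^esub> y) \<in> uz_antipode \<zeta> l"
  using assms(1)
proof induction
  case (base u)
  obtain a where a: "a \<in> Lt" "u = rep_u a" using base(1) by (rule carrier_L_cases)
  have a': "\<S> a \<in> Lt" using base(2) by (simp add: a flip: rep_u_antipode)
  have xa: "(sp a, sp (\<S> a)) \<in> uz_antipode \<zeta> l" by (rule uz_antipode_sp[OF a(1) a'])
  have "(sp a \<otimes>\<^bsub>Z\<^esub> x', y' \<otimes>\<^bsub>Z\<^esub> sp (\<S> a)) \<in> uz_antipode \<zeta> l" using assms(2)
  proof induction
    case (base v)
    obtain b where b: "b \<in> Lt" "v = rep_u b" using base(1) by (rule carrier_L_cases)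
    have b': "\<S> b \<in> Lt" using base(2) by (simp add: b flip: rep_u_antipode)
    have "(sp (a * b), sp (\<S> (a * b))) \<in> uz_antipode \<zeta> l"
      using a a' b b' by (intro uz_antipode_sp) (simp_all add: antipode_mult Lt_mult)
    then show ?case using a a' b b'
      by (simp add: antipode_mult sp_mult) (simp add: sp_def rep_u_antipode)
  next
    case (add x1 y1 x2 y2)
    then show ?case using uz_antipode.add[OF add(3,4)] uz_antipode_closed[OF xa] uz_antipode_closed[OF add(1)] uz_antipode_closed[OF add(2)]
      by (simp add: Z.l_distr Z.r_distr)
  next
    case (smult x1 y1 d)
    then show ?case using uz_antipode.smult[OF smult(2), of d] uz_antipode_closed[OF xa] uz_antipode_closed[OF smult(1)]
      by (simp add: Z.smult_mult_l Z.smult_mult_r)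
  qed
  then show ?case by (simp add: sp_def a rep_u_antipode)
next
  case (add x1 y1 x2 y2)
  then show ?case using uz_antipode.add[OF add(3,4)] uz_antipode_closed[OF assms(2)] uz_antipode_closed[OF add(1)] uz_antipode_closed[OF add(2)]
    by (simp add: Z.l_distr Z.r_distr)
next
  case (smult x1 y1 d)
  then show ?case using uz_antipode.smult[OF smult(2), of d] uz_antipode_closed[OF assms(2)] uz_antipode_closed[OF smult(1)]
    by (simp add: Z.smult_mult_l Z.smult_mult_r)
qed

subsection \<open>The subalgebra generated by \<open>K\<close> and \<open>[K; 0 choose l]\<close>\<close>

text \<open>The candidate for the smallest Hopf subalgebra containing both generators: only the
  algebra operations are used to build it.\<close>

definition U0 :: "'k uz set" where
  "U0 = subalg_gen Z {sp uK, sp (kbin 0 l)}"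

lemma uz_K_eq: "uz_K \<zeta> l = sp uK" and uz_Kbinom_eq: "uz_Kbinom \<zeta> l = sp (kbin 0 l)"
  by (simp_all add: uz_K_def uz_Kbinom_def sp_def rep_u_gens rep_u_kbin)

lemma U0_gens_closed: "{sp uK, sp (kbin 0 l)} \<subseteq> carrier Z"
  by (simp add: Lt_gens kbin_Lt)

lemma U0_closed: "x \<in> U0 \<Longrightarrow> x \<in> carrier Z"
  unfolding U0_def by (rule Z.subalg_gen_closed[OF U0_gens_closed])

lemma U0_intros:
  "sp uK \<in> U0" "sp (kbin 0 l) \<in> U0" "\<one>\<^bsub>Z\<^esub> \<in> U0" "x \<in> U0 \<Longrightarrow> y \<in> U0 \<Longrightarrow> x \<oplus>\<^bsub>Z\<^esub> y \<in> U0"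
  "x \<in> U0 \<Longrightarrow> y \<in> U0 \<Longrightarrow> x \<otimes>\<^bsub>Z\<^esub> y \<in> U0" "x \<in> U0 \<Longrightarrow> c \<odot>\<^bsub>Z\<^esub> x \<in> U0"
  unfolding U0_def by (auto intro: subalg_gen.intros)

lemmas U0_induct = subalg_gen.induct[of _ Z "{sp uK, sp (kbin 0 l)}", folded U0_def, consumes 1, case_names gen one add mult smult]

text \<open>Collects the elements of Lusztig's form that specialize into \<open>U0\<close>, so that
  membership can be proved with identities for generic q.\<close>

definition Lt0 :: "uqt set" where
  "Lt0 = {u \<in> Lt. sp u \<in> U0}"

lemma Lt0_add: "u \<in> Lt0 \<Longrightarrow> v \<in> Lt0 \<Longrightarrow> u + v \<in> Lt0"
  and Lt0_mult: "u \<in> Lt0 \<Longrightarrow> v \<in> Lt0 \<Longrightarrow> u * v \<in> Lt0"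
  and Lt0_scal: "a \<in> Lau \<Longrightarrow> u \<in> Lt0 \<Longrightarrow> a *\<^sub>q u \<in> Lt0"
  and Lt0_one: "1 \<in> Lt0"
  and Lt0_K: "uK \<in> Lt0"
  unfolding Lt0_def by (auto simp: sp_add sp_mult sp_scal sp_one Lt_add Lt_mult Lt_scal Lt_gens intro: U0_intros)

lemma Lt0_power: "u \<in> Lt0 \<Longrightarrow> u ^ n \<in> Lt0"
  by (induction n) (simp_all add: Lt0_mult Lt0_one)

text \<open>Since K^l specializes to 1, the inverse of K and K^(l-1) have the same
  specialization.\<close>

lemma Lt0_Ki: "uKi \<in> Lt0"
proof -
  have "uKi * uK ^ l = uK ^ (l - 1)" using l_gt_1 by (cases l) simp_all
  then have "sp (uK ^ (l - 1)) = sp uKi \<otimes>\<^bsub>Z\<^esub> sp (uK ^ l)"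
    using sp_mult[of uKi "uK ^ l"] by (simp add: Lt_gens Lt_power)
  then have "sp (uK ^ (l - 1)) = sp uKi" by (simp add: sp_K_power Lt_gens)
  then show ?thesis using Lt0_power[OF Lt0_K, of "l - 1"] by (simp add: Lt0_def Lt_gens)
qed

lemma Lt0_diff: "u \<in> Lt0 \<Longrightarrow> v \<in> Lt0 \<Longrightarrow> u - v \<in> Lt0"
  using Lt0_add[of u "(- 1) *\<^sub>q v"] Lt0_scal[of "- 1" v] Lau_minus[OF Lau_1] by (simp add: scal_minus_left)

text \<open>Below l all denominators stay invertible at \<zeta>, so the specialized binomial is a
  polynomial in K and K^-1.\<close>

lemma kbin_Lt0_less: "t < l \<Longrightarrow> kbin c t \<in> Lt0"
proof (induction t)
  case (Suc t)
  \<comment> \<open>This is [t+1] (q - q^-1): it clears the denominator of the binomial and that of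
    the bracket simultaneously.\<close>
  let ?a = "qq powi (int t + 1) - qq powi (- (int t + 1))"
  have "(?a *\<^sub>q kbin c (Suc t)) = ((qq powi (c - int t)) *\<^sub>q uK - (qq powi (- (c - int t))) *\<^sub>q uKi) * kbin c t"
    using qn_neq_zero[of "int t + 1"] by (simp add: br_def qn_def)
  also have "\<dots> \<in> Lt0" using Suc by (intro Lt0_mult Lt0_diff Lt0_scal Lau_powi Lt0_K Lt0_Ki) simp
  finally have "sp (?a *\<^sub>q kbin c (Suc t)) \<in> U0" by (simp add: Lt0_def)
  moreover have "sp (?a *\<^sub>q kbin c (Suc t)) = ev \<zeta> ?a \<odot>\<^bsub>Z\<^esub> sp (kbin c (Suc t))"
    by (rule sp_scal) (auto intro: Lau_diff Lau_powi kbin_Lt simp del: kbin.simps)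
  moreover have "ev \<zeta> ?a = \<zeta> powi int (Suc t) - \<zeta> powi (- int (Suc t))"
    by (subst ev_diff) (auto simp: add.commute)
  ultimately have "(\<zeta> powi int (Suc t) - \<zeta> powi (- int (Suc t))) \<odot>\<^bsub>Z\<^esub> sp (kbin c (Suc t)) \<in> U0" by simp
  from U0_intros(6)[OF this, of "inverse (\<zeta> powi int (Suc t) - \<zeta> powi (- int (Suc t)))"]
  have "sp (kbin c (Suc t)) \<in> U0"
    using zeta_diff_neq_zero[of "Suc t"] Suc.prems kbin_Lt[of c "Suc t"]
    by (simp del: kbin.simps of_nat_Suc flip: Z.smult_assoc)
  then show ?case by (simp add: Lt0_def kbin_Lt del: kbin.simps)
qed (simp add: Lt0_one)

text \<open>At lower index l the division fails, as \<zeta>^l - \<zeta>^-l = 0. Starting from the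
  generator with c = 0, Pascal's rule raises c using only binomials of index l - 1. The antipode
  needs the case c = l - 1.\<close>

lemma kbin_Lt0: "kbin (int c) l \<in> Lt0"
proof (induction c)
  case 0 show ?case by (simp add: Lt0_def kbin_Lt U0_intros)
next
  case (Suc c)
  obtain s where s: "l = Suc s" using l_gt_1 by (cases l) auto
  have e: "kbin (int (Suc c)) l = (qq powi (int s + 1)) *\<^sub>q kbin (int c) l + (qq powi (int s - int c)) *\<^sub>q (uKi * kbin (int c) s)"
    using kbin_pascal[of "int c" s] by (simp add: s add.commute del: kbin.simps)
  show ?case unfolding e
    by (intro Lt0_add Lt0_scal Lt0_mult Lt0_Ki Lau_powi Suc kbin_Lt0_less) (simp add: s)
qed

section \<open>Stability of \<open>U0\<close> under comultiplication and antipode\<close>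

lemma uz_comult_tn:
  assumes u: "u \<in> Lt" and A: "\<And>t. t \<in> set ts \<Longrightarrow> a t \<in> Lt0" "\<And>t. t \<in> set ts \<Longrightarrow> b t \<in> Lt0"
    and e: "\<Delta> u = (\<Sum>t\<leftarrow>ts. tn (a t) (b t))"
  shows "\<exists>t\<in>uz_tensor_square \<zeta> l U0. (sp u, t) \<in> uz_comult \<zeta> l"
proof -
  let ?ps = "map (\<lambda>t. (rep_u (a t), rep_u (b t))) ts"
  have "rep_t (\<Sum>t\<leftarrow>ts. tn (a t) (b t)) = tens_sum Uq Uq (map (\<lambda>t. (rep_u (a t), rep_u (b t))) ts)" for ts
    by (induction ts)
      (simp_all add: rep_t_simps rep_t_tn tens_sum_Nil[OF Uq_is_algebra Uq_is_algebra] tens_sum_Cons[OF Uq_is_algebra Uq_is_algebra])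
  then have p1: "uq_comult (rep_u u) = tens_sum Uq Uq ?ps" unfolding rep_t_Delta[symmetric] e .
  have p: "a t \<in> Lt" "b t \<in> Lt" "sp (a t) \<in> U0" "sp (b t) \<in> U0" if "t \<in> set ts" for t
    using A[OF that] by (simp_all add: Lt0_def)
  have p2: "set ?ps \<subseteq> carrier L \<times> carrier L" by (simp add: image_subset_iff p)
  have "(sp u, tens_sum Z Z (map (map_prod (spec \<zeta> l) (spec \<zeta> l)) ?ps)) \<in> uz_comult \<zeta> l"
    unfolding sp_def by (rule uz_comult.base[OF _ p2 p1]) (simp add: u)
  moreover have "set (map (map_prod (spec \<zeta> l) (spec \<zeta> l)) ?ps) \<subseteq> U0 \<times> U0"
    using p(3,4) by (simp add: image_subset_iff sp_def)
  ultimately show ?thesis unfolding uz_tensor_square_def by blast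
qed

lemma tensor_square_closed: "t \<in> uz_tensor_square \<zeta> l U0 \<Longrightarrow> t \<in> carrier T"
proof -
  assume "t \<in> uz_tensor_square \<zeta> l U0"
  then obtain ps where ps: "t = tens_sum Z Z ps" "set ps \<subseteq> U0 \<times> U0" unfolding uz_tensor_square_def by blast
  then have "set ps \<subseteq> carrier Z \<times> carrier Z" using U0_closed by blast
  then show "t \<in> carrier T" unfolding ps by (rule tens_sum_closed[OF Z_algebra Z_algebra])
qed

lemma tensor_square_add:
  "s \<in> uz_tensor_square \<zeta> l U0 \<Longrightarrow> t \<in> uz_tensor_square \<zeta> l U0 \<Longrightarrow> s \<oplus>\<^bsub>T\<^esub> t \<in> uz_tensor_square \<zeta> l U0"
proof -
  assume "s \<in> uz_tensor_square \<zeta> l U0" "t \<in> uz_tensor_square \<zeta> l U0"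
  then obtain ps qs where pq: "s = tens_sum Z Z ps" "set ps \<subseteq> U0 \<times> U0" "t = tens_sum Z Z qs" "set qs \<subseteq> U0 \<times> U0"
    unfolding uz_tensor_square_def by blast
  then have "set ps \<subseteq> carrier Z \<times> carrier Z" "set qs \<subseteq> carrier Z \<times> carrier Z" using U0_closed by auto
  then have "s \<oplus>\<^bsub>T\<^esub> t = tens_sum Z Z (ps @ qs)" using pq by (simp add: tens_sum_append[OF Z_algebra Z_algebra])
  moreover have "set (ps @ qs) \<subseteq> U0 \<times> U0" using pq by simp
  ultimately show ?thesis unfolding uz_tensor_square_def by blast
qed

lemma tensor_square_mult:
  "s \<in> uz_tensor_square \<zeta> l U0 \<Longrightarrow> t \<in> uz_tensor_square \<zeta> l U0 \<Longrightarrow> s \<otimes>\<^bsub>T\<^esub> t \<in> uz_tensor_square \<zeta> l U0"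
proof -
  assume "s \<in> uz_tensor_square \<zeta> l U0" "t \<in> uz_tensor_square \<zeta> l U0"
  then obtain ps qs where pq: "s = tens_sum Z Z ps" "set ps \<subseteq> U0 \<times> U0" "t = tens_sum Z Z qs" "set qs \<subseteq> U0 \<times> U0"
    unfolding uz_tensor_square_def by blast
  then have "set ps \<subseteq> carrier Z \<times> carrier Z" "set qs \<subseteq> carrier Z \<times> carrier Z" using U0_closed by auto
  then have "s \<otimes>\<^bsub>T\<^esub> t = tens_sum Z Z (tens_pairs Z Z ps qs)" using pq by (simp add: tens_sum_mult[OF Z_algebra Z_algebra])
  moreover have "set (tens_pairs Z Z ps qs) \<subseteq> U0 \<times> U0"
    using pq U0_intros(5) by (intro set_tens_pairs[OF Z_algebra Z_algebra])
  ultimately show ?thesis unfolding uz_tensor_square_def by blast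
qed

lemma tensor_square_smult:
  "s \<in> uz_tensor_square \<zeta> l U0 \<Longrightarrow> c \<odot>\<^bsub>T\<^esub> s \<in> uz_tensor_square \<zeta> l U0"
proof -
  assume "s \<in> uz_tensor_square \<zeta> l U0"
  then obtain ps where pq: "s = tens_sum Z Z ps" "set ps \<subseteq> U0 \<times> U0"
    unfolding uz_tensor_square_def by blast
  then have "set ps \<subseteq> carrier Z \<times> carrier Z" using U0_closed by auto
  then have "c \<odot>\<^bsub>T\<^esub> s = tens_sum Z Z (map (\<lambda>(x, y). (c \<odot>\<^bsub>Z\<^esub> x, y)) ps)" using pq by (simp add: tens_sum_smult[OF Z_algebra Z_algebra])
  moreover have "set (map (\<lambda>(x, y). (c \<odot>\<^bsub>Z\<^esub> x, y)) ps) \<subseteq> U0 \<times> U0" using pq U0_intros(6) by auto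
  ultimately show ?thesis unfolding uz_tensor_square_def by blast
qed

lemma U0_comult:
  assumes "x \<in> U0" shows "\<exists>t\<in>uz_tensor_square \<zeta> l U0. (x, t) \<in> uz_comult \<zeta> l"
  using assms
proof (induction rule: U0_induct)
  case (gen x)
  then consider "x = sp uK" | "x = sp (kbin 0 l)" by blast
  then show ?case
  proof cases
    case 1
    then show ?thesis
      using uz_comult_tn[of uK "[()]" "\<lambda>_. uK" "\<lambda>_. uK"] by (simp add: Lt_gens Lt0_K Delta_gens)
  next
    case 2
    have D: "\<Delta> (kbin 0 l) = (\<Sum>t\<leftarrow>[0..<Suc l]. tn (kbin 0 t * uKi ^ (l - t)) (kbin 0 (l - t) * uK ^ t))"
      unfolding Delta_kbin
      by (simp add: interv_sum_list_conv_sum_set_nat atLeast0LessThan lessThan_Suc_atMost del: upt_Suc sum.lessThan_Suc)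
    \<comment> \<open>Index l, which occurs at the two ends of the sum, is the adjoined generator;
      smaller indices are polynomials in K and K^-1.\<close>
    have k: "kbin 0 t \<in> Lt0" if "t \<le> l" for t
    proof (cases "t = l")
      case True then show ?thesis using kbin_Lt0[of 0] by (simp only: of_nat_0)
    next
      case False then show ?thesis using that by (intro kbin_Lt0_less) simp
    qed
    show ?thesis unfolding 2
    proof (rule uz_comult_tn[OF kbin_Lt _ _ D])
      fix t assume "t \<in> set [0..<Suc l]"
      then have "t \<le> l" by auto
      then show "kbin 0 t * uKi ^ (l - t) \<in> Lt0" "kbin 0 (l - t) * uK ^ t \<in> Lt0"
        by (intro Lt0_mult Lt0_power Lt0_K Lt0_Ki k; simp)+
    qed
  qed
next
  case one
  have "\<Delta> 1 = (\<Sum>t\<leftarrow>[()]. tn 1 1)" by (simp add: Delta_one tn_one)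
  from uz_comult_tn[OF Lt_one Lt0_one Lt0_one this] show ?case unfolding sp_one .
next
  case (add x y)
  then obtain s t where "s \<in> uz_tensor_square \<zeta> l U0" "(x, s) \<in> uz_comult \<zeta> l" "t \<in> uz_tensor_square \<zeta> l U0" "(y, t) \<in> uz_comult \<zeta> l"
    by blast
  then show ?case using tensor_square_add[of s t] uz_comult.add[of x s \<zeta> l y t] by blast
next
  case (mult x y)
  then obtain s t where "s \<in> uz_tensor_square \<zeta> l U0" "(x, s) \<in> uz_comult \<zeta> l" "t \<in> uz_tensor_square \<zeta> l U0" "(y, t) \<in> uz_comult \<zeta> l"
    by blast
  then show ?case using tensor_square_mult[of s t] uz_comult_mult[of x s y t] by blast
next
  case (smult x r)
  then obtain s where "s \<in> uz_tensor_square \<zeta> l U0" "(x, s) \<in> uz_comult \<zeta> l" by blast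
  then show ?case using tensor_square_smult[of s r] uz_comult.smult[of x s \<zeta> l r] by blast
qed

lemma U0_antipode:
  assumes "x \<in> U0" shows "\<exists>y\<in>U0. (x, y) \<in> uz_antipode \<zeta> l"
  using assms
proof (induction rule: U0_induct)
  case (gen x)
  have u: "\<exists>y\<in>U0. (sp u, y) \<in> uz_antipode \<zeta> l" if "u \<in> Lt" "\<S> u \<in> Lt0" for u
    using that uz_antipode_sp[of u] unfolding Lt0_def by blast
  have "(- 1) ^ l *\<^sub>q kbin (int l - 1) l \<in> Lt0"
  proof (rule Lt0_scal)
    show "(- 1) ^ l \<in> Lau" using odd_l by (simp add: Lau_minus)
    show "kbin (int l - 1) l \<in> Lt0" using kbin_Lt0[of "l - 1"] l_gt_1 by (simp add: of_nat_diff)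
  qed
  then have "\<exists>y\<in>U0. (sp (kbin 0 l), y) \<in> uz_antipode \<zeta> l"
    by (intro u kbin_Lt) (simp only: antipode_kbin)
  moreover have "\<exists>y\<in>U0. (sp uK, y) \<in> uz_antipode \<zeta> l"
    by (intro u Lt_gens) (simp only: antipode_K Lt0_Ki)
  ultimately show ?case using gen by blast
next
  case one
  show ?case using uz_antipode_sp[of 1] U0_intros(3) by (auto simp: antipode_one sp_one)
next
  case (add x y)
  then show ?case using U0_intros(4) uz_antipode.add by blast
next
  case (mult x y)
  then show ?case using U0_intros(5) uz_antipode_mult by blast
next
  case (smult x r)
  then show ?case using U0_intros(6) uz_antipode.smult by blast
qed

lemma hopf_subalgebra_U0: "hopf_subalgebra \<zeta> l U0"
  unfolding hopf_subalgebra_def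
proof (intro conjI ballI allI)
  show "U0 \<subseteq> carrier Z" using U0_closed by blast
qed (simp_all add: U0_comult U0_antipode U0_intros)

text \<open>\<open>U0\<close> is itself a member of the family being intersected, and every member,
  being a subalgebra with the two generators, contains it.\<close>

lemma carrier_Uz0: "carrier (Uz0 \<zeta> l) = U0"
proof
  show "carrier (Uz0 \<zeta> l) \<subseteq> U0"
    using hopf_subalgebra_U0 U0_intros(1,2) by (auto simp: Uz0_def uz_K_eq uz_Kbinom_eq)
  have "x \<in> C" if C: "hopf_subalgebra \<zeta> l C" "sp uK \<in> C" "sp (kbin 0 l) \<in> C" and x: "x \<in> U0" for x C
    using x
  proof (induction rule: U0_induct)
    case (gen x) then show ?case using C(2,3) by blast
  qed (use C(1) in \<open>simp_all add: hopf_subalgebra_def\<close>)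
  then show "U0 \<subseteq> carrier (Uz0 \<zeta> l)" by (auto simp: Uz0_def uz_K_eq uz_Kbinom_eq)
qed

end


lemma (in algebra_over) lin_finsum:
  assumes f: "lin M f" and g: "g \<in> A \<rightarrow> carrier M"
  shows "f (\<Oplus>i\<in>A. g i) = (\<Sum>i\<in>A. f (g i))"
  using g
proof (induction A rule: infinite_finite_induct)
  case (insert x A)
  then show ?case by (simp add: finsum_insert Pi_iff semilin_add[OF f])
qed (simp_all add: lin_zero[OF f] finsum_infinite)

lemma (in algebra_over) eq_if_minus_zero:
  "x \<in> carrier M \<Longrightarrow> y \<in> carrier M \<Longrightarrow> x \<ominus> y = \<zero> \<Longrightarrow> x = y"
  by (metis minus_eq minus_equality minus_minus a_inv_closed)

context root_of_unity
begin

subsection \<open>Gaussian binomials at the root of unity\<close>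

lemma zeta_powi_eq_1_iff: "\<zeta> powi d = 1 \<longleftrightarrow> int l dvd d"
proof -
  define r where "r = nat (d mod int l)"
  have r: "r < l" "d = int l * (d div int l) + int r" using l_gt_1 by (simp_all add: r_def nat_less_iff)
  have "\<zeta> powi d = \<zeta> ^ r" by (subst r(2)) (simp add: power_int_add)
  moreover have "\<zeta> ^ r = 1 \<longleftrightarrow> r = 0" using zeta_primitive[of r] r(1) by auto
  moreover have "r = 0 \<longleftrightarrow> int l dvd d" using l_gt_1 by (auto simp: r_def dvd_eq_mod_eq_0)
      (metis mod_0_imp_dvd nat_0_iff order_antisym pos_mod_sign r_def r(1) of_nat_0_less_iff gr_implies_not0 neq0_conv)
  ultimately show ?thesis by simp
qed

lemma zeta_sum: "(\<Sum>i<l. \<zeta> powi (int i * d)) = (if int l dvd d then of_nat l else 0)"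
proof -
  have e: "\<zeta> powi (int i * d) = (\<zeta> powi d) ^ i" for i by (simp add: power_int_mult mult.commute)
  have "(\<zeta> powi d) ^ l = 1" using zeta_powi_l[of d] by (simp add: e[symmetric])
  then show ?thesis using zeta_powi_eq_1_iff[of d]
    by (auto simp: e sum_gp_strict)
qed

definition gz :: "int \<Rightarrow> nat \<Rightarrow> 'k" where
  "gz n t = ev \<zeta> (gb n t)"

lemma gz_0 [simp]: "gz n 0 = 1"
  by (simp add: gz_def)

lemma gz_pascal: "gz (n + 1) (Suc t) = \<zeta> powi (int t + 1) * gz n (Suc t) + \<zeta> powi (int t - n) * gz n t"
  unfolding gz_def gb_pascal
  by (simp add: ev_add ev_mult Lau_mult gb_Lau del: gb.simps)

text \<open>The recursion for Gaussian binomials in division-free form: at t + 1 = l the coefficient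
  on the left vanishes at \<zeta>.\<close>

lemma gz_Suc: "(\<zeta> powi (int t + 1) - \<zeta> powi (- (int t + 1))) * gz n (Suc t) = (\<zeta> powi (n - int t) - \<zeta> powi (- (n - int t))) * gz n t"
proof -
  have "(qq powi (int t + 1) - qq powi (- (int t + 1))) * gb n (Suc t) = (qq powi (n - int t) - qq powi (- (n - int t))) * gb n t"
    using qn_neq_zero[of "int t + 1"] by (simp add: qn_def)
  then have "ev \<zeta> ((qq powi (int t + 1) - qq powi (- (int t + 1))) * gb n (Suc t)) = ev \<zeta> ((qq powi (n - int t) - qq powi (- (n - int t))) * gb n t)"
    by (simp only:)
  then show ?thesis
    by (simp only: gz_def ev_mult[OF zeta_neq_zero] ev_diff Lau_diff Lau_powi gb_Lau ev_powi)
qed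

text \<open>If n is -1 modulo l, each factor [n - t] / [t + 1] specializes to -1, and l - 1 is even.
  Otherwise one of the factors is 0.\<close>

lemma gz_pred_l: "gz n (l - 1) = (if int l dvd n + 1 then 1 else 0)"
proof (cases "int l dvd n + 1")
  case True
  have "gz n t = (- 1) ^ t" if "t < l" for t
    using that
  proof (induction t)
    case (Suc t)
    let ?z = "\<zeta> powi (int t + 1) - \<zeta> powi (- (int t + 1))"
    have z: "?z \<noteq> 0" using zeta_diff_neq_zero[of "Suc t"] Suc.prems by (simp add: add.commute)
    have "\<zeta> powi (n + 1) = 1" "\<zeta> powi (- (n + 1)) = 1" using True zeta_powi_eq_1_iff[of "n + 1"] zeta_powi_eq_1_iff[of "- (n + 1)"] by (simp_all only: dvd_minus_iff)
    moreover have "n - int t = (n + 1) + - (int t + 1)" "- (n - int t) = - (n + 1) + (int t + 1)" by simp_all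
    ultimately have "\<zeta> powi (n - int t) = \<zeta> powi (- (int t + 1))" "\<zeta> powi (- (n - int t)) = \<zeta> powi (int t + 1)"
      by (simp_all only: power_int_add[OF disjI1[OF zeta_neq_zero]] mult_1_left)
    then have "?z * gz n (Suc t) = ?z * (- gz n t)" unfolding gz_Suc by (simp add: algebra_simps)
    then have "gz n (Suc t) = - gz n t" using z mult_left_cancel by blast
    then show ?case using Suc by simp
  qed simp
  from this[of "l - 1"] show ?thesis using True odd_l l_gt_1 by simp
next
  case False
  \<comment> \<open>The numerator [n - r] vanishes at \<zeta>. As r < l - 1, this factor occurs
    before index l - 1 is reached, and the remaining denominators are invertible, so the value stays
    0.\<close>
  define r where "r = nat (n mod int l)"
  have r: "int r = n mod int l" "r < l" using l_gt_1 by (simp_all add: r_def nat_less_iff)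
  have "r \<noteq> l - 1"
  proof
    assume "r = l - 1"
    then have "n mod int l = int l - 1" using r(1) l_gt_1 by (simp add: of_nat_diff)
    then have "n + 1 = int l * (n div int l) + int l"
      using mult_div_mod_eq[of "int l" n] by linarith
    then show False using False by simp
  qed
  then have r': "r < l - 1" using r by simp
  have "int l dvd n - int r" by (simp add: r(1) minus_mod_eq_mult_div)
  then have "\<zeta> powi (n - int r) = 1" "\<zeta> powi (- (n - int r)) = 1"
    using zeta_powi_eq_1_iff[of "n - int r"] zeta_powi_eq_1_iff[of "- (n - int r)"] by (simp_all only: dvd_minus_iff)
  then have base: "gz n (Suc r) = 0"
    using gz_Suc[of r n] zeta_diff_neq_zero[of "Suc r"] r' by (simp add: add.commute)
  have "gz n (Suc r + k) = 0" if "Suc r + k < l" for k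
    using that
  proof (induction k)
    case (Suc k)
    then show ?case using gz_Suc[of "Suc r + k" n] zeta_diff_neq_zero[of "Suc (Suc r + k)"] by (simp add: add.commute add.left_commute)
  qed (simp add: base)
  moreover have "Suc r + (l - 1 - Suc r) = l - 1" using r' by simp
  ultimately have "gz n (l - 1) = 0" using l_gt_1 by (metis diff_less less_imp_Suc_add zero_less_one zero_less_Suc)
  then show ?thesis using False by simp
qed

text \<open>A case of the q-analogue of Lucas' theorem. In Pascal's rule the increment from n to n +
  1 is a power of \<zeta> times \<open>gz n (l - 1)\<close>; it is 1 when l divides n + 1 and 0
  otherwise, just as for n div l.\<close>

lemma gz_l: "gz (int n) l = of_nat (n div l)"
proof (induction n)
  case 0
  obtain s where "l = Suc s" using l_gt_1 by (cases l) auto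
  then show ?case using gb_Suc_shift[of "- 1" s] by (simp add: gz_def del: gb.simps)
next
  case (Suc n)
  obtain s where s: "l = Suc s" using l_gt_1 by (cases l) auto
  have "gz (int n + 1) l = \<zeta> powi int l * gz (int n) l + \<zeta> powi (int l + - (int n + 1)) * gz (int n) (l - 1)"
    using gz_pascal[of "int n" s] by (simp add: s algebra_simps)
  also have "\<zeta> powi int l = 1" using zeta_l by simp
  also have "\<zeta> powi (int l + - (int n + 1)) * gz (int n) (l - 1) = (if l dvd Suc n then 1 else 0)"
  proof -
    have "int l dvd int n + 1 \<longleftrightarrow> l dvd Suc n" using int_dvd_int_iff[of l "Suc n"] by (simp add: add.commute)
    moreover have "\<zeta> powi (int l + - (int n + 1)) = 1" if "l dvd Suc n"
    proof -
      have "int l dvd int n + 1" using that int_dvd_int_iff[of l "Suc n"] by (simp add: add.commute)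
      then show ?thesis unfolding zeta_powi_eq_1_iff by (intro dvd_add dvd_refl) (simp only: dvd_minus_iff)
    qed
    ultimately show ?thesis unfolding gz_pred_l by simp
  qed
  finally show ?case using Suc by (simp add: div_Suc dvd_eq_mod_eq_0 add.commute)
qed

subsection \<open>The primitive element\<close>

lemma hz_K: "y \<in> carrier Z \<Longrightarrow> hz N (sp uK \<otimes>\<^bsub>Z\<^esub> y) = \<zeta> powi N * hz N y"
  and hz_b: "y \<in> carrier Z \<Longrightarrow> hz N (sp (kbin 0 l) \<otimes>\<^bsub>Z\<^esub> y) = gz N l * hz N y"
proof -
  have K: "hz N (sp uK \<otimes>\<^bsub>Z\<^esub> sp u) = \<zeta> powi N * hz N (sp u)" "hz N (sp (kbin 0 l) \<otimes>\<^bsub>Z\<^esub> sp u) = gz N l * hz N (sp u)" if u: "u \<in> Lt" for u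
  proof -
    have "hz N (sp uK \<otimes>\<^bsub>Z\<^esub> sp u) = ev \<zeta> (hwf N (uK * u))" using u by (simp add: hz_sp Lt_mult Lt_gens flip: sp_mult)
    then show "hz N (sp uK \<otimes>\<^bsub>Z\<^esub> sp u) = \<zeta> powi N * hz N (sp u)" using u by (simp add: is_hwfD[OF is_hwf_hwf] ev_mult hwf_Lau hz_sp)
    have "hz N (sp (kbin 0 l) \<otimes>\<^bsub>Z\<^esub> sp u) = ev \<zeta> (hwf N (kbin 0 l * u))" using u by (simp add: hz_sp Lt_mult kbin_Lt flip: sp_mult)
    then show "hz N (sp (kbin 0 l) \<otimes>\<^bsub>Z\<^esub> sp u) = gz N l * hz N (sp u)" using u by (simp add: hwf_kbin ev_mult hwf_Lau hz_sp gb_Lau gz_def)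
  qed
  have c: "sp uK \<in> carrier Z" "sp (kbin 0 l) \<in> carrier Z" by (simp_all add: Lt_gens kbin_Lt)
  assume "y \<in> carrier Z"
  then have "hz N (sp uK \<otimes>\<^bsub>Z\<^esub> y) = \<zeta> powi N * hz N y \<and> hz N (sp (kbin 0 l) \<otimes>\<^bsub>Z\<^esub> y) = gz N l * hz N y"
  proof (induction rule: Z_induct)
    case zero then show ?case using c by (simp add: Z.lin_zero[OF hz_lin])
  next
    case (smult u a) then show ?case using c by (simp add: Z.smult_mult_r semilin_smult[OF hz_lin] K)
  next
    case (add X Y) then show ?case using c by (simp add: Z.r_distr semilin_add[OF hz_lin] distrib_left)
  qed
  then show "hz N (sp uK \<otimes>\<^bsub>Z\<^esub> y) = \<zeta> powi N * hz N y" "hz N (sp (kbin 0 l) \<otimes>\<^bsub>Z\<^esub> y) = gz N l * hz N y" by blast+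
qed

lemma hz_one: "hz N \<one>\<^bsub>Z\<^esub> = 1"
  using hz_sp[OF Lt_one, of N] by (simp add: sp_one is_hwfD[OF is_hwf_hwf])

text \<open>The generators act from the left by scalars under f_N. Hence the left factor alone must
  lie in \<open>U0\<close>, and the right one may be any element of the specialization.\<close>

lemma hz_mult: "x \<in> U0 \<Longrightarrow> y \<in> carrier Z \<Longrightarrow> hz N (x \<otimes>\<^bsub>Z\<^esub> y) = hz N x * hz N y"
proof (induction arbitrary: y rule: U0_induct)
  case (gen x)
  have c: "sp uK \<in> carrier Z" "sp (kbin 0 l) \<in> carrier Z" by (simp_all add: Lt_gens kbin_Lt)
  have "hz N (sp uK) = \<zeta> powi N" "hz N (sp (kbin 0 l)) = gz N l"
    using hz_K[OF Z.one_closed, of N] hz_b[OF Z.one_closed, of N] c by (simp_all add: hz_one)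
  then show ?case using gen hz_K hz_b by auto
next
  case (add x x')
  then show ?case by (simp add: Z.l_distr semilin_add[OF hz_lin] U0_closed distrib_right)
next
  case (mult x x')
  then show ?case by (simp add: Z.m_assoc U0_closed)
next
  case (smult x r)
  then show ?case by (simp add: Z.smult_mult_l semilin_smult[OF hz_lin] U0_closed)
qed (simp add: hz_one)

section \<open>The small subalgebra as an algebra, and the Fourier correction term\<close>

abbreviation "A \<equiv> Uz0 \<zeta> l"

lemma Uz0_eq: "A = Z\<lparr>carrier := U0\<rparr>"
  using carrier_Uz0 by (simp add: Uz0_def)

lemma Uz0_simps [simp]:
  "x \<oplus>\<^bsub>A\<^esub> y = x \<oplus>\<^bsub>Z\<^esub> y" "x \<otimes>\<^bsub>A\<^esub> y = x \<otimes>\<^bsub>Z\<^esub> y" "\<one>\<^bsub>A\<^esub> = \<one>\<^bsub>Z\<^esub>" "\<zero>\<^bsub>A\<^esub> = \<zero>\<^bsub>Z\<^esub>" "c \<odot>\<^bsub>A\<^esub> x = c \<odot>\<^bsub>Z\<^esub> x"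
  "carrier A = U0"
  by (simp_all add: Uz0_eq)

sublocale A: algebra_over A
  unfolding Uz0_eq by (rule carrier_update_is_algebra[OF Z_algebra]) (use U0_closed U0_intros in auto)

lemma U0_power: "x \<in> U0 \<Longrightarrow> x [^]\<^bsub>A\<^esub> (n::nat) \<in> U0"
  using A.nat_pow_closed[of x n] by simp

lemma U0_finsum: "g \<in> F \<rightarrow> U0 \<Longrightarrow> finsum A g F \<in> U0"
  using A.finsum_closed[of g F] by simp

lemma hz_lin_A: "lin A (hz N)"
  using hz_lin[of N] U0_closed by (simp add: semilin_def)

lemma hz_power: "x \<in> U0 \<Longrightarrow> hz N (x [^]\<^bsub>A\<^esub> (n::nat)) = hz N x ^ n"
  by (induction n) (simp_all add: hz_one hz_mult U0_power U0_closed mult.commute)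

text \<open>The Fourier coefficients of the function (n mod l) / l on Z/l.\<close>

definition fourier :: "nat \<Rightarrow> 'k" where
  "fourier i = (1 / of_nat l ^ 2) * (\<Sum>j<l. of_nat j * \<zeta> powi (- int (i * j)))"

definition qK :: "'k uz" where
  "qK = (\<Oplus>\<^bsub>A\<^esub>i\<in>{..<l}. fourier i \<odot>\<^bsub>A\<^esub> (sp uK [^]\<^bsub>A\<^esub> i))"

definition prim :: "'k uz" where
  "prim = sp (kbin 0 l) \<oplus>\<^bsub>A\<^esub> qK"

lemma qK_U0: "qK \<in> U0"
  unfolding qK_def by (rule U0_finsum) (simp add: U0_intros U0_power)

lemma prim_U0: "prim \<in> U0"
  using U0_intros(2) qK_U0 U0_intros(4) by (simp add: prim_def)

lemma hz_sp_K: "hz N (sp uK) = \<zeta> powi N" and hz_sp_b: "hz N (sp (kbin 0 l)) = gz N l"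
  using hz_K[OF Z.one_closed, of N] hz_b[OF Z.one_closed, of N] by (simp_all add: hz_one Lt_gens kbin_Lt)

lemma fourier_sum: "(\<Sum>i<l. fourier i * \<zeta> ^ (n * i)) = of_nat (n mod l) / of_nat l"
proof -
  have l0: "(of_nat l :: 'k) \<noteq> 0" using l_gt_1 by simp
  have "(\<Sum>i<l. fourier i * \<zeta> ^ (n * i)) = 1 / of_nat l ^ 2 * (\<Sum>i<l. \<Sum>j<l. of_nat j * \<zeta> powi (int i * (int n - int j)))"
    unfolding fourier_def sum_distrib_left sum_distrib_right
  proof (intro sum.cong refl)
    fix i j
    have "int i * (int n - int j) = - int (i * j) + int (n * i)" by (simp add: algebra_simps)
    then have "\<zeta> powi (int i * (int n - int j)) = \<zeta> powi (- int (i * j)) * \<zeta> ^ (n * i)"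
      by (simp only: power_int_add[OF disjI1[OF zeta_neq_zero]] power_int_of_nat)
    then show "1 / of_nat l ^ 2 * (of_nat j * \<zeta> powi (- int (i * j))) * \<zeta> ^ (n * i) = 1 / of_nat l ^ 2 * (of_nat j * \<zeta> powi (int i * (int n - int j)))"
      by (simp add: mult.assoc)
  qed
  also have "(\<Sum>i<l. \<Sum>j<l. of_nat j * \<zeta> powi (int i * (int n - int j))) = (\<Sum>j<l. of_nat j * (\<Sum>i<l. \<zeta> powi (int i * (int n - int j))))"
    by (subst sum.swap) (simp add: sum_distrib_left)
  \<comment> \<open>By orthogonality of characters the sum over i is l at j = n mod l and 0
    elsewhere. This l cancels one of the two in 1 / l^2.\<close>
  also have "\<dots> = (\<Sum>j<l. if j = n mod l then of_nat j * of_nat l else 0)"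
  proof (intro sum.cong refl)
    fix j assume "j \<in> {..<l}"
    then have "int l dvd int n - int j \<longleftrightarrow> j = n mod l"
      by (auto simp: mod_eq_dvd_iff[symmetric] simp flip: of_nat_mod)
    then show "of_nat j * (\<Sum>i<l. \<zeta> powi (int i * (int n - int j))) = (if j = n mod l then of_nat j * of_nat l else 0)"
      by (simp add: zeta_sum)
  qed
  also have "\<dots> = of_nat (n mod l) * of_nat l" using l_gt_1 by simp
  finally show ?thesis using l0 by (simp add: power2_eq_square)
qed

lemma hz_prim: "hz (int n) prim = of_nat n / of_nat l"
proof -
  have "(\<lambda>i. fourier i \<odot>\<^bsub>A\<^esub> (sp uK [^]\<^bsub>A\<^esub> i)) \<in> {..<l} \<rightarrow> carrier A"
    by (simp add: U0_intros U0_power)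
  then have "hz (int n) qK = (\<Sum>i<l. hz (int n) (fourier i \<odot>\<^bsub>A\<^esub> (sp uK [^]\<^bsub>A\<^esub> i)))"
    unfolding qK_def by (rule A.lin_finsum[OF hz_lin_A])
  also have "\<dots> = (\<Sum>i<l. fourier i * \<zeta> ^ (n * i))"
    by (intro sum.cong refl) (simp add: semilin_smult[OF hz_lin] U0_closed U0_power U0_intros hz_power hz_sp_K power_mult)
  finally have "hz (int n) prim = of_nat (n div l) + of_nat (n mod l) / of_nat l"
    using qK_U0 U0_closed by (simp add: prim_def semilin_add[OF hz_lin] U0_intros hz_sp_b gz_l fourier_sum)
  also have "\<dots> = of_nat (l * (n div l) + n mod l) / of_nat l"
    using l_gt_1 by (simp only: of_nat_add of_nat_mult) (simp add: field_simps)
  finally show ?thesis by simp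
qed

end


context root_of_unity
begin

subsection \<open>A basis of the subalgebra and separation of its elements\<close>

text \<open>The index k = j l + i encodes the pair (i, j). With p in place of b, f_n takes the value
  \<zeta>^(n i) (n / l)^j, a character of Z/l times a monomial, which makes independence a question
  about polynomials and Fourier sums.\<close>

definition bas :: "nat \<Rightarrow> 'k uz" where
  "bas k = sp uK [^]\<^bsub>A\<^esub> (k mod l) \<otimes>\<^bsub>A\<^esub> prim [^]\<^bsub>A\<^esub> (k div l)"

lemma bas_U0: "bas k \<in> U0"
  unfolding bas_def by (simp add: U0_intros U0_power prim_U0)

lemma bas_closed [simp]: "bas k \<in> carrier Z"
  by (rule U0_closed[OF bas_U0])

lemma hz_bas: "hz (int n) (bas k) = \<zeta> ^ (n * (k mod l)) * (of_nat n / of_nat l) ^ (k div l)"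
  unfolding bas_def
  by (simp add: hz_mult U0_closed U0_power U0_intros prim_U0 hz_power hz_sp_K hz_prim power_mult)

inductive_set span0 :: "'k uz set" where
  zero: "\<zero>\<^bsub>Z\<^esub> \<in> span0"
| step: "w \<in> span0 \<Longrightarrow> c \<odot>\<^bsub>Z\<^esub> bas k \<oplus>\<^bsub>Z\<^esub> w \<in> span0"

lemma span0_closed: "w \<in> span0 \<Longrightarrow> w \<in> carrier Z"
  by (induction rule: span0.induct) simp_all

lemma span0_bas: "bas k \<in> span0"
  using span0.step[OF span0.zero, of 1 k] by simp

lemma span0_add: "v \<in> span0 \<Longrightarrow> w \<in> span0 \<Longrightarrow> v \<oplus>\<^bsub>Z\<^esub> w \<in> span0"
proof (induction rule: span0.induct)
  case (step v c k)
  then show ?case using span0.step[of "v \<oplus>\<^bsub>Z\<^esub> w" c k] by (simp add: Z.a_assoc span0_closed)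
qed (simp add: span0_closed)

lemma span0_smult: "w \<in> span0 \<Longrightarrow> c \<odot>\<^bsub>Z\<^esub> w \<in> span0"
proof (induction rule: span0.induct)
  case (step v d k)
  then show ?case using span0.step[of "c \<odot>\<^bsub>Z\<^esub> v" "c * d" k]
    by (simp add: Z.smult_r_distr span0_closed Z.smult_assoc)
qed (simp add: span0.zero)

lemma K_comm: "x \<in> U0 \<Longrightarrow> sp uK \<otimes>\<^bsub>Z\<^esub> x = x \<otimes>\<^bsub>Z\<^esub> sp uK"
proof (induction rule: U0_induct)
  case (gen x)
  have "sp uK \<otimes>\<^bsub>Z\<^esub> sp (kbin 0 l) = sp (kbin 0 l) \<otimes>\<^bsub>Z\<^esub> sp uK"
    by (simp add: Lt_gens kbin_Lt kbin_comm flip: sp_mult)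
  then show ?case using gen by auto
next
  case (add x y) then show ?case by (simp add: Z.l_distr Z.r_distr U0_closed U0_intros)
next
  case (mult x y)
  have "sp uK \<otimes>\<^bsub>Z\<^esub> (x \<otimes>\<^bsub>Z\<^esub> y) = (sp uK \<otimes>\<^bsub>Z\<^esub> x) \<otimes>\<^bsub>Z\<^esub> y"
    using mult.hyps by (simp add: Z.m_assoc U0_closed U0_intros)
  also have "\<dots> = x \<otimes>\<^bsub>Z\<^esub> (sp uK \<otimes>\<^bsub>Z\<^esub> y)" using mult by (simp add: Z.m_assoc U0_closed U0_intros)
  finally show ?case using mult by (simp add: Z.m_assoc U0_closed U0_intros)
next
  case (smult x r) then show ?case by (simp add: Z.smult_mult_l Z.smult_mult_r U0_closed U0_intros)
qed (simp add: U0_closed U0_intros)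

lemma K_pow_A: "sp uK [^]\<^bsub>A\<^esub> l = \<one>\<^bsub>Z\<^esub>"
proof -
  have "sp uK [^]\<^bsub>A\<^esub> n = sp (uK ^ n)" for n :: nat
    by (induction n) (simp_all add: sp_one Lt_gens Lt_power power_Suc2 sp_mult del: power_Suc)
  then show ?thesis by (simp add: sp_K_power)
qed

lemma K_power_comm: "x \<in> U0 \<Longrightarrow> x \<otimes>\<^bsub>Z\<^esub> (sp uK [^]\<^bsub>A\<^esub> (a::nat)) = sp uK [^]\<^bsub>A\<^esub> a \<otimes>\<^bsub>Z\<^esub> x"
proof (induction a)
  case (Suc a)
  have k: "sp uK [^]\<^bsub>A\<^esub> a \<in> carrier Z" "sp uK \<in> carrier Z" "x \<in> carrier Z"
    using Suc.prems by (simp_all add: U0_closed U0_power U0_intros)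
  have "x \<otimes>\<^bsub>Z\<^esub> (sp uK [^]\<^bsub>A\<^esub> a \<otimes>\<^bsub>Z\<^esub> sp uK) = (sp uK [^]\<^bsub>A\<^esub> a \<otimes>\<^bsub>Z\<^esub> x) \<otimes>\<^bsub>Z\<^esub> sp uK"
    using Suc k by (simp flip: Z.m_assoc)
  then show ?case using k K_comm[OF Suc.prems] by (simp add: Z.m_assoc)
qed (simp add: U0_closed)

text \<open>The elements that map the span into itself by left multiplication form a subalgebra. It
  contains K, whose powers wrap around by K^l = 1, and p, which shifts the index by l. Hence it
  contains \<open>qK\<close> and finally b = p - \<open>qK\<close>.\<close>

lemma span0_mult:
  assumes "x \<in> U0" shows "\<forall>w\<in>span0. x \<otimes>\<^bsub>Z\<^esub> w \<in> span0"
proof -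
  define I where "I = {x \<in> U0. \<forall>w\<in>span0. x \<otimes>\<^bsub>Z\<^esub> w \<in> span0}"
  have I_gen: "x \<in> I" if x: "x \<in> U0" "\<And>k. x \<otimes>\<^bsub>Z\<^esub> bas k \<in> span0" for x
  proof -
    have "x \<otimes>\<^bsub>Z\<^esub> w \<in> span0" if "w \<in> span0" for w
      using that
    proof (induction rule: span0.induct)
      case (step w c k)
      then show ?case using x
        by (simp add: Z.r_distr Z.smult_mult_r U0_closed span0_closed span0_add span0_smult)
    qed (use x in \<open>simp add: U0_closed span0.zero\<close>)
    with x show ?thesis by (simp add: I_def)
  qed
  have I_add: "x \<oplus>\<^bsub>Z\<^esub> y \<in> I" if "x \<in> I" "y \<in> I" for x y
    using that by (simp add: I_def Z.l_distr U0_closed span0_closed span0_add U0_intros)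
  have I_mult: "x \<otimes>\<^bsub>Z\<^esub> y \<in> I" if "x \<in> I" "y \<in> I" for x y
    using that by (simp add: I_def Z.m_assoc U0_closed span0_closed U0_intros)
  have I_smult: "c \<odot>\<^bsub>Z\<^esub> x \<in> I" if "x \<in> I" for x c
    using that by (simp add: I_def Z.smult_mult_l U0_closed span0_closed span0_smult U0_intros)
  have I_one: "\<one>\<^bsub>Z\<^esub> \<in> I" by (simp add: I_def U0_intros span0_closed)
  have l0: "l > 0" using l_gt_1 by simp
  have c: "sp uK \<in> carrier Z" "prim \<in> carrier Z" "sp uK [^]\<^bsub>A\<^esub> (n::nat) \<in> carrier Z" "prim [^]\<^bsub>A\<^esub> (n::nat) \<in> carrier Z" for n
    by (simp_all add: U0_closed U0_power U0_intros prim_U0)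
  have I_K: "sp uK \<in> I"
  proof (rule I_gen)
    fix k
    have pw: "sp uK \<otimes>\<^bsub>Z\<^esub> bas k = sp uK [^]\<^bsub>A\<^esub> Suc (k mod l) \<otimes>\<^bsub>Z\<^esub> prim [^]\<^bsub>A\<^esub> (k div l)"
      using c K_comm[OF U0_power[OF U0_intros(1), of "k mod l"]] by (simp add: bas_def flip: Z.m_assoc)
    show "sp uK \<otimes>\<^bsub>Z\<^esub> bas k \<in> span0"
    proof (cases "Suc (k mod l) = l")
      case True
      have "sp uK \<otimes>\<^bsub>Z\<^esub> bas k = sp uK [^]\<^bsub>A\<^esub> l \<otimes>\<^bsub>Z\<^esub> prim [^]\<^bsub>A\<^esub> (k div l)"
        using pw by (simp only: True)
      also have "\<dots> = bas (l * (k div l))" using l0 c by (simp add: K_pow_A bas_def)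
      finally show ?thesis by (simp add: span0_bas)
    next
      case False
      then have "Suc k mod l = Suc (k mod l)" "Suc k div l = k div l"
        by (simp_all add: mod_Suc div_Suc)
      then have "bas (Suc k) = sp uK [^]\<^bsub>A\<^esub> Suc (k mod l) \<otimes>\<^bsub>Z\<^esub> prim [^]\<^bsub>A\<^esub> (k div l)"
        by (simp only: bas_def Uz0_simps)
      then have "sp uK \<otimes>\<^bsub>Z\<^esub> bas k = bas (Suc k)" by (simp only: pw)
      then show ?thesis by (simp add: span0_bas)
    qed
  qed (rule U0_intros)
  have I_prim: "prim \<in> I"
  proof (rule I_gen)
    fix k
    have "prim \<otimes>\<^bsub>Z\<^esub> prim [^]\<^bsub>A\<^esub> (n::nat) = prim [^]\<^bsub>A\<^esub> Suc n" for n
      using A.nat_pow_Suc2[of prim n] prim_U0 by simp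
    moreover have "prim \<otimes>\<^bsub>Z\<^esub> bas k = sp uK [^]\<^bsub>A\<^esub> (k mod l) \<otimes>\<^bsub>Z\<^esub> (prim \<otimes>\<^bsub>Z\<^esub> prim [^]\<^bsub>A\<^esub> (k div l))"
      using c K_power_comm[OF prim_U0, of "k mod l"] by (simp add: bas_def flip: Z.m_assoc)
    moreover have "(k + l) mod l = k mod l" "(k + l) div l = Suc (k div l)" using l0 by simp_all
    ultimately have "prim \<otimes>\<^bsub>Z\<^esub> bas k = bas (k + l)" unfolding bas_def by (simp only: Uz0_simps)
    then show "prim \<otimes>\<^bsub>Z\<^esub> bas k \<in> span0" by (simp add: span0_bas)
  qed (rule prim_U0)
  have I_K_power: "sp uK [^]\<^bsub>A\<^esub> (n::nat) \<in> I" for n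
    by (induction n) (simp_all add: I_one I_mult I_K)
  have I_sum: "finsum A g F \<in> I" if "g \<in> F \<rightarrow> I" "finite F" for g and F :: "nat set"
    using that(2,1)
  proof (induction F)
    case empty
    have "\<zero>\<^bsub>Z\<^esub> = 0 \<odot>\<^bsub>Z\<^esub> \<one>\<^bsub>Z\<^esub>" by simp
    then show ?case using I_smult[OF I_one, of 0] by simp
  next
    case (insert x F)
    moreover have "I \<subseteq> carrier A" unfolding I_def Uz0_simps by blast
    ultimately have "finsum A g (insert x F) = g x \<oplus>\<^bsub>A\<^esub> finsum A g F"
      by (intro A.finsum_insert) blast+
    moreover have "g x \<in> I" "finsum A g F \<in> I" using insert by simp_all
    ultimately show ?case by (simp add: I_add)
  qed
  have I_q: "qK \<in> I" unfolding qK_def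
    by (rule I_sum) (simp_all add: I_smult I_K_power)
  have "sp (kbin 0 l) = prim \<oplus>\<^bsub>Z\<^esub> (- 1) \<odot>\<^bsub>Z\<^esub> qK"
    using U0_closed[OF qK_U0] U0_closed[OF U0_intros(2)]
    by (simp add: prim_def Z.smult_minus_one Z.a_assoc Z.r_neg)
  then have I_b: "sp (kbin 0 l) \<in> I" by (simp add: I_add I_smult I_q I_prim)
  have "x \<in> I" using assms
  proof (induction rule: U0_induct)
    case (gen x) then show ?case using I_K I_b by blast
  qed (simp_all add: I_one I_add I_mult I_smult)
  then show ?thesis by (simp add: I_def)
qed

lemma U0_subset_span0: "x \<in> U0 \<Longrightarrow> x \<in> span0"
proof -
  assume x: "x \<in> U0"
  have "bas 0 = \<one>\<^bsub>Z\<^esub>" by (simp add: bas_def)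
  then have "\<one>\<^bsub>Z\<^esub> \<in> span0" using span0_bas[of 0] by simp
  then show ?thesis using span0_mult[OF x] U0_closed[OF x] by fastforce
qed

lemma U0_zero: "\<zero>\<^bsub>Z\<^esub> \<in> U0"
  using A.zero_closed by simp

lemma finsum_A_zero: "(\<Oplus>\<^bsub>A\<^esub>i\<in>F. \<zero>\<^bsub>Z\<^esub>) = \<zero>\<^bsub>Z\<^esub>"
  by (rule A.finsum_zero[unfolded Uz0_simps])

lemma finsum_A_single:
  fixes k M :: nat
  assumes "k < M" "x \<in> U0"
  shows "(\<Oplus>\<^bsub>A\<^esub>i\<in>{..<M}. if k = i then x else \<zero>\<^bsub>Z\<^esub>) = x"
  using A.finsum_singleton[of k "{..<M}" "\<lambda>_. x", unfolded Uz0_simps] assms by simp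

text \<open>The expansion is stated for every sufficiently large \<open>M\<close>, so that two
  expansions can be added over a common range.\<close>

lemma span0_coeffs:
  assumes "w \<in> span0"
  shows "\<exists>N c. \<forall>M\<ge>N. w = (\<Oplus>\<^bsub>A\<^esub>k\<in>{..<M}. c k \<odot>\<^bsub>Z\<^esub> bas k)"
  using assms
proof (induction rule: span0.induct)
  case zero
  have "\<forall>M\<ge>0. \<zero>\<^bsub>Z\<^esub> = (\<Oplus>\<^bsub>A\<^esub>k\<in>{..<M}. 0 \<odot>\<^bsub>Z\<^esub> bas k)"
    by (simp add: finsum_A_zero)
  then show ?case by (intro exI[of _ 0] exI[of _ "\<lambda>_. 0"])
next
  case (step w d j)
  then obtain N c where N: "\<And>M. M \<ge> N \<Longrightarrow> w = (\<Oplus>\<^bsub>A\<^esub>k\<in>{..<M}. c k \<odot>\<^bsub>Z\<^esub> bas k)" by blast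
  have "d \<odot>\<^bsub>Z\<^esub> bas j \<oplus>\<^bsub>Z\<^esub> w = (\<Oplus>\<^bsub>A\<^esub>k\<in>{..<M}. ((if j = k then d else 0) + c k) \<odot>\<^bsub>Z\<^esub> bas k)"
    if M: "M \<ge> max N (Suc j)" for M
  proof -
    have "d \<odot>\<^bsub>Z\<^esub> bas j = (\<Oplus>\<^bsub>A\<^esub>k\<in>{..<M}. if j = k then d \<odot>\<^bsub>Z\<^esub> bas j else \<zero>\<^bsub>Z\<^esub>)"
      using M bas_U0 by (subst finsum_A_single) (simp_all add: U0_intros)
    also have "\<dots> = (\<Oplus>\<^bsub>A\<^esub>k\<in>{..<M}. (if j = k then d else 0) \<odot>\<^bsub>Z\<^esub> bas k)"
      by (rule A.finsum_cong') (auto simp: U0_intros bas_U0)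
    finally have "d \<odot>\<^bsub>Z\<^esub> bas j \<oplus>\<^bsub>Z\<^esub> w = (\<Oplus>\<^bsub>A\<^esub>k\<in>{..<M}. (if j = k then d else 0) \<odot>\<^bsub>Z\<^esub> bas k) \<oplus>\<^bsub>A\<^esub> (\<Oplus>\<^bsub>A\<^esub>k\<in>{..<M}. c k \<odot>\<^bsub>Z\<^esub> bas k)"
      using N[of M] M by simp
    also have "\<dots> = (\<Oplus>\<^bsub>A\<^esub>k\<in>{..<M}. (if j = k then d else 0) \<odot>\<^bsub>Z\<^esub> bas k \<oplus>\<^bsub>A\<^esub> c k \<odot>\<^bsub>Z\<^esub> bas k)"
      by (rule A.finsum_addf[symmetric]) (simp_all add: U0_intros bas_U0)
    finally show ?thesis by (simp add: Z.smult_l_distr)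
  qed
  then show ?case by (intro exI[of _ "max N (Suc j)"] exI[of _ "\<lambda>k. (if j = k then d else 0) + c k"]) blast
qed

text \<open>For n = r + l m the characters depend on r alone, while n / l = r / l + m takes
  infinitely many values. The polynomial in n / l with coefficients \<open>d r b\<close> therefore
  vanishes, and Fourier inversion in r recovers the individual \<open>c k\<close>.\<close>

lemma independent:
  assumes e: "\<And>n. (\<Sum>k<M. c k * (\<zeta> ^ (n * (k mod l)) * (of_nat n / of_nat l) ^ (k div l))) = 0" and k: "k < M"
  shows "c k = 0"
proof -
  have l0: "l > 0" using l_gt_1 by simp
  \<comment> \<open>Extension by zero allows the sum to be cut into \<open>M\<close> complete blocks
    of length l.\<close>
  define c' where "c' k = (if k < M then c k else 0)" for k
  define d where "d r b = (\<Sum>a<l. c' (b * l + a) * \<zeta> ^ (r * a))" for r b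
  have "poly (\<Sum>b<M. monom (d r b) b) (of_nat r / of_nat l + of_nat m) = 0" for r m
  proof -
    define n where "n = r + l * m"
    have "0 = (\<Sum>k<M. c' k * (\<zeta> ^ (n * (k mod l)) * (of_nat n / of_nat l) ^ (k div l)))"
      using e[of n] by (simp add: c'_def)
    also have "\<dots> = (\<Sum>k<M * l. c' k * (\<zeta> ^ (n * (k mod l)) * (of_nat n / of_nat l) ^ (k div l)))"
      using l0 by (intro sum.mono_neutral_left) (auto simp: c'_def intro: order_less_le_trans)
    also have "\<dots> = (\<Sum>b<M. \<Sum>k=b * l..<b * l + l. c' k * (\<zeta> ^ (n * (k mod l)) * (of_nat n / of_nat l) ^ (k div l)))"
      by (rule sum.nat_group[symmetric])
    also have "\<dots> = (\<Sum>b<M. \<Sum>a<l. c' (b * l + a) * (\<zeta> ^ (n * a) * (of_nat n / of_nat l) ^ b))"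
    proof (rule sum.cong[OF refl])
      fix b
      have "(\<Sum>k=b * l..<b * l + l. c' k * (\<zeta> ^ (n * (k mod l)) * (of_nat n / of_nat l) ^ (k div l)))
         = (\<Sum>a=0..<l. c' (a + b * l) * (\<zeta> ^ (n * ((a + b * l) mod l)) * (of_nat n / of_nat l) ^ ((a + b * l) div l)))"
        using sum.shift_bounds_nat_ivl[of "\<lambda>k. c' k * (\<zeta> ^ (n * (k mod l)) * (of_nat n / of_nat l) ^ (k div l))" 0 "b * l" l]
        by (simp add: add.commute)
      also have "\<dots> = (\<Sum>a<l. c' (b * l + a) * (\<zeta> ^ (n * a) * (of_nat n / of_nat l) ^ b))"
        unfolding atLeast0LessThan by (intro sum.cong refl) (simp add: add.commute)
      finally show "(\<Sum>k=b * l..<b * l + l. c' k * (\<zeta> ^ (n * (k mod l)) * (of_nat n / of_nat l) ^ (k div l)))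
         = (\<Sum>a<l. c' (b * l + a) * (\<zeta> ^ (n * a) * (of_nat n / of_nat l) ^ b))" .
    qed
    also have "\<dots> = (\<Sum>b<M. d r b * (of_nat r / of_nat l + of_nat m) ^ b)"
    proof (intro sum.cong refl)
      fix b
      have "(of_nat n / of_nat l :: 'k) = of_nat r / of_nat l + of_nat m" using l0 by (simp add: n_def field_simps)
      moreover have "\<zeta> ^ (n * a) = \<zeta> ^ (r * a)" for a
      proof -
        have "n * a = r * a + l * (m * a)" by (simp add: n_def algebra_simps)
        then show ?thesis by (simp only: power_add power_mult zeta_l power_one mult_1_right)
      qed
      ultimately show "(\<Sum>a<l. c' (b * l + a) * (\<zeta> ^ (n * a) * (of_nat n / of_nat l) ^ b)) = d r b * (of_nat r / of_nat l + of_nat m) ^ b"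
        by (simp add: d_def sum_distrib_right mult.assoc)
    qed
    finally show ?thesis by (simp add: poly_sum poly_monom)
  qed
  then have "range (\<lambda>m. of_nat r / of_nat l + of_nat m :: 'k) \<subseteq> {x. poly (\<Sum>b<M. monom (d r b) b) x = 0}" for r
    by blast
  moreover have "infinite (range (\<lambda>m. of_nat r / of_nat l + of_nat m :: 'k))" for r
    by (intro range_inj_infinite injI) simp
  ultimately have "(\<Sum>b<M. monom (d r b) b) = 0" for r
    using poly_roots_finite[of "\<Sum>b<M. monom (d r b) b"] finite_subset by blast
  then have c0: "coeff (\<Sum>b<M. monom (d r b) b) b = 0" for r b by simp
  have d0: "d r b = 0" if "b < M" for r b
  proof -
    have "coeff (\<Sum>b<M. monom (d r b) b) b = (\<Sum>b'<M. if b' = b then d r b' else 0)" by (simp add: coeff_sum)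
    then show ?thesis using c0[of r b] that by simp
  qed
  have "k div l < M" using k by (rule order_le_less_trans[OF div_le_dividend])
  \<comment> \<open>Fourier inversion: only the residue a = k mod l survives the summation over r,
    with weight l.\<close>
  then have "0 = (\<Sum>r<l. \<zeta> powi (- int (r * (k mod l))) * d r (k div l))" by (simp add: d0)
  also have "\<dots> = (\<Sum>r<l. \<Sum>a<l. c' (k div l * l + a) * \<zeta> powi (int r * (int a - int (k mod l))))"
    unfolding d_def sum_distrib_left
  proof (intro sum.cong refl)
    fix r a
    have "int r * (int a - int (k mod l)) = - int (r * (k mod l)) + int (r * a)" by (simp add: algebra_simps)
    then have "\<zeta> powi (int r * (int a - int (k mod l))) = \<zeta> powi (- int (r * (k mod l))) * \<zeta> ^ (r * a)"
      by (simp only: power_int_add[OF disjI1[OF zeta_neq_zero]] power_int_of_nat)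
    then show "\<zeta> powi (- int (r * (k mod l))) * (c' (k div l * l + a) * \<zeta> ^ (r * a)) = c' (k div l * l + a) * \<zeta> powi (int r * (int a - int (k mod l)))"
      by simp
  qed
  also have "\<dots> = (\<Sum>a<l. c' (k div l * l + a) * (\<Sum>r<l. \<zeta> powi (int r * (int a - int (k mod l)))))"
    by (subst sum.swap) (simp add: sum_distrib_left)
  also have "\<dots> = (\<Sum>a<l. if a = k mod l then c' (k div l * l + a) * of_nat l else 0)"
  proof (intro sum.cong refl)
    fix a assume "a \<in> {..<l}"
    then have "int l dvd int a - int (k mod l) \<longleftrightarrow> a = k mod l"
      by (auto simp: mod_eq_dvd_iff[symmetric] simp flip: of_nat_mod)
    then show "c' (k div l * l + a) * (\<Sum>r<l. \<zeta> powi (int r * (int a - int (k mod l)))) = (if a = k mod l then c' (k div l * l + a) * of_nat l else 0)"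
      by (simp add: zeta_sum)
  qed
  also have "\<dots> = c' k * of_nat l" using l0 by simp
  finally show ?thesis using l0 k by (simp add: c'_def)
qed

section \<open>Separation of elements and of tensors by the functionals\<close>

lemma U0_separated:
  assumes x: "x \<in> U0" and hz: "\<And>n. hz (int n) x = 0"
  shows "x = \<zero>\<^bsub>Z\<^esub>"
proof -
  obtain M c where c: "x = (\<Oplus>\<^bsub>A\<^esub>k\<in>{..<M}. c k \<odot>\<^bsub>Z\<^esub> bas k)"
    using span0_coeffs[OF U0_subset_span0[OF x]] by blast
  have "hz (int n) x = (\<Sum>k<M. c k * hz (int n) (bas k))" for n
    unfolding c by (subst A.lin_finsum[OF hz_lin_A]) (simp_all add: U0_intros bas_U0 semilin_smult[OF hz_lin])
  then have "c k = 0" if "k < M" for k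
    using independent[of c M k] hz that by (simp add: hz_bas)
  then have "x = (\<Oplus>\<^bsub>A\<^esub>k\<in>{..<M}. \<zero>\<^bsub>A\<^esub>)"
    unfolding c by (intro A.finsum_cong') (simp_all add: U0_zero)
  then show ?thesis by (simp add: finsum_A_zero)
qed

text \<open>Only the left factors are expanded; the right ones remain arbitrary elements of
  \<open>U0\<close>. No uniqueness of the expansion is needed for separation.\<close>

lemma tensor_square_coeffs:
  assumes "t \<in> uz_tensor_square \<zeta> l U0"
  shows "\<exists>N w. (\<forall>k. w k \<in> U0) \<and> (\<forall>M\<ge>N. t = (\<Oplus>\<^bsub>T\<^esub>k\<in>{..<M}. tens Z Z (bas k) (w k)))"
proof -
  let ?P = "\<lambda>t. \<exists>N w. (\<forall>k. w k \<in> U0) \<and> (\<forall>M\<ge>N. t = (\<Oplus>\<^bsub>T\<^esub>k\<in>{..<M}. tens Z Z (bas k) (w k)))"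
  note tc = tens_closed[OF Z_algebra Z_algebra]
  have tz: "tens Z Z x \<zero>\<^bsub>Z\<^esub> = \<zero>\<^bsub>T\<^esub>" if "x \<in> carrier Z" for x
    using tens_smult(2)[OF Z_algebra Z_algebra that Z.zero_closed, of 0] tc[OF that Z.zero_closed] by simp
  have P_zero: "?P \<zero>\<^bsub>T\<^esub>"
    by (intro exI[of _ 0] exI[of _ "\<lambda>_. \<zero>\<^bsub>Z\<^esub>"]) (simp add: U0_zero tz)
  have P_add: "?P (s \<oplus>\<^bsub>T\<^esub> t)" if "?P s" "?P t" for s t
  proof -
    obtain N v where v: "\<forall>k. v k \<in> U0" "\<forall>M\<ge>N. s = (\<Oplus>\<^bsub>T\<^esub>k\<in>{..<M}. tens Z Z (bas k) (v k))" using \<open>?P s\<close> by blast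
    obtain N' w where w: "\<forall>k. w k \<in> U0" "\<forall>M\<ge>N'. t = (\<Oplus>\<^bsub>T\<^esub>k\<in>{..<M}. tens Z Z (bas k) (w k))" using \<open>?P t\<close> by blast
    have c: "v k \<in> carrier Z" "w k \<in> carrier Z" for k using v(1) w(1) U0_closed by blast+
    have "s \<oplus>\<^bsub>T\<^esub> t = (\<Oplus>\<^bsub>T\<^esub>k\<in>{..<M}. tens Z Z (bas k) (v k \<oplus>\<^bsub>Z\<^esub> w k))" if "M \<ge> max N N'" for M
    proof -
      have "s \<oplus>\<^bsub>T\<^esub> t = (\<Oplus>\<^bsub>T\<^esub>k\<in>{..<M}. tens Z Z (bas k) (v k)) \<oplus>\<^bsub>T\<^esub> (\<Oplus>\<^bsub>T\<^esub>k\<in>{..<M}. tens Z Z (bas k) (w k))"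
      proof -
        have "s = (\<Oplus>\<^bsub>T\<^esub>k\<in>{..<M}. tens Z Z (bas k) (v k))" by (rule v(2)[rule_format]) (use that in simp)
        moreover have "t = (\<Oplus>\<^bsub>T\<^esub>k\<in>{..<M}. tens Z Z (bas k) (w k))" by (rule w(2)[rule_format]) (use that in simp)
        ultimately show ?thesis by (rule arg_cong2)
      qed
      also have "\<dots> = (\<Oplus>\<^bsub>T\<^esub>k\<in>{..<M}. tens Z Z (bas k) (v k) \<oplus>\<^bsub>T\<^esub> tens Z Z (bas k) (w k))"
        by (rule T.finsum_addf[symmetric]) (simp_all add: tc c)
      finally show ?thesis by (simp add: tens_add[OF Z_algebra Z_algebra] c)
    qed
    moreover have "\<forall>k. v k \<oplus>\<^bsub>Z\<^esub> w k \<in> U0" using v(1) w(1) U0_intros(4) by blast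
    ultimately show ?thesis
      by (intro exI[of _ "max N N'"] exI[of _ "\<lambda>k. v k \<oplus>\<^bsub>Z\<^esub> w k"]) blast
  qed
  have P_tens: "?P (tens Z Z x y)" if x: "x \<in> span0" and y: "y \<in> U0" for x y
    using x
  proof (induction rule: span0.induct)
    case zero
    have "tens Z Z \<zero>\<^bsub>Z\<^esub> y = \<zero>\<^bsub>T\<^esub>"
      using tens_smult(1)[OF Z_algebra Z_algebra Z.zero_closed U0_closed[OF y], of 0] tc[OF Z.zero_closed U0_closed[OF y]] by simp
    then show ?case using P_zero by (simp only:)
  next
    case (step x d j)
    have "tens Z Z (d \<odot>\<^bsub>Z\<^esub> bas j) y = (\<Oplus>\<^bsub>T\<^esub>k\<in>{..<M}. tens Z Z (bas k) (if j = k then d \<odot>\<^bsub>Z\<^esub> y else \<zero>\<^bsub>Z\<^esub>))"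
      if "M \<ge> Suc j" for M
    proof -
      have "(\<Oplus>\<^bsub>T\<^esub>k\<in>{..<M}. tens Z Z (bas k) (if j = k then d \<odot>\<^bsub>Z\<^esub> y else \<zero>\<^bsub>Z\<^esub>)) =
        (\<Oplus>\<^bsub>T\<^esub>k\<in>{..<M}. if j = k then tens Z Z (bas k) (d \<odot>\<^bsub>Z\<^esub> y) else \<zero>\<^bsub>T\<^esub>)"
        by (rule T.finsum_cong') (auto simp: tz tc U0_closed y)
      also have "\<dots> = tens Z Z (bas j) (d \<odot>\<^bsub>Z\<^esub> y)"
        using that by (intro T.finsum_singleton) (simp_all add: tc U0_closed y)
      finally show ?thesis by (simp add: tens_smult[OF Z_algebra Z_algebra] U0_closed y)
    qed
    moreover have "\<forall>k. (if j = k then d \<odot>\<^bsub>Z\<^esub> y else \<zero>\<^bsub>Z\<^esub>) \<in> U0" using y U0_zero U0_intros(6) by simp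
    ultimately have "?P (tens Z Z (d \<odot>\<^bsub>Z\<^esub> bas j) y)"
      by (intro exI[of _ "Suc j"] exI[of _ "\<lambda>k. if j = k then d \<odot>\<^bsub>Z\<^esub> y else \<zero>\<^bsub>Z\<^esub>"]) blast
    from P_add[OF this step.IH] show ?case
      using step.hyps by (simp only: tens_add(1)[OF Z_algebra Z_algebra] Z.smult_closed[OF bas_closed] span0_closed U0_closed[OF y])
  qed
  obtain ps where ps: "t = tens_sum Z Z ps" "set ps \<subseteq> U0 \<times> U0" using assms unfolding uz_tensor_square_def by blast
  have "?P (tens_sum Z Z ps)" using ps(2)
  proof (induction ps)
    case Nil show ?case using P_zero by (simp only: tens_sum_Nil[OF Z_algebra Z_algebra])
  next
    case (Cons p ps)
    obtain x y where p: "p = (x, y)" "x \<in> U0" "y \<in> U0" using Cons.prems by (cases p) simp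
    have "?P (tens_sum Z Z ps)" using Cons by simp
    from P_add[OF P_tens[OF U0_subset_span0[OF p(2)] p(3)] this]
    show ?case by (simp only: p(1) tens_sum_Cons[OF Z_algebra Z_algebra])
  qed
  then show ?thesis by (simp only: ps(1))
qed

text \<open>For fixed m the numbers f_m (w k) are the coefficients of a vanishing combination, so
  independence kills them. As m varies, separation in \<open>U0\<close> gives w k = 0.\<close>

lemma tensor_square_separated:
  assumes t: "t \<in> uz_tensor_square \<zeta> l U0" and tz: "\<And>n m. tz (int n) (int m) t = 0"
  shows "t = \<zero>\<^bsub>T\<^esub>"
proof -
  obtain M w where w: "\<And>k. w k \<in> U0" "t = (\<Oplus>\<^bsub>T\<^esub>k\<in>{..<M}. tens Z Z (bas k) (w k))"
    using tensor_square_coeffs[OF t] by blast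
  have c: "tens Z Z (bas k) (w k) \<in> carrier T" for k using w(1) by (simp add: tens_closed[OF Z_algebra Z_algebra] U0_closed)
  have e: "(\<Sum>k<M. hz (int m) (w k) * hz (int n) (bas k)) = 0" for n m
  proof -
    have "tz (int n) (int m) t = (\<Sum>k<M. tz (int n) (int m) (tens Z Z (bas k) (w k)))"
      unfolding w(2) by (rule T.lin_finsum[OF tz_lin]) (simp add: c)
    then show ?thesis using tz[of n m] w(1) by (simp add: tz_tens U0_closed mult.commute)
  qed
  have "hz (int m) (w k) = 0" if "k < M" for k m
    using independent[of "\<lambda>k. hz (int m) (w k)" M k, OF _ that] e[of m] by (simp add: hz_bas)
  then have "w k = \<zero>\<^bsub>Z\<^esub>" if "k < M" for k using that U0_separated[OF w(1)] by blast
  moreover have "tens Z Z (bas k) \<zero>\<^bsub>Z\<^esub> = \<zero>\<^bsub>T\<^esub>" for k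
    using tens_smult(2)[OF Z_algebra Z_algebra bas_closed Z.zero_closed, where r = 0] tens_closed[OF Z_algebra Z_algebra bas_closed Z.zero_closed] by simp
  ultimately have "t = (\<Oplus>\<^bsub>T\<^esub>k\<in>{..<M}. \<zero>\<^bsub>T\<^esub>)" unfolding w(2) by (intro T.finsum_cong') simp_all
  then show ?thesis by simp
qed

subsection \<open>Primitive elements\<close>

lemma tensor_square_eqI:
  assumes s: "s \<in> uz_tensor_square \<zeta> l U0" and t: "t \<in> uz_tensor_square \<zeta> l U0"
    and e: "\<And>n m. tz (int n) (int m) s = tz (int n) (int m) t"
  shows "s = t"
proof -
  have c: "s \<in> carrier T" "t \<in> carrier T" using s t tensor_square_closed by blast+
  have "s \<oplus>\<^bsub>T\<^esub> (- 1) \<odot>\<^bsub>T\<^esub> t = \<zero>\<^bsub>T\<^esub>"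
    by (rule tensor_square_separated[OF tensor_square_add[OF s tensor_square_smult[OF t]]])
      (simp add: semilin_add[OF tz_lin] semilin_smult[OF tz_lin] c e)
  then have "s \<ominus>\<^bsub>T\<^esub> t = \<zero>\<^bsub>T\<^esub>" using c by (simp add: T.smult_minus_one T.minus_eq)
  with c show ?thesis by (rule T.eq_if_minus_zero)
qed

text \<open>Justifies the definite description in \<open>uz0_comult\<close>: two values inside the
  tensor square of \<open>U0\<close> agree under all f_n \<otimes> f_m, hence are equal.\<close>

lemma uz0_comult_eq:
  assumes x: "(x, t) \<in> uz_comult \<zeta> l" and t: "t \<in> uz_tensor_square \<zeta> l U0"
  shows "uz0_comult \<zeta> l x = t"
  unfolding uz0_comult_def carrier_Uz0
proof (rule the_equality)
  fix s assume "s \<in> uz_tensor_square \<zeta> l U0 \<and> (x, s) \<in> uz_comult \<zeta> l"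
  then show "s = t" using uz_comult_closed_tz[OF x] uz_comult_closed_tz[of x s] t by (intro tensor_square_eqI) simp_all
qed (use x t in simp)

lemma uz0_primitive_iff:
  "uz0_primitive \<zeta> l x \<longleftrightarrow> x \<in> U0 \<and> (\<forall>n m. hz (int n + int m) x = hz (int n) x + hz (int m) x)"
proof (cases "x \<in> U0")
  case True
  let ?d = "tens Z Z x \<one>\<^bsub>Z\<^esub> \<oplus>\<^bsub>T\<^esub> tens Z Z \<one>\<^bsub>Z\<^esub> x"
  obtain t where t: "t \<in> uz_tensor_square \<zeta> l U0" "(x, t) \<in> uz_comult \<zeta> l" using U0_comult[OF True] by blast
  have xc: "x \<in> carrier Z" using True by (rule U0_closed)
  have "?d = tens_sum Z Z [(x, \<one>\<^bsub>Z\<^esub>), (\<one>\<^bsub>Z\<^esub>, x)]"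
    using xc by (simp add: tens_sum_Cons[OF Z_algebra Z_algebra] tens_sum_Nil[OF Z_algebra Z_algebra] tens_closed[OF Z_algebra Z_algebra])
  then have d: "?d \<in> uz_tensor_square \<zeta> l U0"
    unfolding uz_tensor_square_def using True U0_intros(3) by (intro CollectI exI[of _ "[(x, \<one>\<^bsub>Z\<^esub>), (\<one>\<^bsub>Z\<^esub>, x)]"]) simp
  have "tz n m ?d = hz n x + hz m x" for n m
    using xc by (simp add: semilin_add[OF tz_lin] tz_tens tens_closed[OF Z_algebra Z_algebra] hz_one)
  moreover have "tz n m t = hz (n + m) x" for n m using uz_comult_closed_tz[OF t(2)] by blast
  ultimately have "t = ?d \<longleftrightarrow> (\<forall>n m. hz (int n + int m) x = hz (int n) x + hz (int m) x)"
    using tensor_square_eqI[OF t(1) d] by metis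
  then show ?thesis using uz0_comult_eq[OF t(2,1)] True by (simp add: uz0_primitive_def)
qed (simp add: uz0_primitive_def)

text \<open>The scalar is forced at N = 1, because f_1 p = 1 / l. Additivity then makes both sides
  take the value n f_1 x under f_n for every n, and separation applies.\<close>

lemma primitive_multiple:
  assumes "uz0_primitive \<zeta> l x"
  shows "x = (of_nat l * hz 1 x) \<odot>\<^bsub>Z\<^esub> prim"
proof -
  have x: "x \<in> U0" and add: "\<And>n m. hz (int n + int m) x = hz (int n) x + hz (int m) x"
    using assms by (simp_all add: uz0_primitive_iff)
  have "hz (int n) x = of_nat n * hz 1 x" for n
  proof (induction n)
    case 0 show ?case using add[of 0 0] by simp
  next
    case (Suc n) then show ?case using add[of n 1] by (simp add: algebra_simps)
  qed
  then have "x \<oplus>\<^bsub>Z\<^esub> (- (of_nat l * hz 1 x)) \<odot>\<^bsub>Z\<^esub> prim = \<zero>\<^bsub>Z\<^esub>"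
    using x prim_U0 l_gt_1
    by (intro U0_separated) (simp_all add: U0_intros U0_closed semilin_add[OF hz_lin] semilin_smult[OF hz_lin] hz_prim)
  moreover have "(- (of_nat l * hz 1 x)) \<odot>\<^bsub>Z\<^esub> prim = \<ominus>\<^bsub>Z\<^esub> ((of_nat l * hz 1 x) \<odot>\<^bsub>Z\<^esub> prim)"
    using Z.smult_assoc[OF U0_closed[OF prim_U0], of "- 1" "of_nat l * hz 1 x"] U0_closed[OF prim_U0]
    by (simp add: Z.smult_minus_one)
  ultimately have "x \<ominus>\<^bsub>Z\<^esub> (of_nat l * hz 1 x) \<odot>\<^bsub>Z\<^esub> prim = \<zero>\<^bsub>Z\<^esub>" by (simp only: Z.minus_eq)
  from Z.eq_if_minus_zero[OF U0_closed[OF x] Z.smult_closed[OF U0_closed[OF prim_U0]] this] show ?thesis .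
qed

lemma prim_primitive: "uz0_primitive \<zeta> l prim"
  unfolding uz0_primitive_iff
proof (intro conjI allI)
  fix n m
  have "hz (int n + int m) prim = of_nat (n + m) / of_nat l" using hz_prim[of "n + m"] by simp
  then show "hz (int n + int m) prim = hz (int n) prim + hz (int m) prim"
    by (simp add: hz_prim add_divide_distrib)
qed (rule prim_U0)

lemma prim_neq_zero: "prim \<noteq> \<zero>\<^bsub>Z\<^esub>"
proof
  assume "prim = \<zero>\<^bsub>Z\<^esub>"
  then have "hz (int 1) prim = 0" using Z.lin_zero[OF hz_lin] by simp
  then show False using l_gt_1 by (subst (asm) hz_prim) simp
qed

end

theorem mainTheorem5:
  fixes \<zeta> :: "'k::field_char_0" and l :: nat
  assumes "l > 1" and "odd l"
    and "\<zeta> ^ l = 1" and "\<forall>m. 0 < m \<and> m < l \<longrightarrow> \<zeta> ^ m \<noteq> 1"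
  shows "let A = Uz0 \<zeta> l;
             a = (\<lambda>i::nat. (1 / of_nat l ^ 2) * (\<Sum>j<l. of_nat j * \<zeta> powi (- int (i * j))));
             p = uz_Kbinom \<zeta> l \<oplus>\<^bsub>A\<^esub> (\<Oplus>\<^bsub>A\<^esub>i\<in>{..<l}. a i \<odot>\<^bsub>A\<^esub> (uz_K \<zeta> l [^]\<^bsub>A\<^esub> i))
         in uz0_primitive \<zeta> l p \<and> p \<noteq> \<zero>\<^bsub>A\<^esub> \<and>
            (\<forall>x. uz0_primitive \<zeta> l x \<longrightarrow> (\<exists>c. x = c \<odot>\<^bsub>A\<^esub> p))"
proof -
  interpret root_of_unity \<zeta> l by unfold_locales (use assms in auto)
  have "uz0_primitive \<zeta> l prim \<and> prim \<noteq> \<zero>\<^bsub>A\<^esub> \<and> (\<forall>x. uz0_primitive \<zeta> l x \<longrightarrow> (\<exists>c. x = c \<odot>\<^bsub>A\<^esub> prim))"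
  proof (intro conjI allI impI)
    show "uz0_primitive \<zeta> l prim" by (rule prim_primitive)
    show "prim \<noteq> \<zero>\<^bsub>A\<^esub>" unfolding Uz0_simps by (rule prim_neq_zero)
    fix x assume "uz0_primitive \<zeta> l x"
    from primitive_multiple[OF this] show "\<exists>c. x = c \<odot>\<^bsub>A\<^esub> prim" unfolding Uz0_simps ..
  qed
  then show ?thesis
    unfolding Let_def prim_def qK_def fourier_def uz_K_eq uz_Kbinom_eq .
qed

end
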